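(* Let $\mathcal C\subset \mathbb T^2$ be a smooth curve with nowhere-zero curvature. Then there exist constants $c>0$ and $\lambda_0>0$, depending only on $\mathcal C$, such that for every $\lambda\ge\lambda_0$ and every nonzero real-valued function $F$ on $\mathbb T^2$ with $-\Delta F=\lambda^2F$, $$N_{F,\mathcal C}\ \ge\ c\,\lambda\left(\frac1{\|F\|_2}\int_{\mathcal C}|F|\right)^5 .$$
   Context: $\mathbb T^2=\mathbb R^2/2\pi\mathbb Z^2$ is the standard flat torus and $\Delta$ its Laplacian. The curve $\mathcal C$ is of finite positive length, with a smooth arc-length parameterization $\gamma:[0,L]\to\mathcal C$, and $\int_{\mathcal C}|F|=\int_0^L|F(\gamma(t))|\,dt$. $\|F\|_2^2=\int_{\mathbb T^2}|F(x)|^2dx$. $N_{F,\mathcal C}=\#(\{x: F(x)=0\}\cap\mathcal C)$ is the number of zeros of $F$ on $\mathcal C$ (possibly $\infty$). *)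

theory Defs
  imports "HOL-Analysis.Analysis"
begin

definition lattice_equiv :: "real \<times> real \<Rightarrow> real \<times> real \<Rightarrow> bool" where
  "lattice_equiv x y \<longleftrightarrow>
     (\<exists>m n :: int. y = x + (2 * pi * of_int m, 2 * pi * of_int n))"

lemma equivp_lattice_equiv: "equivp lattice_equiv"
proof (rule equivpI)
  show "reflp lattice_equiv"
    unfolding lattice_equiv_def
    by (intro reflpI exI[of _ "0::int"]) (auto simp: prod_eq_iff)
  show "symp lattice_equiv"
  proof (rule sympI)
    fix x y assume "lattice_equiv x y"
    then obtain m n :: int where "y = x + (2 * pi * of_int m, 2 * pi * of_int n)"
      unfolding lattice_equiv_def by blast
    then have "x = y + (2 * pi * of_int (-m), 2 * pi * of_int (-n))"
      by (auto simp: prod_eq_iff)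
    then show "lattice_equiv y x" unfolding lattice_equiv_def by blast
  qed
  show "transp lattice_equiv"
  proof (rule transpI)
    fix x y z assume "lattice_equiv x y" "lattice_equiv y z"
    then obtain m n m' n' :: int where
      "y = x + (2 * pi * of_int m, 2 * pi * of_int n)"
      "z = y + (2 * pi * of_int m', 2 * pi * of_int n')"
      unfolding lattice_equiv_def by blast
    then have "z = x + (2 * pi * of_int (m + m'), 2 * pi * of_int (n + n'))"
      by (auto simp: prod_eq_iff algebra_simps)
    then show "lattice_equiv x z" unfolding lattice_equiv_def by blast
  qed
qed

quotient_type torus = "real \<times> real" / lattice_equiv
  by (rule equivp_lattice_equiv)

definition torus_of :: "real \<times> real \<Rightarrow> torus" where
  "torus_of = abs_torus"

lemma torus_of_eq_iff: "torus_of x = torus_of y \<longleftrightarrow> lattice_equiv x y"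
  by (simp add: torus_of_def torus.abs_eq_iff)

lemma surj_torus_of: "surj torus_of"
  unfolding torus_of_def surj_def by (metis Quotient_torus Quotient_abs_rep)


definition partial_deriv :: "'a::euclidean_space \<Rightarrow> ('a \<Rightarrow> real) \<Rightarrow> 'a \<Rightarrow> real" where
  "partial_deriv b f x = frechet_derivative f (at x) b"

definition C2 :: "('a::euclidean_space \<Rightarrow> real) \<Rightarrow> bool" where
  "C2 f \<longleftrightarrow> f differentiable_on UNIV \<and>
     (\<forall>b\<in>Basis. partial_deriv b f differentiable_on UNIV) \<and>
     (\<forall>b\<in>Basis. \<forall>b'\<in>Basis. continuous_on UNIV (partial_deriv b' (partial_deriv b f)))"

definition laplacian :: "('a::euclidean_space \<Rightarrow> real) \<Rightarrow> 'a \<Rightarrow> real" where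
  "laplacian f x = (\<Sum>b\<in>Basis. partial_deriv b (partial_deriv b f) x)"

text \<open>The projection \<^term>\<open>torus_of\<close> is a local isometry, so functions on the flat torus are
  differentiated by composing with it.\<close>

definition torus_eigenfunction :: "real \<Rightarrow> (torus \<Rightarrow> real) \<Rightarrow> bool" where
  "torus_eigenfunction lam F \<longleftrightarrow>
     C2 (F \<circ> torus_of) \<and> (\<forall>x. - laplacian (F \<circ> torus_of) x = lam\<^sup>2 * F (torus_of x))"

definition torus_L2_norm :: "(torus \<Rightarrow> real) \<Rightarrow> real" where
  "torus_L2_norm F =
     sqrt (set_lebesgue_integral lborel ({0..2*pi} \<times> {0..2*pi}) (\<lambda>x. \<bar>F (torus_of x)\<bar>\<^sup>2))"


definition nth_deriv :: "real set \<Rightarrow> nat \<Rightarrow> (real \<Rightarrow> 'a::real_normed_vector) \<Rightarrow> real \<Rightarrow> 'a" where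
  "nth_deriv S n g = ((\<lambda>h t. vector_derivative h (at t within S)) ^^ n) g"

definition smooth_path :: "real set \<Rightarrow> (real \<Rightarrow> 'a::real_normed_vector) \<Rightarrow> bool" where
  "smooth_path S g \<longleftrightarrow> (\<forall>n. nth_deriv S n g differentiable_on S)"

text \<open>A curve in the torus is smooth iff it is the projection of a smooth path in the plane.
  Such a lift is unique up to a lattice translation, so speed and curvature do not depend on the
  lift. For an arc-length parameterization the curvature is the norm of the second derivative.
  The curve need not be injective, so self-intersecting and closed curves are included.\<close>

definition smooth_arclength_param :: "real \<Rightarrow> (real \<Rightarrow> torus) \<Rightarrow> (real \<Rightarrow> real \<times> real) \<Rightarrow> bool" where
  "smooth_arclength_param L \<gamma> g \<longleftrightarrow>
     (\<forall>t\<in>{0..L}. \<gamma> t = torus_of (g t)) \<and>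
     smooth_path {0..L} g \<and>
     (\<forall>t\<in>{0..L}. norm (nth_deriv {0..L} 1 g t) = 1)"

definition arclength_curvature :: "real \<Rightarrow> (real \<Rightarrow> real \<times> real) \<Rightarrow> real \<Rightarrow> real" where
  "arclength_curvature L g t = norm (nth_deriv {0..L} 2 g t)"

definition curve_integral :: "real \<Rightarrow> (real \<Rightarrow> torus) \<Rightarrow> (torus \<Rightarrow> real) \<Rightarrow> real" where
  "curve_integral L \<gamma> F = set_lebesgue_integral lborel {0..L} (\<lambda>t. F (\<gamma> t))"

text \<open>Zeros are counted as distinct points of the torus, not as parameter values; the value is
  \<open>\<infinity>\<close> if there are infinitely many.\<close>

definition zero_count :: "(torus \<Rightarrow> real) \<Rightarrow> torus set \<Rightarrow> ennreal" where
  "zero_count F C = emeasure (count_space UNIV) ({x. F x = 0} \<inter> C)"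

end

theory Submission
  imports Defs "HOL-Computational_Algebra.Primes"
begin

text \<open>
  An eigenfunction is a finite sum \<open>F = \<Sum>k. a k * wave k\<close> over the lattice points \<open>k\<close> with
  \<open>norm (freq k) = lam\<close> (\<open>eigenfunction_expansion\<close>: Green's identity removes all other Fourier
  coefficients and the waves are complete), and its \<open>L\<^sup>2\<close> norm is \<open>2 * pi * \<sigma>\<close> with
  \<open>\<sigma>\<^sup>2 = (\<Sum>k. (norm (a k))\<^sup>2)\<close>. Let \<open>\<phi>\<close> be its restriction to the curve, \<open>m\<close> the number of zeros of
  \<open>\<phi>\<close> plus one for the endpoint, and \<open>q = (m / lam) powr (1/4)\<close>. It is enough to bound the integral of
  \<open>\<bar>\<phi>\<bar>\<close> by a multiple of \<open>\<sigma> * min 1 q\<close>, because the fifth power of \<open>min 1 q\<close> is at most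
  \<open>m / lam\<close>.

  The analytic input is that \<open>slope = e \<bullet> \<gamma>'\<close>, for a unit vector \<open>e\<close>, vanishes only transversally on
  a curved path: where the slope is small, its derivative is at least comparable to the curvature.
  Hence the integral of \<open>1 / (slope\<^sup>2 + \<theta>\<^sup>2)\<close> is of size \<open>1 / \<theta>\<close>
  (\<open>resonance_integral\<close>). Splitting \<open>1 = \<theta>\<^sup>2 / (slope\<^sup>2 + \<theta>\<^sup>2) + slope\<^sup>2 / (slope\<^sup>2 + \<theta>\<^sup>2)\<close> and
  integrating the second part by parts gives van der Corput's decay \<open>(norm \<zeta>) powr (-1/2)\<close> for the
  Fourier transform of the curve (\<open>oscillatory_integral_decay\<close>), without any discussion of stationary
  points. The arithmetic input is that a lattice point on the circle of radius \<open>lam\<close> has at most one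
  other such point within distance \<open>lam powr (1/3)\<close> (\<open>circle_lattice_separation\<close>), and that there
  are only \<open>O(lam powr \<epsilon>)\<close> such points in total (\<open>circle_freqs_subpolynomial\<close>). Together they make
  the waves almost orthogonal on the curve, even with slowly varying weights
  (\<open>quasi_orthogonality\<close>); with weight one, this bounds the mean square of \<open>\<phi>\<close> by a multiple
  of \<open>\<sigma>\<^sup>2\<close>.

  For the main estimate, \<open>\<bar>\<phi>\<bar> = sgn \<phi> * \<phi>\<close>, and the sign is replaced by its average \<open>u\<close> over windows
  of length \<open>1 / lam\<close>. The two differ only on a set of measure \<open>m / lam = q ^ 4\<close>, which costs
  \<open>\<sigma> * q\<^sup>2\<close> by Cauchy-Schwarz, and \<open>u'\<close> is bounded by \<open>2 * lam\<close> and supported on the same set. To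
  bound the integral of \<open>u * \<phi>\<close>, take \<open>\<theta> = q\<^sup>2\<close>. If \<open>q \<le> lam powr (-1/48)\<close>, each wave
  separately contributes \<open>O(q\<^sup>2)\<close>, and the number of waves costs less than one factor \<open>q\<close>
  (\<open>pairing_small_width\<close>). Otherwise \<open>\<phi>\<close> is split into its resonant part, with weights \<open>\<theta>\<^sup>2 / (slope\<^sup>2 + \<theta>\<^sup>2)\<close>, and the rest. The
  resonant part has mean square of size \<open>\<theta> * \<sigma>\<^sup>2\<close>. The rest is, up to small terms, the
  derivative of \<open>H / lam\<close>, where \<open>H\<close> has mean square of size \<open>\<sigma>\<^sup>2 / \<theta>\<close>, and integration by
  parts moves the derivative to \<open>u\<close>. Both parts contribute \<open>O(\<sigma> * q)\<close>
  (\<open>resonant_pairing\<close>, \<open>nonresonant_pairing\<close>).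

  Two points remain. The number \<open>m\<close> has to be bounded by a multiple of the number of zeros in the
  torus, so the extra one must not be the only contribution: for large \<open>lam\<close> there is a
  zero on the curve (\<open>zero_exists\<close>), since otherwise \<open>\<bar>\<phi>\<bar>\<close> would have the same integral as
  \<open>\<phi>\<close> up to sign, which is tiny, while testing \<open>\<phi>\<close> against the wave with the largest
  coefficient shows that it is not. And a zero in the torus is visited a bounded number of times
  by the parameterization (\<open>fibres_bounded\<close>).
\<close>

section \<open>Lattice points on circles\<close>

definition divisor_count :: "nat \<Rightarrow> nat" where
  "divisor_count n = card {d. d dvd n}"

lemma divisor_count_mult_le:
  assumes "a > 0" "b > 0"
  shows "divisor_count (a * b) \<le> divisor_count a * divisor_count b"
proof -
  have "{d. d dvd a * b} \<subseteq> (\<lambda>(x, y). x * y) ` ({d. d dvd a} \<times> {d. d dvd b})"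
  proof
    fix d assume "d \<in> {d. d dvd a * b}"
    then obtain x y where "d = x * y" "x dvd a" "y dvd b"
      using division_decomp[of d a b] by auto
    then show "d \<in> (\<lambda>(x, y). x * y) ` ({d. d dvd a} \<times> {d. d dvd b})" by force
  qed
  then have "card {d. d dvd a * b} \<le> card ({d. d dvd a} \<times> {d. d dvd b})"
    using assms by (intro surj_card_le) auto
  then show ?thesis
    by (simp add: divisor_count_def card_cartesian_product)
qed

lemma divisor_count_prime_power:
  assumes "prime p"
  shows "divisor_count (p ^ k) \<le> Suc k"
proof -
  have "{d. d dvd p ^ k} \<subseteq> (\<lambda>i. p ^ i) ` {..k}"
    using assms by (auto simp: divides_primepow_nat)
  then have "card {d. d dvd p ^ k} \<le> card {..k}"
    by (intro surj_card_le) auto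
  then show ?thesis
    by (simp add: divisor_count_def)
qed

text \<open>
  Write \<open>n\<close> as a product of prime powers \<open>p ^ k\<close>. The quotient of \<open>Suc k\<close>, the number of
  divisors, by \<open>(p ^ k) powr \<epsilon>\<close> is at most 1 when \<open>p powr \<epsilon> \<ge> 2\<close>, and is bounded by a constant
  for each of the finitely many smaller primes.
\<close>

lemma divisor_count_subpolynomial:
  fixes \<epsilon> :: real
  assumes "\<epsilon> > 0"
  shows "\<exists>C>0. \<forall>n>0. real (divisor_count n) \<le> C * real n powr \<epsilon>"
proof -
  define P where "P = nat \<lceil>2 powr (1 / \<epsilon>)\<rceil>"
  define C0 where "C0 = 1 + 1 / (\<epsilon> * ln 2)"
  have C0: "C0 \<ge> 1"
    using assms by (simp add: C0_def)
  have small: "real (Suc k) \<le> C0 * real (p ^ k) powr \<epsilon>" if "p \<ge> 2" for p k :: nat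
  proof -
    have pe: "real (p ^ k) powr \<epsilon> = exp (\<epsilon> * k * ln p)"
      using that by (simp add: powr_def ln_realpow)
    have l: "ln 2 \<le> ln (real p)"
      using that by simp
    have "1 + \<epsilon> * k * ln 2 \<le> 1 + \<epsilon> * k * ln p"
      using assms l by (simp add: mult_left_mono)
    also have "\<dots> \<le> exp (\<epsilon> * k * ln p)"
      by (rule exp_ge_add_one_self)
    finally have e: "1 + \<epsilon> * k * ln 2 \<le> real (p ^ k) powr \<epsilon>"
      unfolding pe .
    have "real (Suc k) \<le> C0 * (1 + \<epsilon> * k * ln 2)"
      using assms by (simp add: C0_def field_simps)
    also have "\<dots> \<le> C0 * real (p ^ k) powr \<epsilon>"
      using e C0 by (intro mult_left_mono) auto
    finally show ?thesis .
  qed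
  have large: "real (Suc k) \<le> real (p ^ k) powr \<epsilon>" if "p \<ge> P" "p \<ge> 2" for p k :: nat
  proof -
    have "2 powr (1 / \<epsilon>) \<le> real p"
      using that unfolding P_def by linarith
    then have "(2 powr (1 / \<epsilon>)) powr \<epsilon> \<le> real p powr \<epsilon>"
      using assms by (intro powr_mono2) auto
    then have "2 \<le> real p powr \<epsilon>"
      using assms by (simp add: powr_powr)
    then have "2 ^ k \<le> (real p powr \<epsilon>) ^ k"
      by (intro power_mono) auto
    also have "\<dots> = real (p ^ k) powr \<epsilon>"
      using that by (simp add: powr_realpow[symmetric] powr_powr mult.commute del: powr_realpow)
    finally have a: "2 ^ k \<le> real (p ^ k) powr \<epsilon>" .
    have "Suc k \<le> 2 ^ k"
      using less_exp[of k] by (rule Suc_leI)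
    then have "real (Suc k) \<le> 2 ^ k"
      by (metis of_nat_le_iff of_nat_numeral of_nat_power)
    with a show ?thesis by linarith
  qed
  define w where "w n = card {p. prime p \<and> p dvd n \<and> p < P}" for n :: nat
  have main: "real (divisor_count n) \<le> C0 ^ w n * real n powr \<epsilon>" if "n > 0" for n :: nat
    using that
  proof (induction n rule: less_induct)
    case (less n)
    show ?case
    proof (cases "n = 1")
      case True
      have "{d::nat. d dvd 1} = {1}" by auto
      then show ?thesis
        using True C0 by (simp add: divisor_count_def w_def)
    next
      case False
      then obtain p where p: "prime p" "p dvd n"
        using prime_factor_nat by blast
      obtain m where m: "n = p ^ multiplicity p n * m" "\<not> p dvd m"
        by (rule multiplicity_decompose'[of n p]) (use less.prems p not_prime_unit[of p] in auto)
      define k where "k = multiplicity p n"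
      have n: "n = p ^ k * m" using m by (simp add: k_def)
      have m0: "m > 0" using m(2) by (cases m) auto
      have p2: "p \<ge> 2" using p by (simp add: prime_ge_2_nat)
      have k0: "k > 0"
        using p m(2) n by (cases k) auto
      then have "p ^ k > 1" using p2 one_less_power[of p k] by simp
      then have "m < n"
        using m0 n by simp
      then have IH: "real (divisor_count m) \<le> C0 ^ w m * real m powr \<epsilon>"
        using less.IH m0 by blast
      have sub: "{q. prime q \<and> q dvd m \<and> q < P} \<subseteq> {q. prime q \<and> q dvd n \<and> q < P}"
        using n by auto
      have fin: "finite {q. prime q \<and> q dvd n \<and> q < P}"
        by (rule finite_subset[of _ "{..<P}"]) auto
      have key: "real (Suc k) * C0 ^ w m \<le> C0 ^ w n * real (p ^ k) powr \<epsilon>"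
      proof (cases "p < P")
        case True
        have "insert p {q. prime q \<and> q dvd m \<and> q < P} \<subseteq> {q. prime q \<and> q dvd n \<and> q < P}"
          using sub p True by auto
        then have "card (insert p {q. prime q \<and> q dvd m \<and> q < P}) \<le> w n"
          unfolding w_def using fin by (rule card_mono[rotated])
        then have "Suc (w m) \<le> w n"
          using m(2) finite_subset[OF sub fin] by (simp add: w_def)
        then have "C0 * C0 ^ w m \<le> C0 ^ w n"
          using power_increasing[OF _ C0] by fastforce
        then have "(C0 * C0 ^ w m) * real (p ^ k) powr \<epsilon> \<le> C0 ^ w n * real (p ^ k) powr \<epsilon>"
          by (intro mult_right_mono) auto
        moreover have "real (Suc k) * C0 ^ w m \<le> (C0 * real (p ^ k) powr \<epsilon>) * C0 ^ w m"
          using small[OF p2] C0 by (intro mult_right_mono) auto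
        ultimately show ?thesis by (simp add: mult_ac)
      next
        case False
        have "w m \<le> w n"
          unfolding w_def using fin sub by (rule card_mono)
        then have "C0 ^ w m \<le> C0 ^ w n"
          using power_increasing[OF _ C0] by blast
        then have "real (Suc k) * C0 ^ w m \<le> real (p ^ k) powr \<epsilon> * C0 ^ w n"
          using large[of p k] False p2 C0 by (intro mult_mono) auto
        then show ?thesis by (simp add: mult_ac)
      qed
      have "divisor_count n \<le> Suc k * divisor_count m"
        using divisor_count_mult_le[of "p ^ k" m] mult_le_mono1[OF divisor_count_prime_power[OF p(1), of k], of "divisor_count m"] m0 p2
        unfolding n by simp
      then have "real (divisor_count n) \<le> real (Suc k) * real (divisor_count m)"
        by (metis of_nat_le_iff of_nat_mult)
      also have "\<dots> \<le> real (Suc k) * (C0 ^ w m * real m powr \<epsilon>)"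
        using IH by (intro mult_left_mono) auto
      also have "\<dots> = (real (Suc k) * C0 ^ w m) * real m powr \<epsilon>"
        by simp
      also have "\<dots> \<le> (C0 ^ w n * real (p ^ k) powr \<epsilon>) * real m powr \<epsilon>"
        by (intro mult_right_mono key) auto
      also have "\<dots> = C0 ^ w n * real n powr \<epsilon>"
        unfolding n of_nat_mult by (subst powr_mult) auto
      finally show ?thesis .
    qed
  qed
  have "real (divisor_count n) \<le> C0 ^ P * real n powr \<epsilon>" if "n > 0" for n :: nat
  proof -
    have "w n \<le> card {..<P}"
      unfolding w_def by (intro card_mono) auto
    then have "C0 ^ w n \<le> C0 ^ P"
      using power_increasing[OF _ C0] by simp
    then have "C0 ^ w n * real n powr \<epsilon> \<le> C0 ^ P * real n powr \<epsilon>"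
      by (intro mult_right_mono) auto
    then show ?thesis using main[OF that] by linarith
  qed
  then show ?thesis
    using C0 by (intro exI[of _ "C0 ^ P"]) auto
qed

definition two_square_reps :: "nat \<Rightarrow> (int \<times> int) set" where
  "two_square_reps n = {(x, y). x\<^sup>2 + y\<^sup>2 = int n}"

lemma finite_two_square_reps: "finite (two_square_reps n)"
proof -
  have le: "\<bar>z\<bar> \<le> z\<^sup>2" for z :: int
    using self_le_power[of "\<bar>z\<bar>" 2] by (cases "z = 0") auto
  have "x \<in> {-int n..int n} \<and> y \<in> {-int n..int n}" if xy: "x\<^sup>2 + y\<^sup>2 = int n" for x y :: int
  proof -
    have "\<bar>x\<bar> \<le> int n" "\<bar>y\<bar> \<le> int n"
      using le[of x] le[of y] zero_le_power2[of x] zero_le_power2[of y] xy by linarith+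
    then show ?thesis by auto
  qed
  then have "two_square_reps n \<subseteq> {-int n..int n} \<times> {-int n..int n}"
    unfolding two_square_reps_def by blast
  then show ?thesis
    by (rule finite_subset) auto
qed

text \<open>
  Compare all primitive representations \<open>(x, y)\<close> of \<open>n\<close> with a fixed one \<open>(x0, y0)\<close>. Since
  \<open>x\<^sup>2\<close> and \<open>- y\<^sup>2\<close> agree modulo \<open>n\<close>, the product of \<open>x * y0 - x0 * y\<close> and \<open>x * y0 + x0 * y\<close> is
  divisible by \<open>n\<close>, and its factorization is recorded by the divisor
  \<open>gcd (x * y0 - x0 * y) n\<close>. Two representations \<open>(x, y)\<close> and \<open>(a, b)\<close> with the same divisor
  satisfy \<open>n dvd 2 * (x * b - a * y)\<close>, and by the two-square identity
  \<open>(x * b - a * y)\<^sup>2 + (x * a + y * b)\<^sup>2 = n\<^sup>2\<close> this leaves five values for the determinant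
  and a sign for the inner product, which together determine \<open>(a, b)\<close>.
\<close>

lemma card_primitive_two_square_reps:
  assumes "n > 0"
  shows "card {(x, y). x\<^sup>2 + y\<^sup>2 = int n \<and> coprime x y} \<le> 10 * divisor_count n"
proof -
  define R where "R = {(x, y). x\<^sup>2 + y\<^sup>2 = int n \<and> coprime x y}"
  have finR: "finite R"
    by (rule finite_subset[OF _ finite_two_square_reps[of n]]) (auto simp: R_def two_square_reps_def)
  show ?thesis
  proof (cases "R = {}")
    case True
    then show ?thesis unfolding R_def[symmetric] by simp
  next
    case False
    then obtain x0 y0 where xy0: "x0\<^sup>2 + y0\<^sup>2 = int n" "coprime x0 y0"
      by (auto simp: R_def)
    have cop: "coprime y (int n)" if "x\<^sup>2 + y\<^sup>2 = int n" "coprime x y" for x y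
    proof -
      have "coprime y (x\<^sup>2)"
        using that by (simp add: coprime_commute)
      then have "coprime y (x\<^sup>2 + y * y)"
        by (metis coprime_iff_gcd_eq_1 gcd_add_mult add.commute)
      then show ?thesis using that by (simp add: power2_eq_square)
    qed
    define D where "D = (\<lambda>(x, y). nat (gcd (x * y0 - x0 * y) (int n)))"
    have Ddvd: "D z \<in> {d. d dvd n}" for z
      unfolding D_def by (cases z) (simp add: nat_dvd_iff flip: int_dvd_int_iff)
    have fin: "finite {d. d dvd n}"
      using assms by simp
    have fibre: "card {z \<in> R. D z = d} \<le> 10" for d
    proof (cases "{z \<in> R. D z = d} = {}")
      case True
      then show ?thesis by (metis card.empty zero_le)
    next
      case False
      then obtain x y where xy: "x\<^sup>2 + y\<^sup>2 = int n" "coprime x y" "D (x, y) = d"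
        by (auto simp: R_def)
      define g where "g = gcd (x * y0 - x0 * y) (int n)"
      have g0: "g > 0" using assms by (simp add: g_def gcd_pos_int)
      have gn: "g dvd int n" by (simp add: g_def)
      define k where "k = int n div g"
      have nk: "int n = g * k" using gn by (simp add: k_def)
      have kdvd: "k dvd a * y0 + x0 * b"
        if "a\<^sup>2 + b\<^sup>2 = int n" "gcd (a * y0 - x0 * b) (int n) = g" for a b
      proof -
        note ab = that
        have "(a * y0 - x0 * b) * (a * y0 + x0 * b) = a\<^sup>2 * y0\<^sup>2 - x0\<^sup>2 * b\<^sup>2"
          by (simp add: algebra_simps power2_eq_square)
        also have "\<dots> = int n * (y0\<^sup>2 - b\<^sup>2)"
        proof -
          have "a\<^sup>2 = int n - b\<^sup>2" "x0\<^sup>2 = int n - y0\<^sup>2" using that xy0 by auto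
          then show ?thesis by (simp only: left_diff_distrib right_diff_distrib) (simp add: algebra_simps)
        qed
        finally have dv: "int n dvd (a * y0 - x0 * b) * (a * y0 + x0 * b)" by simp
        obtain c where c: "a * y0 - x0 * b = g * c" "coprime c k"
        proof -
          obtain c where c: "a * y0 - x0 * b = g * c"
            using ab(2) by (metis dvdE gcd_dvd1)
          have "g * gcd c k = gcd (g * c) (g * k)"
            using g0 by (simp add: gcd_mult_left)
          also have "\<dots> = g" using ab(2) c nk by simp
          finally have "coprime c k" using g0 by (simp add: coprime_iff_gcd_eq_1)
          with c that show ?thesis by blast
        qed
        have "g * k dvd g * (c * (a * y0 + x0 * b))"
          using dv c nk by (simp add: mult.assoc)
        then have "k dvd c * (a * y0 + x0 * b)"
          using g0 by simp
        then show ?thesis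
          using c(2) by (simp add: coprime_commute coprime_dvd_mult_right_iff)
      qed
      define T where "T = (\<lambda>(a, b). x * b - a * y)"
      define U where "U = (\<lambda>(a, b). x * a + y * b)"
      \<comment> \<open>both factors in \<open>n = g * k\<close> divide \<open>T\<close>, and they are coprime up to a factor 2\<close>
      have dvdT: "int n dvd 2 * T (a, b)" if ab: "(a, b) \<in> R" "D (a, b) = d" for a b
      proof -
        have abn: "a\<^sup>2 + b\<^sup>2 = int n" using ab by (auto simp: R_def)
        have gab: "gcd (a * y0 - x0 * b) (int n) = g"
          using ab xy(3) unfolding D_def g_def by (simp add: eq_nat_nat_iff[symmetric])
        have y0g: "coprime y0 g" "coprime y0 k"
          using cop[OF xy0] nk by auto
        have "g dvd (x * y0 - x0 * y) * b - (a * y0 - x0 * b) * y"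
          using gab g_def by (metis dvd_diff dvd_mult2 gcd_dvd1)
        then have "g dvd y0 * T (a, b)"
          by (simp add: T_def algebra_simps)
        then have gT: "g dvd T (a, b)"
          using y0g by (simp add: coprime_commute coprime_dvd_mult_right_iff)
        have "k dvd (x * y0 + x0 * y) * b - (a * y0 + x0 * b) * y"
          using kdvd[OF abn gab] kdvd[OF xy(1) g_def[symmetric]] by (intro dvd_diff dvd_mult2)
        then have "k dvd y0 * T (a, b)"
          by (simp add: T_def algebra_simps)
        then have kT: "k dvd T (a, b)"
          using y0g by (simp add: coprime_commute coprime_dvd_mult_right_iff)
        have "gcd g k dvd (x * y0 - x0 * y) + (x * y0 + x0 * y)"
          using kdvd[OF xy(1) g_def[symmetric]] unfolding g_def
          by (meson dvd_add dvd_trans gcd_dvd1 gcd_dvd2)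
        then have "gcd g k dvd 2 * x * y0" by (simp add: algebra_simps)
        moreover have "coprime x (int n)"
          using cop[of y x] xy by (simp add: add.commute coprime_commute)
        then have "coprime (gcd g k) x"
          using gn by (meson coprime_commute coprime_divisors dvd_refl dvd_trans gcd_dvd1)
        moreover have "coprime (gcd g k) y0"
          using y0g by (meson coprime_commute coprime_divisors dvd_refl gcd_dvd1)
        ultimately have g2: "gcd g k dvd 2"
          by (simp add: coprime_dvd_mult_left_iff)
        have "lcm g k dvd T (a, b)"
          using gT kT by (rule lcm_least)
        then have "gcd g k * lcm g k dvd 2 * T (a, b)"
          using g2 by (rule mult_dvd_mono[rotated])
        moreover have "gcd g k * lcm g k = int n"
          using prod_gcd_lcm_int[of g k] nk by (metis abs_mult abs_of_nat)
        ultimately show ?thesis by simp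
      qed
      have TU: "(T (a, b))\<^sup>2 + (U (a, b))\<^sup>2 = (int n)\<^sup>2" if "a\<^sup>2 + b\<^sup>2 = int n" for a b
      proof -
        have "(T (a, b))\<^sup>2 + (U (a, b))\<^sup>2 = (x\<^sup>2 + y\<^sup>2) * (a\<^sup>2 + b\<^sup>2)"
          by (simp add: T_def U_def algebra_simps power2_eq_square)
        then show ?thesis using that xy by (simp add: power2_eq_square)
      qed
      have inTU: "z = z'" if "T z = T z'" "U z = U z'" for z z'
      proof -
        obtain a b a' b' where z: "z = (a, b)" "z' = (a', b')" by (cases z, cases z')
        have t: "x * b - a * y = x * b' - a' * y" and u: "x * a + y * b = x * a' + y * b'"
          using that by (auto simp: z T_def U_def)
        have "int n * (a - a') = x * ((x * a + y * b) - (x * a' + y * b')) - y * ((x * b - a * y) - (x * b' - a' * y))"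
          unfolding xy(1)[symmetric] by (simp add: algebra_simps power2_eq_square)
        also have "\<dots> = 0" using t u by simp
        finally have 1: "a = a'" using assms by simp
        have "int n * (b - b') = y * ((x * a + y * b) - (x * a' + y * b')) + x * ((x * b - a * y) - (x * b' - a' * y))"
          unfolding xy(1)[symmetric] by (simp add: algebra_simps power2_eq_square)
        also have "\<dots> = 0" using t u by simp
        finally have 2: "b = b'" using assms by simp
        show ?thesis using 1 2 z by simp
      qed
      define \<Phi> where "\<Phi> z = (2 * T z div int n, U z \<ge> 0)" for z
      have mem: "\<Phi> z \<in> {-2, -1, 0, 1, 2} \<times> UNIV" if "z \<in> {z \<in> R. D z = d}" for z
      proof -
        obtain a b where z: "z = (a, b)" by (cases z)
        then have abn: "a\<^sup>2 + b\<^sup>2 = int n" using that by (auto simp: R_def)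
        have "int n dvd 2 * T z"
          using dvdT[of a b] that z by simp
        then obtain q where q: "2 * T z = int n * q" ..
        have "(T z)\<^sup>2 \<le> (int n)\<^sup>2" using TU[OF abn] z by (metis le_add_same_cancel1 zero_le_power2)
        then have "\<bar>T z\<bar> \<le> int n" using abs_le_square_iff[of "T z" "int n"] by simp
        then have "\<bar>int n * q\<bar> \<le> int n * 2" using q by linarith
        then have "int n * \<bar>q\<bar> \<le> int n * 2" by (simp add: abs_mult)
        then have "\<bar>q\<bar> \<le> 2" using assms by simp
        then have "q = -2 \<or> q = -1 \<or> q = 0 \<or> q = 1 \<or> q = 2" by linarith
        moreover have "2 * T z div int n = q" using q assms by simp
        ultimately show ?thesis by (simp add: \<Phi>_def)
      qed
      have inj: "inj_on \<Phi> {z \<in> R. D z = d}"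
      proof (rule inj_onI)
        fix z z' assume z: "z \<in> {z \<in> R. D z = d}" "z' \<in> {z \<in> R. D z = d}" "\<Phi> z = \<Phi> z'"
        obtain a b a' b' where ab: "z = (a, b)" "z' = (a', b')" by (cases z, cases z')
        have "int n dvd 2 * T z" "int n dvd 2 * T z'" using dvdT z ab by auto
        then have T: "T z = T z'"
          using z(3) assms by (auto simp: \<Phi>_def elim!: dvdE)
        have "(T z)\<^sup>2 + (U z)\<^sup>2 = (int n)\<^sup>2" "(T z')\<^sup>2 + (U z')\<^sup>2 = (int n)\<^sup>2"
          using TU z ab by (auto simp: R_def)
        then have "(U z)\<^sup>2 = (U z')\<^sup>2" using T by simp
        then have "U z = U z'" using z(3) by (auto simp: \<Phi>_def power2_eq_iff)
        then show "z = z'" using T inTU by blast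
      qed
      have "card {z \<in> R. D z = d} \<le> card ({-2::int, -1, 0, 1, 2} \<times> (UNIV :: bool set))"
        by (rule card_inj_on_le[OF inj image_subsetI[OF mem]]) simp_all
      then show ?thesis by (simp add: card_cartesian_product)
    qed
    have "R = (\<Union>d\<in>{d. d dvd n}. {z \<in> R. D z = d})"
      using Ddvd by auto
    then have "card R \<le> (\<Sum>d\<in>{d. d dvd n}. card {z \<in> R. D z = d})"
      using card_UN_le[OF fin, of "\<lambda>d. {z \<in> R. D z = d}"] by simp
    also have "\<dots> \<le> (\<Sum>d\<in>{d. d dvd n}. 10)"
      by (rule sum_mono) (rule fibre)
    finally show ?thesis by (simp add: R_def divisor_count_def mult.commute)
  qed
qed

text \<open>
  Dividing a representation by the gcd \<open>k\<close> of its entries gives a primitive representation of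
  \<open>n div k\<^sup>2\<close>.
\<close>

lemma card_two_square_reps:
  assumes "n > 0"
  shows "card (two_square_reps n) \<le> 10 * (divisor_count n)\<^sup>2"
proof -
  define R where "R m = {(x, y). x\<^sup>2 + y\<^sup>2 = int m \<and> coprime x y}" for m
  have finR: "finite (R m)" for m
    by (rule finite_subset[OF _ finite_two_square_reps[of m]]) (auto simp: R_def two_square_reps_def)
  define K where "K = {k. k\<^sup>2 dvd n}"
  have Ksub: "K \<subseteq> {d. d dvd n}"
    unfolding K_def using dvd_trans[OF dvd_triv_left] by (auto simp: power2_eq_square)
  have finK: "finite K" using Ksub assms by (rule_tac finite_subset) auto
  have "two_square_reps n \<subseteq> (\<Union>k\<in>K. (\<lambda>(x, y). (int k * x, int k * y)) ` R (n div k\<^sup>2))"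
  proof
    fix z assume "z \<in> two_square_reps n"
    then obtain x y where z: "z = (x, y)" "x\<^sup>2 + y\<^sup>2 = int n"
      by (auto simp: two_square_reps_def)
    have ne: "x \<noteq> 0 \<or> y \<noteq> 0" using z assms by auto
    define g where "g = gcd x y"
    have g0: "g > 0" using ne by (simp add: g_def)
    obtain a b where ab: "x = g * a" "y = g * b" "coprime a b"
      using gcd_coprime_exists[of x y] ne unfolding g_def by (metis gcd_eq_0_iff mult.commute)
    define k where "k = nat g"
    have gk: "g = int k" using g0 by (simp add: k_def)
    have eq: "int n = int (k\<^sup>2) * (a\<^sup>2 + b\<^sup>2)"
      using z(2) ab gk by (simp add: power_mult_distrib algebra_simps)
    then have kd: "k\<^sup>2 dvd n" by (metis dvd_triv_left int_dvd_int_iff)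
    then obtain m where m: "n = k\<^sup>2 * m" by auto
    have "k > 0" using g0 gk by simp
    then have "a\<^sup>2 + b\<^sup>2 = int m" using eq m by simp
    moreover have "n div k\<^sup>2 = m" using m \<open>k > 0\<close> by simp
    ultimately have "(a, b) \<in> R (n div k\<^sup>2)" using ab by (simp add: R_def)
    then show "z \<in> (\<Union>k\<in>K. (\<lambda>(x, y). (int k * x, int k * y)) ` R (n div k\<^sup>2))"
      using kd z ab gk by (auto simp: K_def intro!: bexI[of _ k] image_eqI[of _ _ "(a, b)"])
  qed
  then have "card (two_square_reps n) \<le> card (\<Union>k\<in>K. (\<lambda>(x, y). (int k * x, int k * y)) ` R (n div k\<^sup>2))"
    using finK finR by (intro card_mono) auto
  also have "\<dots> \<le> (\<Sum>k\<in>K. card ((\<lambda>(x, y). (int k * x, int k * y)) ` R (n div k\<^sup>2)))"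
    by (rule card_UN_le[OF finK])
  also have "\<dots> \<le> (\<Sum>k\<in>K. 10 * divisor_count n)"
  proof (rule sum_mono)
    fix k assume "k \<in> K"
    then obtain m where m: "n = k\<^sup>2 * m" by (auto simp: K_def)
    then have k: "n div k\<^sup>2 = m" "m > 0" using assms by auto
    have "card ((\<lambda>(x, y). (int k * x, int k * y)) ` R (n div k\<^sup>2)) \<le> card (R m)"
      using k finR by (simp add: card_image_le)
    also have "\<dots> \<le> 10 * divisor_count m"
      unfolding R_def by (rule card_primitive_two_square_reps[OF k(2)])
    also have "divisor_count m \<le> divisor_count n"
      unfolding divisor_count_def using assms m by (intro card_mono) auto
    finally show "card ((\<lambda>(x, y). (int k * x, int k * y)) ` R (n div k\<^sup>2)) \<le> 10 * divisor_count n"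
      by simp
  qed
  also have "\<dots> \<le> divisor_count n * (10 * divisor_count n)"
    using card_mono[OF _ Ksub] assms by (simp add: divisor_count_def)
  finally show ?thesis by (simp add: power2_eq_square mult_ac)
qed

text \<open>
  The formula \<open>area = a * b * c / (4 * R)\<close> for a triangle with circumradius \<open>R\<close>, squared and
  cleared of denominators, for a triangle with vertices \<open>x\<close>, \<open>x + p\<close>, \<open>x + q\<close> on the circle of
  radius \<open>sqrt n\<close>.
\<close>

lemma circle_triangle_area:
  fixes x1 x2 p1 p2 q1 q2 n :: int
  assumes "x1\<^sup>2 + x2\<^sup>2 = n" "(x1 + p1)\<^sup>2 + (x2 + p2)\<^sup>2 = n" "(x1 + q1)\<^sup>2 + (x2 + q2)\<^sup>2 = n"
  shows "(p1\<^sup>2 + p2\<^sup>2) * (q1\<^sup>2 + q2\<^sup>2) * ((p1 - q1)\<^sup>2 + (p2 - q2)\<^sup>2) = 4 * n * (p1 * q2 - p2 * q1)\<^sup>2"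
proof -
  define P Q where "P = p1\<^sup>2 + p2\<^sup>2" and "Q = q1\<^sup>2 + q2\<^sup>2"
  have P: "2 * (x1 * p1 + x2 * p2) = - P" and Q: "2 * (x1 * q1 + x2 * q2) = - Q"
    using assms by (auto simp: P_def Q_def power2_eq_square algebra_simps)
  have "4 * n * (p1 * q2 - p2 * q1)\<^sup>2
      = (2 * (x1 * p1 + x2 * p2) * q1 - 2 * (x1 * q1 + x2 * q2) * p1)\<^sup>2
        + (2 * (x1 * p1 + x2 * p2) * q2 - 2 * (x1 * q1 + x2 * q2) * p2)\<^sup>2"
    unfolding assms(1)[symmetric] by (simp add: power2_eq_square algebra_simps)
  also have "\<dots> = (P * q1 - Q * p1)\<^sup>2 + (P * q2 - Q * p2)\<^sup>2"
    unfolding P Q by (simp add: power2_eq_square algebra_simps)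
  also have "\<dots> = P * Q * (P + Q - 2 * (p1 * q1 + p2 * q2))"
  proof -
    have "(P * q1 - Q * p1)\<^sup>2 + (P * q2 - Q * p2)\<^sup>2
        = P\<^sup>2 * (q1\<^sup>2 + q2\<^sup>2) + Q\<^sup>2 * (p1\<^sup>2 + p2\<^sup>2) - 2 * P * Q * (p1 * q1 + p2 * q2)"
      by (simp add: power2_eq_square algebra_simps)
    then show ?thesis
      unfolding P_def[symmetric] Q_def[symmetric] by (simp add: power2_eq_square algebra_simps)
  qed
  also have "P + Q - 2 * (p1 * q1 + p2 * q2) = (p1 - q1)\<^sup>2 + (p2 - q2)\<^sup>2"
    by (simp add: P_def Q_def power2_eq_square algebra_simps)
  finally show ?thesis by (simp add: P_def Q_def)
qed

definition freq :: "int \<times> int \<Rightarrow> real \<times> real" where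
  "freq k = (of_int (fst k), of_int (snd k))"

lemma norm_freq_square: "(norm (freq k))\<^sup>2 = of_int ((fst k)\<^sup>2 + (snd k)\<^sup>2)"
  by (simp add: freq_def norm_prod_def)

lemma freq_diff: "freq (k - l) = freq k - freq l"
  by (simp add: freq_def prod_eq_iff)

lemma norm_freq_ge_1: "k \<noteq> 0 \<Longrightarrow> norm (freq k) \<ge> 1"
proof -
  assume "k \<noteq> 0"
  then have "(fst k)\<^sup>2 + (snd k)\<^sup>2 > 0"
    by (auto simp: prod_eq_iff sum_power2_gt_zero_iff)
  then have "(fst k)\<^sup>2 + (snd k)\<^sup>2 \<ge> 1" by linarith
  then have "(norm (freq k))\<^sup>2 \<ge> 1\<^sup>2" unfolding norm_freq_square by (metis of_int_1_le_iff one_power2)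
  then show ?thesis by (rule power2_le_imp_le) auto
qed

lemma finite_bounded_freqs: "finite {k. norm (freq k) \<le> B}"
proof -
  have "{k. norm (freq k) \<le> B} \<subseteq> {-\<lceil>B\<rceil>..\<lceil>B\<rceil>} \<times> {-\<lceil>B\<rceil>..\<lceil>B\<rceil>}"
  proof
    fix k assume "k \<in> {k. norm (freq k) \<le> B}"
    then have "norm (fst (freq k)) \<le> B" "norm (snd (freq k)) \<le> B"
      using norm_fst_le[of "fst (freq k)" "snd (freq k)"] norm_snd_le[of "snd (freq k)" "fst (freq k)"] by auto
    then have "\<bar>real_of_int (fst k)\<bar> \<le> B" "\<bar>real_of_int (snd k)\<bar> \<le> B" by (auto simp: freq_def)
    then show "k \<in> {-\<lceil>B\<rceil>..\<lceil>B\<rceil>} \<times> {-\<lceil>B\<rceil>..\<lceil>B\<rceil>}"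
      by (auto simp: mem_Times_iff) linarith+
  qed
  then show ?thesis by (rule finite_subset) auto
qed

text \<open>
  Three distinct points on a circle are not collinear, so a triangle of lattice points has area at
  least \<open>1 / 2\<close>; by the area formula the product of its sides is at least \<open>2 * lam\<close>. Sides
  below \<open>r\<close>, \<open>r\<close> and \<open>2 * r\<close> are too short for this.
\<close>

lemma circle_lattice_separation:
  fixes lam r :: real and x y z :: "int \<times> int"
  assumes lam: "lam > 0" "lam = r ^ 3"
    and on: "norm (freq x) = lam" "norm (freq y) = lam" "norm (freq z) = lam"
    and near: "norm (freq y - freq x) < r" "norm (freq z - freq x) < r"
    and neq: "x \<noteq> y" "x \<noteq> z"
  shows "y = z"
proof (rule ccontr)
  assume "y \<noteq> z"
  define p q where "p = y - x" and "q = z - x"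
  define n where "n = (fst x)\<^sup>2 + (snd x)\<^sup>2"
  have n: "of_int n = lam\<^sup>2" using norm_freq_square[of x] on by (simp add: n_def)
  have eqs: "(fst x + fst p)\<^sup>2 + (snd x + snd p)\<^sup>2 = n" "(fst x + fst q)\<^sup>2 + (snd x + snd q)\<^sup>2 = n"
  proof -
    have "(of_int ((fst y)\<^sup>2 + (snd y)\<^sup>2)::real) = of_int n" "(of_int ((fst z)\<^sup>2 + (snd z)\<^sup>2)::real) = of_int n"
      using norm_freq_square[of y] norm_freq_square[of z] on n by auto
    then show "(fst x + fst p)\<^sup>2 + (snd x + snd p)\<^sup>2 = n" "(fst x + fst q)\<^sup>2 + (snd x + snd q)\<^sup>2 = n"
      unfolding of_int_eq_iff by (auto simp: p_def q_def)
  qed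
  define dt where "dt = fst p * snd q - snd p * fst q"
  have id: "((fst p)\<^sup>2 + (snd p)\<^sup>2) * ((fst q)\<^sup>2 + (snd q)\<^sup>2) * ((fst p - fst q)\<^sup>2 + (snd p - snd q)\<^sup>2) = 4 * n * dt\<^sup>2"
    unfolding dt_def using circle_triangle_area[OF n_def[symmetric] eqs] .
  have "of_int (((fst p)\<^sup>2 + (snd p)\<^sup>2) * ((fst q)\<^sup>2 + (snd q)\<^sup>2) * ((fst p - fst q)\<^sup>2 + (snd p - snd q)\<^sup>2))
      = (norm (freq p))\<^sup>2 * (norm (freq q))\<^sup>2 * (norm (freq (p - q)))\<^sup>2"
    unfolding norm_freq_square by simp
  then have id': "(norm (freq p))\<^sup>2 * (norm (freq q))\<^sup>2 * (norm (freq (p - q)))\<^sup>2 = 4 * lam\<^sup>2 * of_int (dt\<^sup>2)"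
    unfolding id using n by simp
  have r0: "r > 0" using near(1) norm_ge_zero[of "freq y - freq x"] by linarith
  have lt: "norm (freq p) < r" "norm (freq q) < r"
    using near by (auto simp: p_def q_def freq_diff)
  have ge: "norm (freq p) \<ge> 1" "norm (freq q) \<ge> 1" "norm (freq (p - q)) \<ge> 1"
    using neq \<open>y \<noteq> z\<close> by (auto intro!: norm_freq_ge_1 simp: p_def q_def)
  have "norm (freq (p - q)) < 2 * r"
    unfolding freq_diff using norm_triangle_ineq4[of "freq p" "freq q"] lt by linarith
  then have 3: "(norm (freq (p - q)))\<^sup>2 < (2 * r)\<^sup>2"
    by (rule power_strict_mono) auto
  have 1: "(norm (freq p))\<^sup>2 < r\<^sup>2" "(norm (freq q))\<^sup>2 < r\<^sup>2"
    using lt by (auto intro!: power_strict_mono)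
  have "(norm (freq p))\<^sup>2 * (norm (freq q))\<^sup>2 < r\<^sup>2 * r\<^sup>2"
    using 1 by (intro mult_strict_mono) (auto simp: r0)
  then have "(norm (freq p))\<^sup>2 * (norm (freq q))\<^sup>2 * (norm (freq (p - q)))\<^sup>2 < r\<^sup>2 * r\<^sup>2 * (2 * r)\<^sup>2"
    using 3 by (rule mult_strict_mono) (use r0 in auto)
  also have "\<dots> = 4 * lam\<^sup>2" by (simp add: lam power2_eq_square power3_eq_cube)
  finally have up: "4 * lam\<^sup>2 * of_int (dt\<^sup>2) < 4 * lam\<^sup>2" unfolding id' .
  have "(norm (freq p))\<^sup>2 * (norm (freq q))\<^sup>2 * (norm (freq (p - q)))\<^sup>2 > 0"
    using ge by (auto simp: zero_less_mult_iff)
  then have "dt \<noteq> 0" unfolding id' by auto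
  then have "dt\<^sup>2 \<ge> 1" by (metis int_one_le_iff_zero_less zero_less_power2)
  then have "(of_int (dt\<^sup>2)::real) \<ge> 1" by linarith
  then have "4 * lam\<^sup>2 * of_int (dt\<^sup>2) \<ge> 4 * lam\<^sup>2"
    using mult_left_mono[of 1 "of_int (dt\<^sup>2)" "4 * lam\<^sup>2"] by simp
  with up show False by linarith
qed

definition circle_freqs :: "real \<Rightarrow> (int \<times> int) set" where
  "circle_freqs lam = {k. norm (freq k) = lam}"

lemma card_near_frequencies:
  assumes "lam > 0" "lam = r ^ 3" "k \<in> circle_freqs lam"
  shows "card {l \<in> circle_freqs lam. norm (freq k - freq l) < r} \<le> 2"
proof -
  define N where "N = {l \<in> circle_freqs lam. norm (freq k - freq l) < r}"
  have "card N \<le> 2"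
  proof (cases "N \<subseteq> {k}")
    case True
    then have "card N \<le> card {k}" by (intro card_mono) auto
    then show ?thesis by simp
  next
    case False
    then obtain l where l: "l \<in> N" "l \<noteq> k" by auto
    have "N \<subseteq> {k, l}"
    proof
      fix j assume j: "j \<in> N"
      have "j = l" if "j \<noteq> k"
        using that l j assms(3)
        by (intro circle_lattice_separation[OF assms(1,2), of k])
           (auto simp: N_def circle_freqs_def norm_minus_commute)
      then show "j \<in> {k, l}" by blast
    qed
    then have "card N \<le> card {k, l}" by (intro card_mono) auto
    then show ?thesis using l by simp
  qed
  then show ?thesis by (simp add: N_def)
qed

lemma circle_freqs_eq_two_square_reps:
  assumes "k \<in> circle_freqs lam"
  shows "\<exists>n. real n = lam\<^sup>2 \<and> circle_freqs lam = two_square_reps n"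
proof -
  have k: "norm (freq k) = lam" using assms by (simp add: circle_freqs_def)
  define n where "n = nat ((fst k)\<^sup>2 + (snd k)\<^sup>2)"
  have n: "real n = lam\<^sup>2" using norm_freq_square[of k] k by (simp add: n_def)
  have "norm (freq l) = lam \<longleftrightarrow> (fst l)\<^sup>2 + (snd l)\<^sup>2 = int n" for l
  proof -
    have "norm (freq l) = lam \<longleftrightarrow> (norm (freq l))\<^sup>2 = lam\<^sup>2" using k by (auto simp: power2_eq_iff_nonneg)
    also have "\<dots> \<longleftrightarrow> (of_int ((fst l)\<^sup>2 + (snd l)\<^sup>2) :: real) = of_int (int n)"
      unfolding norm_freq_square n[symmetric] by simp
    finally show ?thesis unfolding of_int_eq_iff .
  qed
  then have "circle_freqs lam = two_square_reps n"
    by (auto simp: circle_freqs_def two_square_reps_def)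
  then show ?thesis using n by blast
qed

lemma finite_circle_freqs: "finite (circle_freqs lam)"
  by (cases "circle_freqs lam = {}")
     (auto dest: circle_freqs_eq_two_square_reps simp: finite_two_square_reps)

lemma circle_freqs_subpolynomial:
  fixes \<epsilon> :: real
  assumes "\<epsilon> > 0"
  shows "\<exists>C>0. \<forall>lam\<ge>1. real (card (circle_freqs lam)) \<le> C * lam powr \<epsilon>"
proof -
  obtain C where C: "C > 0" "\<And>n. n > 0 \<Longrightarrow> real (divisor_count n) \<le> C * real n powr (\<epsilon> / 4)"
    using divisor_count_subpolynomial[of "\<epsilon> / 4"] assms by auto
  have "real (card (circle_freqs lam)) \<le> 10 * C\<^sup>2 * lam powr \<epsilon>"
    if lam: "lam \<ge> 1" for lam
  proof (cases "circle_freqs lam = {}")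
    case True
    then show ?thesis by simp
  next
    case False
    then obtain n where n: "real n = lam\<^sup>2" and eq: "circle_freqs lam = two_square_reps n"
      using circle_freqs_eq_two_square_reps by blast
    have n0: "n > 0" using n lam by (cases n) auto
    have "real (card (circle_freqs lam)) \<le> 10 * (real (divisor_count n))\<^sup>2"
      using card_two_square_reps[OF n0] unfolding eq
      by (metis of_nat_le_iff of_nat_mult of_nat_numeral of_nat_power)
    also have "\<dots> \<le> 10 * (C * real n powr (\<epsilon> / 4))\<^sup>2"
      using C(2)[OF n0] by (intro mult_left_mono power_mono) auto
    also have "real n powr (\<epsilon> / 4) = lam powr (\<epsilon> / 2)"
    proof -
      have "real n = lam powr 2" using n lam by (simp add: powr_numeral)
      then show ?thesis by (simp add: powr_powr)
    qed
    also have "10 * (C * lam powr (\<epsilon> / 2))\<^sup>2 = 10 * C\<^sup>2 * lam powr \<epsilon>"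
      by (simp add: power_mult_distrib power2_eq_square flip: powr_add)
    finally show ?thesis .
  qed
  then show ?thesis using C(1) by (intro exI[of _ "10 * C\<^sup>2"]) auto
qed

section \<open>Completeness of the waves on the torus\<close>

definition wave :: "int \<times> int \<Rightarrow> real \<times> real \<Rightarrow> complex" where
  "wave k z = cis (freq k \<bullet> z)"

abbreviation torus_box :: "(real \<times> real) set" where
  "torus_box \<equiv> cbox (0, 0) (2 * pi, 2 * pi)"

definition doubly_periodic :: "(real \<times> real \<Rightarrow> 'a) \<Rightarrow> bool" where
  "doubly_periodic f \<longleftrightarrow> (\<forall>z w. lattice_equiv z w \<longrightarrow> f z = f w)"

lemma wave_pair: "wave k (x, y) = cis (of_int (fst k) * x) * cis (of_int (snd k) * y)"
  by (simp add: wave_def freq_def cis_mult)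

lemma wave_add: "wave j z * wave k z = wave (j + k) z"
  by (simp add: wave_def freq_def cis_mult inner_add_left flip: add_Pair)

lemma wave_0 [simp]: "wave 0 z = 1"
  by (simp add: wave_def freq_def inner_prod_def)

lemma cnj_wave: "cnj (wave k z) = wave (- k) z"
  by (simp add: wave_def freq_def cis_cnj inner_prod_def)

lemma norm_wave [simp]: "norm (wave k z) = 1"
  by (simp add: wave_def)

lemma continuous_on_wave [continuous_intros]: "continuous_on S (wave k)"
  unfolding wave_def by (intro continuous_intros)

lemma cis_integer_period: "cis (of_int m * (x + 2 * pi * of_int j)) = cis (of_int m * x)"
proof -
  have "cis (of_int m * (x + 2 * pi * of_int j)) = cis (of_int m * x) * cis (2 * pi * of_int (m * j))"
    by (simp add: cis_mult algebra_simps)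
  moreover have "cis (2 * pi * of_int (m * j)) = 1"
    by (rule cis_multiple_2pi) auto
  ultimately show ?thesis by simp
qed

lemma doubly_periodic_wave: "doubly_periodic (wave k)"
  unfolding doubly_periodic_def lattice_equiv_def
  by (auto simp: wave_pair cis_integer_period simp del: cis_mult)

lemma integral_cis_period:
  assumes "m \<noteq> (0::int)"
  shows "integral {0..2 * pi} (\<lambda>x. cis (of_int m * x)) = 0"
proof -
  define F where "F x = cis (of_int m * x) / (\<i> * of_int m)" for x :: real
  have "((\<lambda>x. cis (of_int m * x)) has_integral F (2 * pi) - F 0) {0..2 * pi}"
  proof (rule fundamental_theorem_of_calculus)
    fix x :: real
    have "((\<lambda>x. cis (of_int m * x)) has_derivative (\<lambda>t. (of_int m * t) *\<^sub>R (\<i> * cis (of_int m * x)))) (at x within {0..2 * pi})"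
      by (auto intro!: derivative_eq_intros)
    then have "((\<lambda>x. cis (of_int m * x)) has_vector_derivative (\<i> * of_int m * cis (of_int m * x))) (at x within {0..2 * pi})"
      by (simp add: has_vector_derivative_def scaleR_conv_of_real mult_ac)
    from has_vector_derivative_divide[OF this, of "\<i> * of_int m"]
    show "(F has_vector_derivative cis (of_int m * x)) (at x within {0..2 * pi})"
      using assms by (simp add: F_def[abs_def])
  qed auto
  moreover have "F (2 * pi) = F 0"
    using cis_integer_period[of m 0 1] by (simp add: F_def)
  ultimately show ?thesis by (simp add: integral_unique)
qed

lemma integral_wave:
  "integral torus_box (wave k) = (if k = 0 then of_real (4 * pi\<^sup>2) else 0)"
proof -
  have "integral torus_box (wave k) = integral (cbox 0 (2 * pi)) (\<lambda>x. integral (cbox 0 (2 * pi)) (\<lambda>y. wave k (x, y)))"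
    by (intro integral_prod_continuous continuous_intros)
  also have "\<dots> = integral {0..2 * pi} (\<lambda>x. cis (of_int (fst k) * x)) * integral {0..2 * pi} (\<lambda>y. cis (of_int (snd k) * y))"
    by (simp add: wave_pair)
  also have "\<dots> = (if k = 0 then of_real (4 * pi\<^sup>2) else 0)"
  proof (cases "k = 0")
    case True
    then show ?thesis by (simp add: power2_eq_square scaleR_conv_of_real)
  next
    case False
    then have "fst k \<noteq> 0 \<or> snd k \<noteq> 0" by (simp add: prod_eq_iff)
    then show ?thesis using False integral_cis_period by auto
  qed
  finally show ?thesis .
qed

lemma integral_wave_product:
  "integral torus_box (\<lambda>z. wave j z * wave k z) = (if k = - j then of_real (4 * pi\<^sup>2) else 0)"
proof -
  have "j + k = 0 \<longleftrightarrow> k = - j" by (metis add_eq_0_iff)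
  then show ?thesis unfolding wave_add using integral_wave[of "j + k"] by simp
qed

lemma torus_of_periodic: "doubly_periodic (F \<circ> torus_of)"
  by (auto simp: doubly_periodic_def torus_of_eq_iff[symmetric])

text \<open>
  The trigonometric polynomials, generated so that closure under products is an induction.
\<close>

inductive trig_poly :: "(real \<times> real \<Rightarrow> complex) \<Rightarrow> bool" where
  monomial: "trig_poly (\<lambda>z. c * wave k z)"
| add: "trig_poly p \<Longrightarrow> trig_poly q \<Longrightarrow> trig_poly (\<lambda>z. p z + q z)"

lemma trig_poly_mult:
  assumes "trig_poly p" "trig_poly q"
  shows "trig_poly (\<lambda>z. p z * q z)"
  using assms
proof (induction rule: trig_poly.induct)
  case (monomial c k)
  from monomial show ?case
  proof (induction rule: trig_poly.induct)
    case (monomial d l)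
    have "(\<lambda>z. c * wave k z * (d * wave l z)) = (\<lambda>z. (c * d) * wave (k + l) z)"
      by (simp add: wave_add[symmetric] mult_ac)
    then show ?case using trig_poly.monomial by simp
  next
    case (add p q)
    then show ?case using trig_poly.add by (simp add: distrib_left)
  qed
next
  case (add p q)
  then show ?case using trig_poly.add by (simp add: distrib_right)
qed

lemma trig_poly_continuous: "trig_poly p \<Longrightarrow> continuous_on S p"
  by (induction rule: trig_poly.induct) (auto intro!: continuous_intros)

lemma integral_against_trig_poly:
  fixes h :: "real \<times> real \<Rightarrow> complex"
  assumes "continuous_on torus_box h" "\<And>k. integral torus_box (\<lambda>z. h z * wave k z) = 0" "trig_poly p"
  shows "integral torus_box (\<lambda>z. h z * p z) = 0"
  using assms(3)
proof (induction rule: trig_poly.induct)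
  case (monomial c k)
  have "integral torus_box (\<lambda>z. h z * (c * wave k z)) = integral torus_box (\<lambda>z. c * (h z * wave k z))"
    by (simp add: mult_ac)
  also have "\<dots> = 0" using assms(2)[of k] by simp
  finally show ?case .
next
  case (add p q)
  have "integral torus_box (\<lambda>z. h z * p z + h z * q z) = integral torus_box (\<lambda>z. h z * p z) + integral torus_box (\<lambda>z. h z * q z)"
    by (intro integral_add integrable_continuous continuous_on_mult assms(1)
        trig_poly_continuous[OF add.hyps(1)] trig_poly_continuous[OF add.hyps(2)])
  then show ?case using add.IH by (simp add: distrib_left)
qed

definition circle_pair :: "real \<times> real \<Rightarrow> complex \<times> complex" where
  "circle_pair z = (cis (fst z), cis (snd z))"

text \<open>
  The map onto the product of two circles identifies exactly the points that are equivalent modulo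
  the lattice, so it turns doubly periodic functions into functions on a compact Hausdorff space, to
  which the Stone-Weierstrass theorem applies.
\<close>

lemma circle_pair_surj: "circle_pair ` torus_box = sphere 0 1 \<times> sphere 0 1"
proof -
  have "\<exists>x\<in>{0..2 * pi}. a = cis x" if "norm a = 1" for a
    using that complex_norm_eq_1_exp[of a] Arg2pi_eq[of a] Arg2pi[of a]
    by (intro bexI[of _ "Arg2pi a"]) (auto simp: cis_conv_exp)
  note angle = this
  show ?thesis
  proof (intro set_eqI iffI)
    fix u assume "u \<in> circle_pair ` torus_box"
    then show "u \<in> sphere 0 1 \<times> sphere 0 1"
      by (auto simp: circle_pair_def)
  next
    fix u :: "complex \<times> complex" assume "u \<in> sphere 0 1 \<times> sphere 0 1"
    then have n: "norm (fst u) = 1" "norm (snd u) = 1"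
      by (auto simp: mem_Times_iff)
    obtain x y where x: "x \<in> {0..2 * pi}" "fst u = cis x" and y: "y \<in> {0..2 * pi}" "snd u = cis y"
      using angle[OF n(1)] angle[OF n(2)] by blast
    have "u = circle_pair (x, y)" using x y by (simp add: circle_pair_def prod_eq_iff)
    moreover have "(x, y) \<in> torus_box" using x y by (simp add: cbox_Pair_eq)
    ultimately show "u \<in> circle_pair ` torus_box" by (rule image_eqI)
  qed
qed

lemma circle_pair_eq_iff:
  "circle_pair z = circle_pair w \<longleftrightarrow> lattice_equiv z w"
proof -
  have one: "cis x = cis y \<longleftrightarrow> (\<exists>n::int. y = x + 2 * pi * of_int n)" for x y
  proof -
    have "cis x = cis y \<longleftrightarrow> (\<exists>n::int. \<i> * of_real y = \<i> * of_real x + of_int (2 * n) * of_real pi * \<i>)"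
      unfolding cis_conv_exp by (subst eq_commute, subst exp_eq) simp
    also have "\<dots> \<longleftrightarrow> (\<exists>n::int. y = x + 2 * pi * of_int n)"
    proof (rule ex_cong1)
      fix n :: int
      have "\<i> * of_real x + of_int (2 * n) * of_real pi * \<i> = \<i> * of_real (x + 2 * pi * of_int n)"
        by (simp add: algebra_simps)
      then show "\<i> * of_real y = \<i> * of_real x + of_int (2 * n) * of_real pi * \<i> \<longleftrightarrow> y = x + 2 * pi * of_int n"
        by (metis complex_i_not_zero mult_cancel_left of_real_eq_iff)
    qed
    finally show ?thesis .
  qed
  show ?thesis
    unfolding lattice_equiv_def circle_pair_def by (auto simp: one prod_eq_iff)
qed

text \<open>
  The function \<open>H\<close> induced on the product of two circles is continuous because the quotient map is
  closed on a compact fundamental domain. The algebra of functions that become trigonometric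
  polynomials contains the four coordinates, which separate points.
\<close>

lemma trig_poly_approximation:
  fixes h :: "real \<times> real \<Rightarrow> real"
  assumes "doubly_periodic h" "continuous_on UNIV h" "\<epsilon> > 0"
  shows "\<exists>p. trig_poly p \<and> (\<forall>z\<in>torus_box. norm (of_real (h z) - p z) < \<epsilon>)"
proof -
  define S :: "(complex \<times> complex) set" where "S = sphere 0 1 \<times> sphere 0 1"
  have S: "compact S" unfolding S_def by (intro compact_Times compact_sphere)
  define R where "R \<phi> \<longleftrightarrow> continuous_on S \<phi> \<and> trig_poly (\<lambda>z. of_real (\<phi> (circle_pair z)))" for \<phi> :: "complex \<times> complex \<Rightarrow> real"
  define H where "H u = h (SOME z. circle_pair z = u)" for u
  have H: "H (circle_pair z) = h z" for z
  proof -
    have "circle_pair (SOME w. circle_pair w = circle_pair z) = circle_pair z"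
      by (rule someI) simp
    then show ?thesis
      using assms(1) unfolding H_def doubly_periodic_def circle_pair_eq_iff by metis
  qed
  have contH: "continuous_on S H"
    unfolding continuous_on_closed_vimage[OF compact_imp_closed[OF S]]
  proof (intro allI impI)
    fix B :: "real set" assume B: "closed B"
    have "H -` B \<inter> S = circle_pair ` (torus_box \<inter> h -` B)"
      using circle_pair_surj H unfolding S_def[symmetric] by (auto simp: image_iff)
    moreover have "compact (torus_box \<inter> h -` B)"
      using assms(2) by (intro compact_Int_closed compact_cbox continuous_closed_vimage[OF B])
        (metis UNIV_I continuous_on_eq_continuous_within)
    then have "compact (circle_pair ` (torus_box \<inter> h -` B))"
      unfolding circle_pair_def by (intro compact_continuous_image continuous_intros)
    ultimately show "closed (H -` B \<inter> S)" using compact_imp_closed by simp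
  qed
  have Re_cis: "complex_of_real (cos t) = 1/2 * cis t + 1/2 * cis (- t)"
    and Im_cis: "complex_of_real (sin t) = - \<i>/2 * cis t + \<i>/2 * cis (- t)" for t
    by (auto simp: complex_eq_iff)
  have coord: "R (\<lambda>u. Re (fst u))" "R (\<lambda>u. Im (fst u))" "R (\<lambda>u. Re (snd u))" "R (\<lambda>u. Im (snd u))"
  proof -
    have w: "cis (fst z) = wave (1, 0) z" "cis (- fst z) = wave (-1, 0) z"
      "cis (snd z) = wave (0, 1) z" "cis (- snd z) = wave (0, -1) z" for z
      by (auto simp: wave_def freq_def inner_prod_def)
    have "(\<lambda>z. complex_of_real (Re (fst (circle_pair z)))) = (\<lambda>z. 1/2 * wave (1, 0) z + 1/2 * wave (-1, 0) z)"
      "(\<lambda>z. complex_of_real (Im (fst (circle_pair z)))) = (\<lambda>z. - \<i>/2 * wave (1, 0) z + \<i>/2 * wave (-1, 0) z)"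
      "(\<lambda>z. complex_of_real (Re (snd (circle_pair z)))) = (\<lambda>z. 1/2 * wave (0, 1) z + 1/2 * wave (0, -1) z)"
      "(\<lambda>z. complex_of_real (Im (snd (circle_pair z)))) = (\<lambda>z. - \<i>/2 * wave (0, 1) z + \<i>/2 * wave (0, -1) z)"
      unfolding w[symmetric] circle_pair_def fst_conv snd_conv cis.sel Re_cis Im_cis by (rule refl)+
    note eqs = this
    have c: "continuous_on S (\<lambda>u. Re (fst u))" "continuous_on S (\<lambda>u. Im (fst u))"
      "continuous_on S (\<lambda>u. Re (snd u))" "continuous_on S (\<lambda>u. Im (snd u))"
      by (intro continuous_intros)+
    have "trig_poly (\<lambda>z. complex_of_real (Re (fst (circle_pair z))))" "trig_poly (\<lambda>z. complex_of_real (Im (fst (circle_pair z))))"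
      "trig_poly (\<lambda>z. complex_of_real (Re (snd (circle_pair z))))" "trig_poly (\<lambda>z. complex_of_real (Im (snd (circle_pair z))))"
      unfolding eqs by (intro trig_poly.add trig_poly.monomial)+
    then show "R (\<lambda>u. Re (fst u))" "R (\<lambda>u. Im (fst u))" "R (\<lambda>u. Re (snd u))" "R (\<lambda>u. Im (snd u))"
      unfolding R_def using c by simp_all
  qed
  have "\<exists>\<phi>. R \<phi> \<and> (\<forall>u\<in>S. \<bar>H u - \<phi> u\<bar> < \<epsilon>)"
  proof (rule Stone_Weierstrass_HOL[OF S _ _ _ _ _ contH assms(3)])
    show "R (\<lambda>_. c)" for c
      using trig_poly.monomial[of "of_real c" 0] by (simp add: R_def)
    show "R \<phi> \<Longrightarrow> continuous_on S \<phi>" for \<phi> by (simp add: R_def)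
    show "R \<phi> \<and> R \<psi> \<Longrightarrow> R (\<lambda>x. \<phi> x + \<psi> x)" for \<phi> \<psi>
      by (auto simp: R_def intro!: continuous_intros trig_poly.add)
    show "R \<phi> \<and> R \<psi> \<Longrightarrow> R (\<lambda>x. \<phi> x * \<psi> x)" for \<phi> \<psi>
      by (auto simp: R_def intro!: continuous_intros trig_poly_mult)
    show "\<exists>\<phi>. R \<phi> \<and> \<phi> u \<noteq> \<phi> w" if "u \<in> S \<and> w \<in> S \<and> u \<noteq> w" for u w
    proof -
      have "Re (fst u) \<noteq> Re (fst w) \<or> Im (fst u) \<noteq> Im (fst w) \<or> Re (snd u) \<noteq> Re (snd w) \<or> Im (snd u) \<noteq> Im (snd w)"
        using that by (auto simp: prod_eq_iff complex_eq_iff)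
      then show ?thesis using coord by blast
    qed
  qed
  then obtain \<phi> where \<phi>: "R \<phi>" "\<And>u. u \<in> S \<Longrightarrow> \<bar>H u - \<phi> u\<bar> < \<epsilon>" by blast
  have "norm (of_real (h z) - complex_of_real (\<phi> (circle_pair z))) < \<epsilon>" if "z \<in> torus_box" for z
  proof -
    have "circle_pair z \<in> S" using that circle_pair_surj unfolding S_def by blast
    from \<phi>(2)[OF this] show ?thesis unfolding H by (metis norm_of_real of_real_diff)
  qed
  then show ?thesis
    using \<phi>(1) unfolding R_def by blast
qed

text \<open>
  The function is orthogonal to every trigonometric polynomial, hence to polynomials arbitrarily close
  to its own conjugate, so its mean square vanishes.
\<close>

lemma wave_completeness:
  fixes h :: "real \<times> real \<Rightarrow> complex"
  assumes per: "doubly_periodic h" and cont: "continuous_on UNIV h"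
    and orth: "\<And>k. integral torus_box (\<lambda>z. h z * wave k z) = 0"
  shows "h z = 0"
proof -
  have cb: "continuous_on torus_box h" using cont continuous_on_subset by blast
  define I where "I = integral torus_box (\<lambda>z. (norm (h z))\<^sup>2)"
  have cI: "continuous_on torus_box (\<lambda>z. (norm (h z))\<^sup>2)" by (intro continuous_intros cb)
  have iI: "(\<lambda>z. (norm (h z))\<^sup>2) integrable_on torus_box" by (rule integrable_continuous[OF cI])
  define N where "N = integral torus_box (\<lambda>z. norm (h z))"
  have N0: "N \<ge> 0" unfolding N_def by (intro integral_nonneg integrable_continuous continuous_intros cb) auto
  have small: "I \<le> 2 * \<epsilon> * N" if \<epsilon>: "\<epsilon> > 0" for \<epsilon>
  proof -
    have per': "doubly_periodic (\<lambda>z. Re (h z))" "doubly_periodic (\<lambda>z. Im (h z))"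
      using per unfolding doubly_periodic_def by metis+
    obtain p where p: "trig_poly p" "\<And>z. z \<in> torus_box \<Longrightarrow> norm (of_real (Re (h z)) - p z) < \<epsilon>"
      using trig_poly_approximation[OF per'(1) continuous_on_Re[OF cont] \<epsilon>] by blast
    obtain q where q: "trig_poly q" "\<And>z. z \<in> torus_box \<Longrightarrow> norm (of_real (Im (h z)) - q z) < \<epsilon>"
      using trig_poly_approximation[OF per'(2) continuous_on_Im[OF cont] \<epsilon>] by blast
    define r where "r z = p z + (\<lambda>_. (- \<i>) * wave 0 z) z * q z" for z
    have r: "trig_poly r"
      unfolding r_def using trig_poly.add[OF p(1) trig_poly_mult[OF trig_poly.monomial[of "-\<i>" 0] q(1)]] by simp
    have near: "norm (cnj (h z) - r z) \<le> 2 * \<epsilon>" if "z \<in> torus_box" for z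
    proof -
      have "cnj (h z) - r z = (of_real (Re (h z)) - p z) - \<i> * (of_real (Im (h z)) - q z)"
        by (simp add: r_def complex_eq_iff)
      also have "norm \<dots> \<le> norm (of_real (Re (h z)) - p z) + norm (of_real (Im (h z)) - q z)"
        by (metis norm_ii norm_mult norm_triangle_ineq4 mult_1)
      finally show ?thesis using p(2)[OF that] q(2)[OF that] by linarith
    qed
    have cr: "continuous_on torus_box r" by (rule trig_poly_continuous[OF r])
    have "integral torus_box (\<lambda>z. h z * cnj (h z)) = integral torus_box (\<lambda>z. h z * (cnj (h z) - r z)) + integral torus_box (\<lambda>z. h z * r z)"
    proof -
      have "h z * cnj (h z) = h z * (cnj (h z) - r z) + h z * r z" for z
        by (simp add: algebra_simps)
      then have "integral torus_box (\<lambda>z. h z * cnj (h z)) = integral torus_box (\<lambda>z. h z * (cnj (h z) - r z) + h z * r z)"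
        by presburger
      also have "\<dots> = integral torus_box (\<lambda>z. h z * (cnj (h z) - r z)) + integral torus_box (\<lambda>z. h z * r z)"
        by (intro integral_add integrable_continuous continuous_intros cb cr)
      finally show ?thesis .
    qed
    also have "integral torus_box (\<lambda>z. h z * r z) = 0"
      by (rule integral_against_trig_poly[OF cb orth r])
    finally have eq: "integral torus_box (\<lambda>z. h z * cnj (h z)) = integral torus_box (\<lambda>z. h z * (cnj (h z) - r z))" by simp
    have "integral torus_box (\<lambda>z. h z * cnj (h z)) = integral torus_box (\<lambda>z. complex_of_real ((norm (h z))\<^sup>2))"
      by (simp flip: complex_norm_square)
    also have "\<dots> = of_real I"
      unfolding I_def using integral_linear[OF iI bounded_linear_of_real[where 'a = complex]] by (simp add: o_def)
    finally have "\<bar>I\<bar> = norm (integral torus_box (\<lambda>z. h z * (cnj (h z) - r z)))"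
      unfolding eq by (metis norm_of_real)
    also have "\<dots> \<le> integral torus_box (\<lambda>z. 2 * \<epsilon> * norm (h z))"
    proof (rule integral_norm_bound_integral)
      show "norm (h z * (cnj (h z) - r z)) \<le> 2 * \<epsilon> * norm (h z)" if "z \<in> torus_box" for z
        unfolding norm_mult using near[OF that] by (simp add: mult.commute mult_left_mono)
    qed (auto intro!: integrable_continuous continuous_intros cb cr)
    also have "\<dots> = 2 * \<epsilon> * N" by (simp add: N_def)
    finally show ?thesis by linarith
  qed
  have "I \<le> 0"
  proof (rule field_le_epsilon)
    fix e :: real assume "e > 0"
    have "I \<le> 2 * (e / (2 * (N + 1))) * N" using \<open>e > 0\<close> N0 by (intro small) auto
    also have "\<dots> \<le> e" using \<open>e > 0\<close> N0 by (simp add: divide_simps)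
    finally show "I \<le> 0 + e" by simp
  qed
  moreover have "I \<ge> 0" unfolding I_def by (intro integral_nonneg iI) auto
  ultimately have I0: "((\<lambda>z. (norm (h z))\<^sup>2) has_integral 0) torus_box"
    using iI by (simp add: I_def has_integral_integral)
  have zero: "(norm (h w))\<^sup>2 = 0" if "w \<in> torus_box" for w
    by (rule has_integral_0_cbox_imp_0[OF cI _ I0 _ that]) (auto simp: box_ne_empty Basis_prod_def)
  obtain w where "w \<in> torus_box" "circle_pair w = circle_pair z"
  proof -
    have "circle_pair z \<in> circle_pair ` torus_box" unfolding circle_pair_surj by (simp add: circle_pair_def)
    then show ?thesis by (rule imageE) (use that in auto)
  qed
  then show ?thesis
    using zero[of w] per unfolding circle_pair_eq_iff doubly_periodic_def by auto
qed

section \<open>Eigenfunctions are trigonometric sums\<close>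

text \<open>
  Green's identity in one variable: the integrand is the derivative of
  \<open>(\<phi>1 - \<i> * m * \<phi>) * cis (m * x)\<close>, which is periodic.
\<close>

lemma periodic_green_identity:
  fixes \<phi> \<phi>1 \<phi>2 :: "real \<Rightarrow> real" and m :: int
  assumes d1: "\<And>x. (\<phi> has_real_derivative \<phi>1 x) (at x)"
    and d2: "\<And>x. (\<phi>1 has_real_derivative \<phi>2 x) (at x)"
    and per: "\<phi> (2 * pi) = \<phi> 0" "\<phi>1 (2 * pi) = \<phi>1 0"
  shows "integral {0..2 * pi} (\<lambda>x. of_real (\<phi>2 x + (of_int m)\<^sup>2 * \<phi> x) * cis (of_int m * x)) = 0"
proof -
  define E where "E x = cis (of_int m * x)" for x :: real
  define G where "G x = (of_real (\<phi>1 x) - \<i> * of_int m * of_real (\<phi> x)) * E x" for x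
  have "((\<lambda>x. of_real (\<phi>2 x + (of_int m)\<^sup>2 * \<phi> x) * E x) has_integral G (2 * pi) - G 0) {0..2 * pi}"
  proof (rule fundamental_theorem_of_calculus)
    fix x :: real
    have "(E has_derivative (\<lambda>t. (of_int m * t) *\<^sub>R (\<i> * cis (of_int m * x)))) (at x within {0..2 * pi})"
      unfolding E_def by (auto intro!: derivative_eq_intros)
    then have E: "(E has_vector_derivative (\<i> * of_int m * E x)) (at x within {0..2 * pi})"
      by (simp add: has_vector_derivative_def scaleR_conv_of_real mult_ac E_def)
    have \<phi>: "((\<lambda>x. complex_of_real (\<phi> x)) has_vector_derivative of_real (\<phi>1 x)) (at x within {0..2 * pi})"
      "((\<lambda>x. complex_of_real (\<phi>1 x)) has_vector_derivative of_real (\<phi>2 x)) (at x within {0..2 * pi})"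
      using has_vector_derivative_of_real[OF has_field_derivative_at_within[OF d1]]
        has_vector_derivative_of_real[OF has_field_derivative_at_within[OF d2]] by blast+
    have "((\<lambda>x. of_real (\<phi>1 x) - \<i> * of_int m * of_real (\<phi> x)) has_vector_derivative (of_real (\<phi>2 x) - \<i> * of_int m * of_real (\<phi>1 x))) (at x within {0..2 * pi})"
      by (intro has_vector_derivative_diff has_vector_derivative_mult_right \<phi>)
    from has_vector_derivative_mult[OF this E]
    show "(G has_vector_derivative of_real (\<phi>2 x + (of_int m)\<^sup>2 * \<phi> x) * E x) (at x within {0..2 * pi})"
      unfolding G_def[abs_def] by (simp add: algebra_simps power2_eq_square)
  qed auto
  moreover have "G (2 * pi) = G 0"
    using cis_integer_period[of m 0 1] per by (simp add: G_def E_def)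
  ultimately show ?thesis by (simp add: integral_unique E_def)
qed

lemma partial_deriv_slices:
  fixes f :: "real \<times> real \<Rightarrow> real"
  assumes "f differentiable_on UNIV"
  shows "((\<lambda>x. f (x, y)) has_real_derivative partial_deriv (1, 0) f (x, y)) (at x)"
    and "((\<lambda>y. f (x, y)) has_real_derivative partial_deriv (0, 1) f (x, y)) (at y)"
proof -
  define D where "D = frechet_derivative f (at (x, y))"
  have D: "(f has_derivative D) (at (x, y))"
    using assms unfolding D_def differentiable_on_def by (metis UNIV_I frechet_derivative_works)
  have lin: "D (h *\<^sub>R z) = h * D z" for h z
    using linear_cmul[OF has_derivative_linear[OF D], of h z] by simp
  have "((\<lambda>x. (x, y)) has_derivative (\<lambda>h. (h, 0))) (at x)"
    by (auto intro!: derivative_eq_intros)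
  then have "((\<lambda>x. f (x, y)) has_derivative (\<lambda>h. D (h, 0))) (at x)"
    using has_derivative_compose[of "\<lambda>x. (x, y)" _ x UNIV f D] D by simp
  moreover have "(\<lambda>h. D (h, 0)) = (*) (partial_deriv (1, 0) f (x, y))"
  proof
    fix h show "D (h, 0) = partial_deriv (1, 0) f (x, y) * h"
      using lin[of h "(1, 0)"] by (simp add: partial_deriv_def D_def)
  qed
  ultimately show "((\<lambda>x. f (x, y)) has_real_derivative partial_deriv (1, 0) f (x, y)) (at x)"
    unfolding has_field_derivative_def by metis
  have "((\<lambda>y. (x, y)) has_derivative (\<lambda>h. (0, h))) (at y)"
    by (auto intro!: derivative_eq_intros)
  then have "((\<lambda>y. f (x, y)) has_derivative (\<lambda>h. D (0, h))) (at y)"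
    using has_derivative_compose[of "\<lambda>y. (x, y)" _ y UNIV f D] D by simp
  moreover have "(\<lambda>h. D (0, h)) = (*) (partial_deriv (0, 1) f (x, y))"
  proof
    fix h show "D (0, h) = partial_deriv (0, 1) f (x, y) * h"
      using lin[of h "(0, 1)"] by (simp add: partial_deriv_def D_def)
  qed
  ultimately show "((\<lambda>y. f (x, y)) has_real_derivative partial_deriv (0, 1) f (x, y)) (at y)"
    unfolding has_field_derivative_def by metis
qed

lemma doubly_periodic_partial_deriv:
  fixes f :: "real \<times> real \<Rightarrow> real"
  assumes per: "doubly_periodic f" and diff: "f differentiable_on UNIV"
  shows "doubly_periodic (partial_deriv b f)"
  unfolding doubly_periodic_def
proof (intro allI impI)
  fix z w assume "lattice_equiv z w"
  then obtain m n :: int where w: "w = z + (2 * pi * of_int m, 2 * pi * of_int n)"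
    by (auto simp: lattice_equiv_def)
  define c where "c = (2 * pi * of_int m, 2 * pi * of_int n)"
  define D where "D = frechet_derivative f (at w)"
  have "(f has_derivative D) (at w)"
    using diff unfolding D_def differentiable_on_def by (metis UNIV_I frechet_derivative_works)
  then have "(f has_derivative D) (at (z + c))"
    by (simp add: w c_def)
  moreover have "((\<lambda>u. u + c) has_derivative (\<lambda>h. h)) (at z)"
    by (auto intro!: derivative_eq_intros)
  ultimately have "((\<lambda>u. f (u + c)) has_derivative D) (at z)"
    using has_derivative_compose by blast
  moreover have "f (u + c) = f u" for u
    using per unfolding doubly_periodic_def lattice_equiv_def c_def by metis
  ultimately have "(f has_derivative D) (at z)" by simp
  then show "partial_deriv b f z = partial_deriv b f w"
    unfolding partial_deriv_def D_def by (metis frechet_derivative_at)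
qed

lemma laplacian_plane:
  fixes f :: "real \<times> real \<Rightarrow> real"
  shows "laplacian f z = partial_deriv (1, 0) (partial_deriv (1, 0) f) z + partial_deriv (0, 1) (partial_deriv (0, 1) f) z"
proof -
  have B: "(Basis :: (real \<times> real) set) = {(1, 0), (0, 1)}" by (auto simp: Basis_prod_def)
  show ?thesis unfolding laplacian_def B by simp
qed

text \<open>
  Each of the two second derivatives is moved to the wave by Green's identity on the slices parallel
  to its axis, which have vanishing boundary terms by periodicity.
\<close>

lemma laplacian_wave_adjoint:
  fixes f :: "real \<times> real \<Rightarrow> real"
  assumes C2: "C2 f" and per: "doubly_periodic f"
  shows "integral torus_box (\<lambda>z. of_real (laplacian f z + (norm (freq k))\<^sup>2 * f z) * wave k z) = 0"
proof -
  define fx where "fx = partial_deriv (1, 0) f"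
  define fy where "fy = partial_deriv (0, 1) f"
  define fxx where "fxx = partial_deriv (1, 0) fx"
  define fyy where "fyy = partial_deriv (0, 1) fy"
  define m n where "m = fst k" and "n = snd k"
  have b: "(1::real, 0::real) \<in> Basis" "(0::real, 1::real) \<in> Basis" by (auto simp: Basis_prod_def)
  have diff: "f differentiable_on UNIV" "fx differentiable_on UNIV" "fy differentiable_on UNIV"
    using C2 b by (auto simp: C2_def fx_def fy_def)
  have cont: "continuous_on UNIV fxx" "continuous_on UNIV fyy" "continuous_on UNIV f"
    using C2 b differentiable_imp_continuous_on[OF diff(1)] by (auto simp: C2_def fx_def fy_def fxx_def fyy_def)
  then have cont: "continuous_on torus_box fxx" "continuous_on torus_box fyy" "continuous_on torus_box f"
    using continuous_on_subset by blast+
  have perx: "doubly_periodic fx" "doubly_periodic fy"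
    unfolding fx_def fy_def by (rule doubly_periodic_partial_deriv[OF per diff(1)])+
  have px: "h (2 * pi, y) = h (0, y)" if "doubly_periodic h" for h :: "real \<times> real \<Rightarrow> real" and y
  proof -
    have "lattice_equiv (0, y) (2 * pi, y)"
      unfolding lattice_equiv_def by (intro exI[of _ 1] exI[of _ 0]) simp
    then show ?thesis using that unfolding doubly_periodic_def by metis
  qed
  have py: "h (x, 2 * pi) = h (x, 0)" if "doubly_periodic h" for h :: "real \<times> real \<Rightarrow> real" and x
  proof -
    have "lattice_equiv (x, 0) (x, 2 * pi)"
      unfolding lattice_equiv_def by (intro exI[of _ 0] exI[of _ 1]) simp
    then show ?thesis using that unfolding doubly_periodic_def by metis
  qed
  define G1 where "G1 z = of_real (fxx z + (of_int m)\<^sup>2 * f z) * wave k z" for z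
  define G2 where "G2 z = of_real (fyy z + (of_int n)\<^sup>2 * f z) * wave k z" for z
  have cG: "continuous_on torus_box G1" "continuous_on torus_box G2"
    unfolding G1_def G2_def by (intro continuous_intros cont)+
  have "integral torus_box G1 = integral (cbox 0 (2 * pi)) (\<lambda>x. integral (cbox 0 (2 * pi)) (\<lambda>y. G1 (x, y)))"
    by (rule integral_prod_continuous[OF cG(1)])
  also have "\<dots> = integral (cbox 0 (2 * pi)) (\<lambda>y. integral (cbox 0 (2 * pi)) (\<lambda>x. G1 (x, y)))"
    using integral_swap_continuous[of 0 0 "2 * pi" "2 * pi" "\<lambda>x y. G1 (x, y)"] cG(1) by (simp add: case_prod_unfold)
  also have "\<dots> = integral (cbox 0 (2 * pi)) (\<lambda>y. 0)"
  proof (rule arg_cong[where f = "integral (cbox 0 (2 * pi))"], rule ext)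
    fix y
    have "integral {0..2 * pi} (\<lambda>x. of_real (fxx (x, y) + (of_int m)\<^sup>2 * f (x, y)) * cis (of_int m * x)) = 0"
      using px[OF per] px[OF perx(1)] partial_deriv_slices(1)[OF diff(1)] partial_deriv_slices(1)[OF diff(2)]
      by (intro periodic_green_identity[of "\<lambda>x. f (x, y)" "\<lambda>x. fx (x, y)"]) (auto simp: fx_def fxx_def)
    then show "integral (cbox 0 (2 * pi)) (\<lambda>x. G1 (x, y)) = 0"
      by (simp add: G1_def wave_pair m_def mult.assoc[symmetric] del: of_real_add of_real_mult)
  qed
  finally have G1: "integral torus_box G1 = 0" by simp
  have "integral torus_box G2 = integral (cbox 0 (2 * pi)) (\<lambda>x. integral (cbox 0 (2 * pi)) (\<lambda>y. G2 (x, y)))"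
    by (rule integral_prod_continuous[OF cG(2)])
  also have "\<dots> = integral (cbox 0 (2 * pi)) (\<lambda>x. 0)"
  proof (rule arg_cong[where f = "integral (cbox 0 (2 * pi))"], rule ext)
    fix x
    have "integral {0..2 * pi} (\<lambda>y. of_real (fyy (x, y) + (of_int n)\<^sup>2 * f (x, y)) * cis (of_int n * y)) = 0"
      using py[OF per] py[OF perx(2)] partial_deriv_slices(2)[OF diff(1)] partial_deriv_slices(2)[OF diff(3)]
      by (intro periodic_green_identity[of "\<lambda>y. f (x, y)" "\<lambda>y. fy (x, y)"]) (auto simp: fy_def fyy_def)
    moreover have "(\<lambda>y. G2 (x, y)) = (\<lambda>y. cis (of_int m * x) * (of_real (fyy (x, y) + (of_int n)\<^sup>2 * f (x, y)) * cis (of_int n * y)))"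
      by (auto simp: G2_def wave_pair m_def n_def mult_ac simp del: of_real_add of_real_mult cis_mult)
    ultimately show "integral (cbox 0 (2 * pi)) (\<lambda>y. G2 (x, y)) = 0"
      by (simp del: of_real_add of_real_mult)
  qed
  finally have G2: "integral torus_box G2 = 0" by simp
  have "of_real (laplacian f z + (norm (freq k))\<^sup>2 * f z) * wave k z = G1 z + G2 z" for z
    unfolding laplacian_plane norm_freq_square G1_def G2_def fx_def fy_def fxx_def fyy_def m_def n_def
    by (simp add: algebra_simps)
  then have "integral torus_box (\<lambda>z. of_real (laplacian f z + (norm (freq k))\<^sup>2 * f z) * wave k z) = integral torus_box (\<lambda>z. G1 z + G2 z)"
    by presburger
  also have "\<dots> = 0"
    using G1 G2 by (simp add: integral_add integrable_continuous[OF cG(1)] integrable_continuous[OF cG(2)])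
  finally show ?thesis .
qed

text \<open>
  By the previous lemma, \<open>(norm (freq k))\<^sup>2 - lam\<^sup>2\<close> annihilates the \<open>k\<close>-th Fourier coefficient.
  The remaining coefficients form a finite sum whose difference to the eigenfunction is orthogonal to
  all waves.
\<close>

theorem eigenfunction_expansion:
  assumes eig: "torus_eigenfunction lam F" and lam: "lam > 0"
  shows "\<exists>a. (\<forall>z. of_real (F (torus_of z)) = (\<Sum>k\<in>circle_freqs lam. a k * wave k z)) \<and>
    torus_L2_norm F = 2 * pi * sqrt (\<Sum>k\<in>circle_freqs lam. (norm (a k))\<^sup>2)"
proof -
  define f where "f = F \<circ> torus_of"
  define K where "K = circle_freqs lam"
  have finK: "finite K" unfolding K_def by (rule finite_circle_freqs)
  have C2: "C2 f"
    using eig by (simp add: torus_eigenfunction_def f_def)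
  have lap: "laplacian f z = - (lam\<^sup>2 * f z)" for z
  proof -
    have "- laplacian f z = lam\<^sup>2 * f z"
      using eig unfolding torus_eigenfunction_def f_def o_apply by blast
    then show ?thesis by linarith
  qed
  have per: "doubly_periodic f" unfolding f_def by (rule torus_of_periodic)
  have contf: "continuous_on S f" for S
    using C2 differentiable_imp_continuous_on continuous_on_subset unfolding C2_def by blast
  have cf: "continuous_on S (\<lambda>z. complex_of_real (f z))" for S by (intro continuous_intros contf)
  define I where "I k = integral torus_box (\<lambda>z. of_real (f z) * wave k z)" for k
  define a where "a k = I (- k) / of_real (4 * pi\<^sup>2)" for k
  have pi0: "complex_of_real (4 * pi\<^sup>2) \<noteq> 0" by simp
  have I0: "I k = 0" if "k \<notin> K" for k
  proof -
    have "0 = integral torus_box (\<lambda>z. of_real ((norm (freq k))\<^sup>2 - lam\<^sup>2) * (of_real (f z) * wave k z))"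
      using laplacian_wave_adjoint[OF C2 per, of k] unfolding lap by (simp add: algebra_simps)
    also have "\<dots> = of_real ((norm (freq k))\<^sup>2 - lam\<^sup>2) * I k"
      unfolding I_def by (rule integral_mult_right)
    finally have "complex_of_real ((norm (freq k))\<^sup>2 - lam\<^sup>2) = 0 \<or> I k = 0"
      by (metis mult_eq_0_iff)
    then have "(norm (freq k))\<^sup>2 = lam\<^sup>2 \<or> I k = 0"
      unfolding of_real_eq_0_iff by auto
    moreover have "(norm (freq k))\<^sup>2 \<noteq> lam\<^sup>2"
      using that lam by (auto simp: K_def circle_freqs_def power2_eq_iff_nonneg)
    ultimately show ?thesis by simp
  qed
  have Kneg: "- k \<in> K \<longleftrightarrow> k \<in> K" for k
    by (simp add: K_def circle_freqs_def freq_def norm_prod_def)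
  define h where "h z = of_real (f z) - (\<Sum>k\<in>K. a k * wave k z)" for z
  have "h z = 0" for z
  proof (rule wave_completeness)
    show "doubly_periodic h"
      unfolding doubly_periodic_def
    proof (intro allI impI)
      fix z w assume zw: "lattice_equiv z w"
      have "f z = f w" "\<And>k. wave k z = wave k w"
        using per doubly_periodic_wave zw unfolding doubly_periodic_def by blast+
      then show "h z = h w" by (simp add: h_def)
    qed
    show "continuous_on UNIV h" unfolding h_def by (intro continuous_intros cf)
    fix j
    have ii: "(\<lambda>z. of_real (f z) * wave j z) integrable_on torus_box"
      "\<And>k. (\<lambda>z. a k * (wave k z * wave j z)) integrable_on torus_box"
      by (intro integrable_continuous continuous_intros cf)+
    have "integral torus_box (\<lambda>z. h z * wave j z)
        = integral torus_box (\<lambda>z. of_real (f z) * wave j z - (\<Sum>k\<in>K. a k * (wave k z * wave j z)))"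
      by (simp add: h_def left_diff_distrib sum_distrib_right mult.assoc)
    also have "\<dots> = I j - (\<Sum>k\<in>K. integral torus_box (\<lambda>z. a k * (wave k z * wave j z)))"
      unfolding I_def using ii finK by (simp add: integral_diff integrable_sum integral_sum)
    also have "(\<Sum>k\<in>K. integral torus_box (\<lambda>z. a k * (wave k z * wave j z))) = (\<Sum>k\<in>K. if k = - j then a k * of_real (4 * pi\<^sup>2) else 0)"
      by (intro sum.cong refl) (auto simp: integral_wave_product)
    also have "\<dots> = (if - j \<in> K then I j else 0)"
      using finK pi0 by (simp add: a_def)
    also have "I j - \<dots> = 0" using I0[of j] Kneg[of j] by auto
    finally show "integral torus_box (\<lambda>z. h z * wave j z) = 0" .
  qed
  then have expand: "of_real (f z) = (\<Sum>k\<in>K. a k * wave k z)" for z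
    by (simp add: h_def)
  have "complex_of_real (integral torus_box (\<lambda>z. (f z)\<^sup>2)) = integral torus_box (\<lambda>z. complex_of_real ((f z)\<^sup>2))"
    using integral_linear[OF _ bounded_linear_of_real[where 'a = complex], of "\<lambda>z. (f z)\<^sup>2" torus_box]
    by (simp add: o_def integrable_continuous continuous_intros contf)
  also have "\<dots> = integral torus_box (\<lambda>z. \<Sum>k\<in>K. cnj (a k) * (of_real (f z) * wave (- k) z))"
  proof (rule arg_cong[where f = "integral torus_box"], rule ext)
    fix z
    have "complex_of_real ((f z)\<^sup>2) = of_real (f z) * cnj (of_real (f z))"
      by (simp add: power2_eq_square)
    also have "cnj (of_real (f z)) = (\<Sum>k\<in>K. cnj (a k) * wave (- k) z)"
      unfolding expand by (simp add: cnj_wave)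
    finally show "complex_of_real ((f z)\<^sup>2) = (\<Sum>k\<in>K. cnj (a k) * (of_real (f z) * wave (- k) z))"
      by (simp add: sum_distrib_left mult_ac)
  qed
  also have "\<dots> = (\<Sum>k\<in>K. integral torus_box (\<lambda>z. cnj (a k) * (of_real (f z) * wave (- k) z)))"
    by (rule integral_sum[OF finK]) (intro integrable_continuous continuous_intros cf)
  also have "\<dots> = (\<Sum>k\<in>K. complex_of_real (4 * pi\<^sup>2 * (norm (a k))\<^sup>2))"
  proof (intro sum.cong refl)
    fix k
    have "integral torus_box (\<lambda>z. cnj (a k) * (of_real (f z) * wave (- k) z)) = cnj (a k) * I (- k)"
      by (simp add: I_def)
    also have "I (- k) = of_real (4 * pi\<^sup>2) * a k" using pi0 by (simp add: a_def)
    also have "cnj (a k) * (of_real (4 * pi\<^sup>2) * a k) = of_real (4 * pi\<^sup>2) * (a k * cnj (a k))"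
      by (simp only: mult_ac)
    also have "a k * cnj (a k) = of_real ((norm (a k))\<^sup>2)"
      using complex_norm_square[of "a k"] by simp
    finally show "integral torus_box (\<lambda>z. cnj (a k) * (of_real (f z) * wave (- k) z)) = complex_of_real (4 * pi\<^sup>2 * (norm (a k))\<^sup>2)"
      by simp
  qed
  also have "\<dots> = complex_of_real (4 * pi\<^sup>2 * (\<Sum>k\<in>K. (norm (a k))\<^sup>2))"
    by (simp add: sum_distrib_left)
  finally have int: "integral torus_box (\<lambda>z. (f z)\<^sup>2) = 4 * pi\<^sup>2 * (\<Sum>k\<in>K. (norm (a k))\<^sup>2)"
    unfolding of_real_eq_iff .
  have "set_integrable lborel torus_box (\<lambda>z. (f z)\<^sup>2)"
    unfolding set_integrable_def by (intro borel_integrable_compact continuous_intros contf) simp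
  then have "set_lebesgue_integral lborel torus_box (\<lambda>z. (f z)\<^sup>2) = 4 * pi\<^sup>2 * (\<Sum>k\<in>K. (norm (a k))\<^sup>2)"
    using set_borel_integral_eq_integral(2) int by metis
  then have "torus_L2_norm F = sqrt (4 * pi\<^sup>2 * (\<Sum>k\<in>K. (norm (a k))\<^sup>2))"
    by (simp add: torus_L2_norm_def f_def cbox_Pair_eq)
  also have "\<dots> = 2 * pi * sqrt (\<Sum>k\<in>K. (norm (a k))\<^sup>2)"
    by (simp add: real_sqrt_mult)
  finally show ?thesis
    using expand unfolding f_def K_def by auto
qed

section \<open>Oscillatory integrals along a curved path\<close>

text \<open>
  The kernel \<open>v / (v\<^sup>2 + \<theta>\<^sup>2)\<close> is a smooth replacement for \<open>1 / v\<close> cut off at \<open>\<bar>v\<bar> = \<theta>\<close>; the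
  second estimate concerns its derivative.
\<close>

lemma resonance_kernel_bounds:
  fixes v \<theta> :: real
  assumes "\<theta> > 0"
  shows "\<bar>v / (v\<^sup>2 + \<theta>\<^sup>2)\<bar> \<le> 1 / (2 * \<theta>)"
    and "\<bar>(\<theta>\<^sup>2 - v\<^sup>2) / (v\<^sup>2 + \<theta>\<^sup>2)\<^sup>2\<bar> \<le> 1 / (v\<^sup>2 + \<theta>\<^sup>2)"
    and "1 / (v\<^sup>2 + \<theta>\<^sup>2) \<le> 1 / \<theta>\<^sup>2"
    and "v\<^sup>2 + \<theta>\<^sup>2 > 0"
proof -
  show pos: "v\<^sup>2 + \<theta>\<^sup>2 > 0" using assms by (simp add: add_nonneg_pos)
  have "0 \<le> (\<bar>v\<bar> - \<theta>)\<^sup>2" by simp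
  then have "\<bar>v\<bar> * (2 * \<theta>) \<le> v\<^sup>2 + \<theta>\<^sup>2" by (simp add: power2_diff mult_ac)
  then show "\<bar>v / (v\<^sup>2 + \<theta>\<^sup>2)\<bar> \<le> 1 / (2 * \<theta>)"
    using pos assms by (simp add: abs_divide divide_simps)
  have "\<bar>\<theta>\<^sup>2 - v\<^sup>2\<bar> \<le> v\<^sup>2 + \<theta>\<^sup>2"
    using zero_le_power2[of v] zero_le_power2[of \<theta>] by linarith
  then have "\<bar>\<theta>\<^sup>2 - v\<^sup>2\<bar> / (v\<^sup>2 + \<theta>\<^sup>2)\<^sup>2 \<le> (v\<^sup>2 + \<theta>\<^sup>2) / (v\<^sup>2 + \<theta>\<^sup>2)\<^sup>2"
    by (rule divide_right_mono) simp
  also have "\<dots> = 1 / (v\<^sup>2 + \<theta>\<^sup>2)"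
    using pos by (simp add: power2_eq_square)
  finally show "\<bar>(\<theta>\<^sup>2 - v\<^sup>2) / (v\<^sup>2 + \<theta>\<^sup>2)\<^sup>2\<bar> \<le> 1 / (v\<^sup>2 + \<theta>\<^sup>2)"
    by (simp add: abs_divide)
  show "1 / (v\<^sup>2 + \<theta>\<^sup>2) \<le> 1 / \<theta>\<^sup>2"
    using assms by (intro divide_left_mono) (auto simp: zero_less_mult_iff pos)
qed

text \<open>
  An arc-length parameterized planar path with curvature at least \<open>\<kappa>\<close>, with its first three
  derivatives and a common bound \<open>M\<close> for the last two of them.
\<close>

locale curved_path =
  fixes L \<kappa> M :: real and g g1 g2 g3 :: "real \<Rightarrow> real \<times> real"
  assumes L_pos: "L > 0" and \<kappa>_pos: "\<kappa> > 0"
    and deriv0: "\<And>t. t \<in> {0..L} \<Longrightarrow> (g has_vector_derivative g1 t) (at t within {0..L})"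
    and deriv1: "\<And>t. t \<in> {0..L} \<Longrightarrow> (g1 has_vector_derivative g2 t) (at t within {0..L})"
    and deriv2: "\<And>t. t \<in> {0..L} \<Longrightarrow> (g2 has_vector_derivative g3 t) (at t within {0..L})"
    and cont3: "continuous_on {0..L} g3"
    and unit_speed: "\<And>t. t \<in> {0..L} \<Longrightarrow> norm (g1 t) = 1"
    and curvature_lower: "\<And>t. t \<in> {0..L} \<Longrightarrow> \<kappa> \<le> norm (g2 t)"
    and bound2: "\<And>t. t \<in> {0..L} \<Longrightarrow> norm (g2 t) \<le> M"
    and bound3: "\<And>t. t \<in> {0..L} \<Longrightarrow> norm (g3 t) \<le> M"
begin

lemma M_pos: "M > 0"
  using curvature_lower[of 0] bound2[of 0] \<kappa>_pos L_pos by auto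

lemma conts: "continuous_on {0..L} g" "continuous_on {0..L} g1" "continuous_on {0..L} g2"
  by (meson continuous_on_eq_continuous_within has_vector_derivative_continuous deriv0 deriv1 deriv2)+

lemma inner_derivs:
  assumes "t \<in> {0..L}"
  shows "((\<lambda>t. e \<bullet> g t) has_real_derivative e \<bullet> g1 t) (at t within {0..L})"
    and "((\<lambda>t. e \<bullet> g1 t) has_real_derivative e \<bullet> g2 t) (at t within {0..L})"
    and "((\<lambda>t. e \<bullet> g2 t) has_real_derivative e \<bullet> g3 t) (at t within {0..L})"
  unfolding has_real_derivative_iff_has_vector_derivative
  using assms by (auto intro!: bounded_linear.has_vector_derivative[OF bounded_linear_inner_right] deriv0 deriv1 deriv2)

lemma orthogonal_acceleration:
  assumes "t \<in> {0..L}"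
  shows "g1 t \<bullet> g2 t = 0"
proof -
  have "((\<lambda>s. g1 s \<bullet> g1 s) has_vector_derivative (g1 t \<bullet> g2 t + g2 t \<bullet> g1 t)) (at t within {0..L})"
    using bounded_bilinear.has_vector_derivative[OF bounded_bilinear_inner deriv1[OF assms] deriv1[OF assms]] .
  then have "((\<lambda>s. 1::real) has_vector_derivative (g1 t \<bullet> g2 t + g2 t \<bullet> g1 t)) (at t within {0..L})"
    by (rule has_vector_derivative_transform[rotated 2]) (use assms unit_speed in \<open>auto simp: dot_square_norm\<close>)
  then have "g1 t \<bullet> g2 t + g2 t \<bullet> g1 t = 0"
    using vector_derivative_unique_within_closed_interval[of 0 L t] assms L_pos
    by (metis cbox_interval has_vector_derivative_const)
  then show ?thesis by (simp add: inner_commute)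
qed

text \<open>
  The vectors \<open>g1 t\<close> and \<open>g2 t / norm (g2 t)\<close> form an orthonormal frame, in which \<open>e\<close> is expanded.
\<close>

lemma frame_identity:
  assumes "t \<in> {0..L}" "norm e = 1"
  shows "(e \<bullet> g1 t)\<^sup>2 * (norm (g2 t))\<^sup>2 + (e \<bullet> g2 t)\<^sup>2 = (norm (g2 t))\<^sup>2"
proof -
  obtain a b c d x y where s: "g1 t = (a, b)" "g2 t = (c, d)" "e = (x, y)"
    by (cases "g1 t", cases "g2 t", cases e)
  have 1: "a\<^sup>2 + b\<^sup>2 = 1" using unit_speed[OF assms(1)] s by (simp add: norm_prod_def)
  have 2: "x\<^sup>2 + y\<^sup>2 = 1" using assms(2) s by (simp add: norm_prod_def)
  have 3: "a * c + b * d = 0" using orthogonal_acceleration[OF assms(1)] s by simp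
  define k where "k = a * d - b * c"
  have c: "c = - k * b"
  proof -
    have "c = c * (a\<^sup>2 + b\<^sup>2) - a * (a * c + b * d)" using 1 3 by simp
    also have "\<dots> = - k * b" by (simp add: k_def power2_eq_square algebra_simps)
    finally show ?thesis .
  qed
  have d: "d = k * a"
  proof -
    have "d = d * (a\<^sup>2 + b\<^sup>2) - b * (a * c + b * d)" using 1 3 by simp
    also have "\<dots> = k * a" by (simp add: k_def power2_eq_square algebra_simps)
    finally show ?thesis .
  qed
  have "(x * a + y * b)\<^sup>2 * (c\<^sup>2 + d\<^sup>2) + (x * c + y * d)\<^sup>2
      = k\<^sup>2 * ((x * a + y * b)\<^sup>2 * (a\<^sup>2 + b\<^sup>2) + (y * a - x * b)\<^sup>2)"
    unfolding c d by (simp add: power2_eq_square algebra_simps)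
  also have "\<dots> = k\<^sup>2 * ((x * a + y * b)\<^sup>2 + (y * a - x * b)\<^sup>2)"
    unfolding 1 by simp
  also have "\<dots> = k\<^sup>2 * ((x\<^sup>2 + y\<^sup>2) * (a\<^sup>2 + b\<^sup>2))"
    by (simp add: power2_eq_square algebra_simps)
  also have "\<dots> = c\<^sup>2 + d\<^sup>2"
    unfolding 2 unfolding c d by (simp add: power2_eq_square algebra_simps)
  finally show ?thesis
    by (simp add: s norm_prod_def)
qed

lemma slope_bounds:
  assumes "t \<in> {0..L}" "norm e = 1"
  shows "\<bar>e \<bullet> g1 t\<bar> \<le> 1" "\<bar>e \<bullet> g2 t\<bar> \<le> M" "\<bar>e \<bullet> g3 t\<bar> \<le> M"
  using Cauchy_Schwarz_ineq2[of e "g1 t"] Cauchy_Schwarz_ineq2[of e "g2 t"] Cauchy_Schwarz_ineq2[of e "g3 t"]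
    assms unit_speed[OF assms(1)] bound2[OF assms(1)] bound3[OF assms(1)] by auto

lemma acceleration_lower:
  assumes "t \<in> {0..L}" "norm e = 1"
  shows "\<kappa>\<^sup>2 * (1 - (e \<bullet> g1 t)\<^sup>2) \<le> (e \<bullet> g2 t)\<^sup>2"
proof -
  have "(e \<bullet> g1 t)\<^sup>2 \<le> 1" using slope_bounds(1)[OF assms] abs_square_le_1 by blast
  moreover have "\<kappa>\<^sup>2 \<le> (norm (g2 t))\<^sup>2" using curvature_lower[OF assms(1)] \<kappa>_pos by (intro power_mono) auto
  ultimately have "\<kappa>\<^sup>2 * (1 - (e \<bullet> g1 t)\<^sup>2) \<le> (norm (g2 t))\<^sup>2 * (1 - (e \<bullet> g1 t)\<^sup>2)"
    by (intro mult_right_mono) auto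
  also have "\<dots> = (e \<bullet> g2 t)\<^sup>2" using frame_identity[OF assms] by (simp add: algebra_simps)
  finally show ?thesis .
qed

definition resonance_const :: real where
  "resonance_const = (pi * M + L * (M * (pi / 2)) + \<kappa>\<^sup>2 * L) / \<kappa>\<^sup>2"

lemma resonance_const_pos: "resonance_const > 0"
  using L_pos M_pos \<kappa>_pos by (auto simp: resonance_const_def intro!: divide_pos_pos add_pos_pos)

lemma continuous_resonance_kernel:
  assumes "\<theta> > 0"
  shows "continuous_on {0..L} (\<lambda>t. 1 / ((e \<bullet> g1 t)\<^sup>2 + \<theta>\<^sup>2))"
  using assms by (intro continuous_intros conts) auto

text \<open>
  Let \<open>v\<close> be the slope of the path in direction \<open>e\<close>. The derivative of \<open>v' * arctan (v / \<theta>)\<close> is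
  \<open>\<theta> * v'\<^sup>2 / (v\<^sup>2 + \<theta>\<^sup>2)\<close> up to a bounded term, so the former has bounded integral; and
  \<open>v'\<^sup>2 \<ge> \<kappa>\<^sup>2 * (1 - v\<^sup>2)\<close>, so \<open>v'\<^sup>2\<close> may be replaced by \<open>\<kappa>\<^sup>2\<close>. This one identity replaces
  the localization of the stationary points of \<open>e \<bullet> g\<close>.
\<close>

lemma resonance_integral:
  assumes e: "norm e = 1" and \<theta>: "0 < \<theta>" "\<theta> \<le> 1"
  shows "integral {0..L} (\<lambda>t. 1 / ((e \<bullet> g1 t)\<^sup>2 + \<theta>\<^sup>2)) \<le> resonance_const / \<theta>"
proof -
  define v where "v t = e \<bullet> g1 t" for t
  define v' where "v' t = e \<bullet> g2 t" for t
  define v'' where "v'' t = e \<bullet> g3 t" for t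
  note pos = resonance_kernel_bounds(4)[OF \<theta>(1)]
  have c: "continuous_on {0..L} v" "continuous_on {0..L} v'" "continuous_on {0..L} v''"
    unfolding v_def v'_def v''_def by (intro continuous_intros conts cont3)+
  define P where "P t = \<theta> * (v' t)\<^sup>2 / ((v t)\<^sup>2 + \<theta>\<^sup>2)" for t
  define Q where "Q t = v'' t * arctan (v t / \<theta>)" for t
  have cP: "continuous_on {0..L} P"
    unfolding P_def using \<theta> by (intro continuous_intros c) auto
  have cQ: "continuous_on {0..L} Q"
    unfolding Q_def using \<theta> by (intro continuous_intros c) auto
  define D where "D t = v' t * arctan (v t / \<theta>)" for t
  have dD: "(D has_vector_derivative (P t + Q t)) (at t within {0..L})" if t: "t \<in> {0..L}" for t
  proof -
    have "(D has_real_derivative (v'' t * arctan (v t / \<theta>) + v' t * (v' t / \<theta> / (1 + (v t / \<theta>)\<^sup>2)))) (at t within {0..L})"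
      unfolding D_def v_def v'_def v''_def using \<theta>
      by (auto intro!: derivative_eq_intros inner_derivs t simp: divide_inverse)
    moreover have "v' t * (v' t / \<theta> / (1 + (v t / \<theta>)\<^sup>2)) = P t"
      using \<theta> pos[of "v t"] by (simp add: P_def field_simps power2_eq_square)
    ultimately show ?thesis
      by (simp add: has_real_derivative_iff_has_vector_derivative Q_def add.commute)
  qed
  have "((\<lambda>t. P t + Q t) has_integral (D L - D 0)) {0..L}"
    using fundamental_theorem_of_calculus[OF _ dD] L_pos by simp
  then have sum: "integral {0..L} P + integral {0..L} Q = D L - D 0"
    using integral_add[OF integrable_continuous_interval[OF cP] integrable_continuous_interval[OF cQ]]
    by (simp add: integral_unique)
  have at: "\<bar>arctan x\<bar> \<le> pi / 2" for x
    using arctan_bounded[of x] by auto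
  have Db: "\<bar>D t\<bar> \<le> M * (pi / 2)" if "t \<in> {0..L}" for t
    unfolding D_def abs_mult v'_def using slope_bounds[OF that e] at M_pos by (intro mult_mono) auto
  have Qb: "norm (integral {0..L} Q) \<le> M * (pi / 2) * (L - 0)"
  proof (rule integral_bound)
    show "norm (Q t) \<le> M * (pi / 2)" if "t \<in> {0..L}" for t
      unfolding Q_def real_norm_def abs_mult v''_def using slope_bounds[OF that e] at M_pos by (intro mult_mono) auto
  qed (use L_pos cQ in auto)
  have IP: "integral {0..L} P \<le> pi * M + L * (M * (pi / 2))"
    using sum Db[of 0] Db[of L] Qb L_pos by (auto simp: mult_ac)
  have pw: "\<kappa>\<^sup>2 * \<theta> * (1 / ((v t)\<^sup>2 + \<theta>\<^sup>2)) \<le> P t + \<kappa>\<^sup>2" if t: "t \<in> {0..L}" for t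
  proof -
    have "\<kappa>\<^sup>2 * \<theta> = \<theta> * (\<kappa>\<^sup>2 * (1 - (v t)\<^sup>2)) + \<kappa>\<^sup>2 * (\<theta> * (v t)\<^sup>2)"
      by (simp add: algebra_simps)
    also have "\<dots> \<le> \<theta> * (v' t)\<^sup>2 + \<kappa>\<^sup>2 * ((v t)\<^sup>2 + \<theta>\<^sup>2)"
    proof (intro add_mono mult_left_mono)
      show "\<kappa>\<^sup>2 * (1 - (v t)\<^sup>2) \<le> (v' t)\<^sup>2"
        unfolding v_def v'_def by (rule acceleration_lower[OF t e])
      have "\<theta> * (v t)\<^sup>2 \<le> 1 * (v t)\<^sup>2" using \<theta> by (intro mult_right_mono) auto
      then show "\<theta> * (v t)\<^sup>2 \<le> (v t)\<^sup>2 + \<theta>\<^sup>2"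
        using zero_le_power2[of \<theta>] by linarith
    qed (use \<theta> in auto)
    finally have "\<kappa>\<^sup>2 * \<theta> / ((v t)\<^sup>2 + \<theta>\<^sup>2)
        \<le> (\<theta> * (v' t)\<^sup>2 + \<kappa>\<^sup>2 * ((v t)\<^sup>2 + \<theta>\<^sup>2)) / ((v t)\<^sup>2 + \<theta>\<^sup>2)"
      using pos[of "v t"] by (intro divide_right_mono) auto
    also have "\<dots> = P t + \<kappa>\<^sup>2"
      using pos[of "v t"] by (simp add: P_def add_divide_distrib del: sum_power2_eq_zero_iff)
    finally show ?thesis by simp
  qed
  have "\<kappa>\<^sup>2 * \<theta> * integral {0..L} (\<lambda>t. 1 / ((v t)\<^sup>2 + \<theta>\<^sup>2)) = integral {0..L} (\<lambda>t. \<kappa>\<^sup>2 * \<theta> * (1 / ((v t)\<^sup>2 + \<theta>\<^sup>2)))"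
    by (simp only: integral_mult_right)
  also have "\<dots> \<le> integral {0..L} (\<lambda>t. P t + \<kappa>\<^sup>2)"
    using continuous_resonance_kernel[OF \<theta>(1), of e] cP pw
    by (intro integral_le integrable_continuous_interval continuous_on_mult continuous_on_add continuous_on_const)
      (auto simp: v_def)
  also have "\<dots> = integral {0..L} P + \<kappa>\<^sup>2 * L"
    using integral_add[OF integrable_continuous_interval[OF cP] integrable_const_ivl[of "\<kappa>\<^sup>2" 0 L]] L_pos
    by (simp add: mult.commute)
  finally have "\<kappa>\<^sup>2 * \<theta> * integral {0..L} (\<lambda>t. 1 / ((v t)\<^sup>2 + \<theta>\<^sup>2)) \<le> pi * M + L * (M * (pi / 2)) + \<kappa>\<^sup>2 * L"
    using IP by linarith
  then have "integral {0..L} (\<lambda>t. 1 / ((v t)\<^sup>2 + \<theta>\<^sup>2))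
      \<le> (pi * M + L * (M * (pi / 2)) + \<kappa>\<^sup>2 * L) / (\<kappa>\<^sup>2 * \<theta>)"
    using \<kappa>_pos \<theta> by (subst pos_le_divide_eq) (auto simp: mult_ac)
  then show ?thesis
    unfolding resonance_const_def v_def divide_divide_eq_left .
qed

definition oscillation_const :: real where
  "oscillation_const = resonance_const + 1 + M * resonance_const"

lemma oscillation_const_ge_1: "oscillation_const \<ge> 1"
  using resonance_const_pos M_pos by (simp add: oscillation_const_def)

lemma wave_derivative:
  assumes "t \<in> {0..L}"
  shows "((\<lambda>t. cis (\<zeta> \<bullet> g t)) has_vector_derivative (\<i> * of_real (\<zeta> \<bullet> g1 t) * cis (\<zeta> \<bullet> g t))) (at t within {0..L})"
proof -
  have "((\<lambda>t. \<zeta> \<bullet> g t) has_derivative (\<lambda>h. (\<zeta> \<bullet> g1 t) * h)) (at t within {0..L})"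
    using inner_derivs(1)[OF assms] by (simp add: has_field_derivative_def)
  from has_derivative_cis[OF this] show ?thesis
    by (simp add: has_vector_derivative_def scaleR_conv_of_real mult_ac)
qed

lemma slope_kernel_derivative:
  assumes "t \<in> {0..L}" "\<theta> > 0"
  shows "((\<lambda>t. (e \<bullet> g1 t) / ((e \<bullet> g1 t)\<^sup>2 + \<theta>\<^sup>2)) has_real_derivative
           ((e \<bullet> g2 t) * ((\<theta>\<^sup>2 - (e \<bullet> g1 t)\<^sup>2) / ((e \<bullet> g1 t)\<^sup>2 + \<theta>\<^sup>2)\<^sup>2))) (at t within {0..L})"
proof -
  define v where "v = e \<bullet> g1 t"
  define a where "a = e \<bullet> g2 t"
  have p: "v\<^sup>2 + \<theta>\<^sup>2 \<noteq> 0"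
    using resonance_kernel_bounds(4)[OF assms(2), of v] by linarith
  have 1: "((\<lambda>t. e \<bullet> g1 t) has_real_derivative a) (at t within {0..L})"
    unfolding a_def by (rule inner_derivs[OF assms(1)])
  have 2: "((\<lambda>t. (e \<bullet> g1 t)\<^sup>2 + \<theta>\<^sup>2) has_real_derivative 2 * v * a) (at t within {0..L})"
    by (rule derivative_eq_intros 1 refl)+ (simp add: v_def)
  have "((\<lambda>t. (e \<bullet> g1 t) / ((e \<bullet> g1 t)\<^sup>2 + \<theta>\<^sup>2)) has_real_derivative
      (a * (v\<^sup>2 + \<theta>\<^sup>2) - v * (2 * v * a)) / ((v\<^sup>2 + \<theta>\<^sup>2) * (v\<^sup>2 + \<theta>\<^sup>2))) (at t within {0..L})"
    using DERIV_divide[OF 1 2] p unfolding v_def by blast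
  moreover have "a * (v\<^sup>2 + \<theta>\<^sup>2) - v * (2 * v * a) = a * (\<theta>\<^sup>2 - v\<^sup>2)"
    by (simp add: power2_eq_square algebra_simps)
  ultimately show ?thesis
    by (simp add: v_def a_def power2_eq_square)
qed

text \<open>
  Split the amplitude with the weights \<open>\<theta>\<^sup>2 / (v\<^sup>2 + \<theta>\<^sup>2)\<close> and \<open>v * (v / (v\<^sup>2 + \<theta>\<^sup>2))\<close>, where
  \<open>v\<close> is the slope in the direction of \<open>\<zeta>\<close>. The first part is \<open>O(\<theta>)\<close> by the resonance integral.
  In the second part, the factor \<open>v\<close> makes \<open>v * cis (\<zeta> \<bullet> g)\<close> a derivative up to the factor
  \<open>\<i> * norm \<zeta>\<close>, and the derivative of the remaining kernel is again controlled by the resonance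
  integral. The free parameter \<open>\<theta>\<close> and the bound \<open>W\<close> for the total variation of the amplitude make
  the estimate useful for amplitudes that change fast on a small set.
\<close>

lemma oscillatory_integral:
  fixes b b' w :: "real \<Rightarrow> real"
  assumes \<zeta>: "\<zeta> \<noteq> 0" and \<theta>: "0 < \<theta>" "\<theta> \<le> 1"
    and contb: "continuous_on {0..L} b" and S: "finite S"
    and db: "\<And>t. t \<in> {0<..<L} - S \<Longrightarrow> (b has_real_derivative b' t) (at t)"
    and bb: "\<And>t. t \<in> {0..L} \<Longrightarrow> \<bar>b t\<bar> \<le> B"
    and b'w: "\<And>t. t \<in> {0<..<L} - S \<Longrightarrow> \<bar>b' t\<bar> \<le> w t"
    and w0: "\<And>t. w t \<ge> 0" and intw: "w integrable_on {0..L}" and W: "integral {0..L} w \<le> W"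
  shows "norm (integral {0..L} (\<lambda>t. of_real (b t) * cis (\<zeta> \<bullet> g t)))
    \<le> oscillation_const * (B * \<theta> + (B + W) / (norm \<zeta> * \<theta>))"
proof -
  define \<rho> where "\<rho> = norm \<zeta>"
  have \<rho>: "\<rho> > 0" using \<zeta> by (simp add: \<rho>_def)
  define e where "e = (1 / \<rho>) *\<^sub>R \<zeta>"
  have e: "norm e = 1" using \<rho> by (simp add: e_def \<rho>_def)
  have \<zeta>e: "\<zeta> \<bullet> x = \<rho> * (e \<bullet> x)" for x using \<rho> by (simp add: e_def)
  define v where "v t = e \<bullet> g1 t" for t
  define q where "q t = 1 / ((v t)\<^sup>2 + \<theta>\<^sup>2)" for t
  define E where "E t = cis (\<zeta> \<bullet> g t)" for t
  define k where "k t = v t / ((v t)\<^sup>2 + \<theta>\<^sup>2)" for t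
  define k' where "k' t = (e \<bullet> g2 t) * ((\<theta>\<^sup>2 - (v t)\<^sup>2) / ((v t)\<^sup>2 + \<theta>\<^sup>2)\<^sup>2)" for t
  define d where "d t = (if t \<in> {0<..<L} - S then b' t else 0)" for t
  note ker = resonance_kernel_bounds[OF \<theta>(1)]
  have B0: "B \<ge> 0" using bb[of 0] L_pos by (auto intro: order_trans[OF abs_ge_zero])
  have cv: "continuous_on {0..L} v" unfolding v_def by (intro continuous_intros conts)
  have cq: "continuous_on {0..L} q" unfolding q_def v_def by (rule continuous_resonance_kernel[OF \<theta>(1)])
  have cE: "continuous_on {0..L} E" unfolding E_def by (intro continuous_intros conts)
  have ck: "continuous_on {0..L} k"
    unfolding k_def using \<theta> by (intro continuous_intros cv) auto
  have ck': "continuous_on {0..L} k'"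
    unfolding k'_def using \<theta> by (intro continuous_intros cv conts) auto
  have q: "integral {0..L} q \<le> resonance_const / \<theta>" "q t \<ge> 0" for t
    using resonance_integral[OF e \<theta>] ker(4)[of "v t"] unfolding q_def v_def by auto
  have kq: "\<theta>\<^sup>2 * q t + v t * k t = 1" for t
  proof -
    have "\<theta>\<^sup>2 * q t + v t * k t = ((v t)\<^sup>2 + \<theta>\<^sup>2) / ((v t)\<^sup>2 + \<theta>\<^sup>2)"
      unfolding q_def k_def add_divide_distrib
      by (simp only: power2_eq_square times_divide_eq_right mult_1_right add.commute)
    also have "\<dots> = 1"
      using ker(4)[of "v t"] by (intro divide_self) linarith
    finally show ?thesis .
  qed
  have iq: "q integrable_on {0..L}" using cq by (rule integrable_continuous_interval)
  define X where "X t = of_real (b t * (\<theta>\<^sup>2 * q t)) * E t" for t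
  define Y where "Y t = of_real (b t * (v t * k t)) * E t" for t
  have cX: "continuous_on {0..L} X" unfolding X_def by (intro continuous_intros contb cq cE)
  have cY: "continuous_on {0..L} Y" unfolding Y_def by (intro continuous_intros contb cv ck cE)
  have split: "integral {0..L} (\<lambda>t. of_real (b t) * E t) = integral {0..L} X + integral {0..L} Y"
  proof -
    have "of_real (b t) * E t = X t + Y t" for t
    proof -
      have "X t + Y t = of_real (b t * (\<theta>\<^sup>2 * q t + v t * k t)) * E t"
        by (simp add: X_def Y_def algebra_simps)
      then show ?thesis by (simp add: kq)
    qed
    then show ?thesis
      using integral_add[OF integrable_continuous_interval[OF cX] integrable_continuous_interval[OF cY]] by simp
  qed
  have Xb: "norm (integral {0..L} X) \<le> resonance_const * (B * \<theta>)"
  proof -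
    have "norm (integral {0..L} X) \<le> integral {0..L} (\<lambda>t. (B * \<theta>\<^sup>2) * q t)"
    proof (rule integral_norm_bound_integral)
      show "norm (X t) \<le> (B * \<theta>\<^sup>2) * q t" if "t \<in> {0..L}" for t
      proof -
        have "norm (X t) = \<bar>b t * (\<theta>\<^sup>2 * q t)\<bar>"
          by (simp add: X_def E_def norm_mult del: of_real_mult)
        also have "\<dots> = \<bar>b t\<bar> * (\<theta>\<^sup>2 * q t)"
          using q(2)[of t] by (simp add: abs_mult)
        also have "\<dots> \<le> B * (\<theta>\<^sup>2 * q t)"
          using bb[OF that] q(2)[of t] by (intro mult_right_mono) auto
        finally show ?thesis by simp
      qed
    qed (use integrable_continuous_interval[OF cX] integrable_on_mult_right[OF iq] in auto)
    also have "\<dots> = B * \<theta>\<^sup>2 * integral {0..L} q" by simp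
    also have "\<dots> \<le> B * \<theta>\<^sup>2 * (resonance_const / \<theta>)"
      using q(1) B0 by (intro mult_left_mono) auto
    also have "\<dots> = resonance_const * (B * \<theta>)" using \<theta> by (simp add: power2_eq_square)
    finally show ?thesis .
  qed
  define R where "R t = of_real (b t * k t) * E t" for t
  define r where "r t = of_real (d t * k t + b t * k' t) * E t" for t
  \<comment> \<open>integration by parts: \<open>r\<close> collects the terms in which the amplitude is differentiated\<close>
  have Rint: "((\<lambda>t. r t + (\<i> * of_real \<rho>) * Y t) has_integral (R L - R 0)) {0..L}"
  proof (rule fundamental_theorem_of_calculus_interior_strong[OF S])
    show "continuous_on {0..L} R" unfolding R_def by (intro continuous_intros contb ck cE)
    fix t assume t: "t \<in> {0<..<L} - S"
    then have t': "t \<in> {0..L}" and at: "at t within {0..L} = at t"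
      using at_within_Icc_at[of 0 t L] by auto
    have kd: "(k has_real_derivative k' t) (at t)"
      using slope_kernel_derivative[OF t' \<theta>(1), of e] unfolding at k_def k'_def v_def .
    have "((\<lambda>t. b t * k t) has_real_derivative (b' t * k t + b t * k' t)) (at t)"
      using DERIV_mult[OF db[OF t] kd] by (simp add: mult.commute)
    then have 1: "((\<lambda>t. complex_of_real (b t * k t)) has_vector_derivative of_real (d t * k t + b t * k' t)) (at t)"
      using t has_vector_derivative_of_real[of "\<lambda>t. b t * k t"]
      by (simp add: d_def has_real_derivative_iff_has_vector_derivative del: of_real_mult of_real_add)
    have 2: "(E has_vector_derivative (\<i> * of_real (\<rho> * v t) * E t)) (at t)"
      using wave_derivative[OF t', of \<zeta>] unfolding at E_def \<zeta>e v_def .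
    show "(R has_vector_derivative (r t + (\<i> * of_real \<rho>) * Y t)) (at t)"
      using has_vector_derivative_mult[OF 1 2] unfolding R_def r_def Y_def
      by (simp add: algebra_simps)
  qed (use L_pos in auto)
  have iY: "(\<lambda>t. (\<i> * of_real \<rho>) * Y t) integrable_on {0..L}"
    by (intro integrable_continuous_interval continuous_intros cY)
  have ir: "r integrable_on {0..L}"
    using integrable_diff[OF has_integral_integrable[OF Rint] iY] by simp
  have eqY: "(\<i> * of_real \<rho>) * integral {0..L} Y = R L - R 0 - integral {0..L} r"
    using integral_add[OF ir iY] integral_unique[OF Rint] by (simp add: algebra_simps)
  have kb: "\<bar>k t\<bar> \<le> 1 / (2 * \<theta>)" for t unfolding k_def by (rule ker)
  have Rb: "norm (R t) \<le> B * (1 / (2 * \<theta>))" if "t \<in> {0..L}" for t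
    using mult_mono[OF bb[OF that] kb[of t]] B0 by (simp add: R_def E_def norm_mult abs_mult)
  have rb: "norm (integral {0..L} r) \<le> W * (1 / (2 * \<theta>)) + B * M * (resonance_const / \<theta>)"
  proof -
    have "norm (integral {0..L} r) \<le> integral {0..L} (\<lambda>t. w t * (1 / (2 * \<theta>)) + (B * M) * q t)"
    proof (rule integral_norm_bound_integral[OF ir])
      show "(\<lambda>t. w t * (1 / (2 * \<theta>)) + (B * M) * q t) integrable_on {0..L}"
        using intw iq by (intro integrable_add integrable_on_mult_left integrable_on_mult_right)
      fix t assume t: "t \<in> {0..L}"
      have "\<bar>d t\<bar> \<le> w t" using b'w w0 by (auto simp: d_def)
      then have 1: "\<bar>d t * k t\<bar> \<le> w t * (1 / (2 * \<theta>))"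
        unfolding abs_mult using kb w0 by (intro mult_mono) auto
      have "\<bar>k' t\<bar> \<le> M * q t"
        unfolding k'_def abs_mult q_def using slope_bounds(2)[OF t e] ker(2)[of "v t"] M_pos by (intro mult_mono) auto
      then have 2: "\<bar>b t * k' t\<bar> \<le> B * (M * q t)"
        unfolding abs_mult using bb[OF t] B0 by (intro mult_mono) auto
      show "norm (r t) \<le> w t * (1 / (2 * \<theta>)) + (B * M) * q t"
        using 1 2 abs_triangle_ineq[of "d t * k t" "b t * k' t"]
        by (simp add: r_def E_def norm_mult mult.assoc del: of_real_add of_real_mult)
    qed
    also have "\<dots> = integral {0..L} w * (1 / (2 * \<theta>)) + B * M * integral {0..L} q"
    proof -
      have "integral {0..L} (\<lambda>t. w t * (1 / (2 * \<theta>)) + (B * M) * q t)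
        = integral {0..L} (\<lambda>t. w t * (1 / (2 * \<theta>))) + integral {0..L} (\<lambda>t. (B * M) * q t)"
        by (rule integral_add[OF integrable_on_mult_left[OF intw] integrable_on_mult_right[OF iq]])
      then show ?thesis by simp
    qed
    also have "\<dots> \<le> W * (1 / (2 * \<theta>)) + B * M * (resonance_const / \<theta>)"
      using W q(1) B0 M_pos \<theta> by (intro add_mono mult_right_mono mult_left_mono) auto
    finally show ?thesis .
  qed
  have W0: "W \<ge> 0" using integral_nonneg[OF intw] w0 W by (meson order_trans)
  have "\<rho> * norm (integral {0..L} Y) = norm ((\<i> * of_real \<rho>) * integral {0..L} Y)"
    using \<rho> by (simp add: norm_mult)
  also have "\<dots> \<le> norm (R L) + norm (R 0) + norm (integral {0..L} r)"
    unfolding eqY by (metis (no_types) add_mono norm_triangle_ineq4 norm_triangle_le_diff order_refl)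
  also have "\<dots> \<le> B / \<theta> + (W * (1 / (2 * \<theta>)) + B * M * (resonance_const / \<theta>))"
    using Rb[of 0] Rb[of L] rb L_pos by auto
  also have "\<dots> = (B + W / 2 + (M * resonance_const) * B) / \<theta>"
    using \<theta> by (simp add: field_simps)
  also have "\<dots> \<le> ((1 + M * resonance_const) * (B + W)) / \<theta>"
  proof (rule divide_right_mono)
    have "W / 2 \<le> W" "0 \<le> (M * resonance_const) * W"
      using W0 M_pos resonance_const_pos by auto
    then show "B + W / 2 + (M * resonance_const) * B \<le> (1 + M * resonance_const) * (B + W)"
      unfolding distrib_right distrib_left by linarith
  qed (use \<theta> in auto)
  finally have "norm (integral {0..L} Y) \<le> (1 + M * resonance_const) * ((B + W) / (\<rho> * \<theta>))"
    using \<rho> \<theta> by (simp add: field_simps)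
  with Xb have "norm (integral {0..L} X) + norm (integral {0..L} Y)
      \<le> resonance_const * (B * \<theta>) + (1 + M * resonance_const) * ((B + W) / (\<rho> * \<theta>))"
    by (rule add_mono)
  also have "\<dots> \<le> oscillation_const * (B * \<theta>) + oscillation_const * ((B + W) / (\<rho> * \<theta>))"
    using B0 W0 \<theta> \<rho> M_pos resonance_const_pos
    by (intro add_mono mult_right_mono) (auto simp: oscillation_const_def)
  finally have "norm (integral {0..L} X) + norm (integral {0..L} Y) \<le> oscillation_const * (B * \<theta> + (B + W) / (\<rho> * \<theta>))"
    by (simp add: distrib_left)
  then show ?thesis
    using norm_triangle_ineq[of "integral {0..L} X" "integral {0..L} Y"]
    unfolding split[symmetric] E_def \<rho>_def by linarith
qed

end

section \<open>Almost orthogonality of the waves on the curve\<close>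

lemma schur_test:
  fixes x :: "'a \<Rightarrow> real" and T :: "'a \<Rightarrow> 'a \<Rightarrow> real"
  assumes "finite K" and sym: "\<And>k l. T k l = T l k" and nonneg: "\<And>k l. k \<in> K \<Longrightarrow> l \<in> K \<Longrightarrow> T k l \<ge> 0"
    and row: "\<And>k. k \<in> K \<Longrightarrow> (\<Sum>l\<in>K. T k l) \<le> R"
  shows "(\<Sum>k\<in>K. \<Sum>l\<in>K. x k * x l * T k l) \<le> R * (\<Sum>k\<in>K. (x k)\<^sup>2)"
proof -
  have "(\<Sum>k\<in>K. \<Sum>l\<in>K. x k * x l * T k l) \<le> (\<Sum>k\<in>K. \<Sum>l\<in>K. ((x k)\<^sup>2 * T k l + (x l)\<^sup>2 * T k l) / 2)"
  proof (intro sum_mono)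
    fix k l assume kl: "k \<in> K" "l \<in> K"
    have "0 \<le> (x k - x l)\<^sup>2" by simp
    then have "x k * x l \<le> ((x k)\<^sup>2 + (x l)\<^sup>2) / 2" by (simp add: power2_diff)
    then have "x k * x l * T k l \<le> ((x k)\<^sup>2 + (x l)\<^sup>2) / 2 * T k l"
      using nonneg[OF kl] by (rule mult_right_mono)
    then show "x k * x l * T k l \<le> ((x k)\<^sup>2 * T k l + (x l)\<^sup>2 * T k l) / 2" by (simp add: algebra_simps)
  qed
  also have "\<dots> = ((\<Sum>k\<in>K. \<Sum>l\<in>K. (x k)\<^sup>2 * T k l) + (\<Sum>k\<in>K. \<Sum>l\<in>K. (x l)\<^sup>2 * T k l)) / 2"
    by (simp add: sum.distrib flip: sum_divide_distrib)
  also have "(\<Sum>k\<in>K. \<Sum>l\<in>K. (x l)\<^sup>2 * T k l) = (\<Sum>k\<in>K. \<Sum>l\<in>K. (x k)\<^sup>2 * T k l)"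
    by (subst sum.swap) (simp only: sym)
  also have "((\<Sum>k\<in>K. \<Sum>l\<in>K. (x k)\<^sup>2 * T k l) + (\<Sum>k\<in>K. \<Sum>l\<in>K. (x k)\<^sup>2 * T k l)) / 2 = (\<Sum>k\<in>K. (x k)\<^sup>2 * (\<Sum>l\<in>K. T k l))"
    unfolding sum_distrib_left by simp
  also have "\<dots> \<le> (\<Sum>k\<in>K. (x k)\<^sup>2 * R)"
    using row by (intro sum_mono mult_left_mono) auto
  finally show ?thesis by (simp add: sum_distrib_left mult.commute)
qed

context curved_path
begin

text \<open>
  The choice \<open>\<theta> = 1 / sqrt (norm \<zeta>)\<close>.
\<close>

lemma oscillatory_integral_decay:
  fixes b b' :: "real \<Rightarrow> real"
  assumes \<zeta>: "norm \<zeta> \<ge> 1"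
    and contb: "continuous_on {0..L} b"
    and db: "\<And>t. t \<in> {0<..<L} \<Longrightarrow> (b has_real_derivative b' t) (at t)"
    and bb: "\<And>t. t \<in> {0..L} \<Longrightarrow> \<bar>b t\<bar> \<le> B"
    and bb': "\<And>t. t \<in> {0<..<L} \<Longrightarrow> \<bar>b' t\<bar> \<le> B'" and "B' \<ge> 0"
  shows "norm (integral {0..L} (\<lambda>t. of_real (b t) * cis (\<zeta> \<bullet> g t)))
    \<le> 2 * oscillation_const * (B + L * B') / sqrt (norm \<zeta>)"
proof -
  define \<rho> where "\<rho> = sqrt (norm \<zeta>)"
  have \<rho>: "\<rho> \<ge> 1" "norm \<zeta> = \<rho> * \<rho>" using \<zeta> by (auto simp: \<rho>_def)
  have B0: "B \<ge> 0" using bb[of 0] L_pos by (auto intro: order_trans[OF abs_ge_zero])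
  have "norm (integral {0..L} (\<lambda>t. of_real (b t) * cis (\<zeta> \<bullet> g t)))
      \<le> oscillation_const * (B * (1 / \<rho>) + (B + L * B') / (norm \<zeta> * (1 / \<rho>)))"
    by (rule oscillatory_integral[where S = "{}" and w = "\<lambda>_. B'"]) (use assms \<rho> L_pos in auto)
  also have "(B + L * B') / (norm \<zeta> * (1 / \<rho>)) = (B + L * B') / \<rho>"
    using \<rho> by simp
  also have "oscillation_const * (B * (1 / \<rho>) + (B + L * B') / \<rho>) = oscillation_const * ((2 * B + L * B') / \<rho>)"
    by (simp add: add_divide_distrib)
  also have "\<dots> \<le> oscillation_const * ((2 * (B + L * B')) / \<rho>)"
    using \<rho> L_pos \<open>B' \<ge> 0\<close> oscillation_const_ge_1 by (intro mult_left_mono divide_right_mono) auto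
  also have "\<dots> = 2 * oscillation_const * (B + L * B') / sqrt (norm \<zeta>)"
    by (simp only: \<rho>_def times_divide_eq_right mult_ac)
  finally show ?thesis .
qed

text \<open>
  Expand the square. Pairs of frequencies at distance at least \<open>r\<close> are bounded by \<open>Q\<close>, and a given
  frequency is close to at most one other, so the near pairs are no worse than the diagonal. The
  matrix \<open>T\<close> of these bounds is symmetric with small row sums, as needed for Schur's test.
\<close>

lemma quasi_orthogonality:
  fixes lam :: real and b :: "int \<times> int \<Rightarrow> real \<Rightarrow> real" and a :: "int \<times> int \<Rightarrow> complex"
  defines "K \<equiv> circle_freqs lam"
  assumes lam: "lam > 0" "lam = r ^ 3"
    and contb: "\<And>k. k \<in> K \<Longrightarrow> continuous_on {0..L} (b k)"
    and D: "\<And>k. k \<in> K \<Longrightarrow> integral {0..L} (\<lambda>t. (b k t)\<^sup>2) \<le> D"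
    and far: "\<And>k l. k \<in> K \<Longrightarrow> l \<in> K \<Longrightarrow> norm (freq k - freq l) \<ge> r \<Longrightarrow>
        norm (integral {0..L} (\<lambda>t. of_real (b k t * b l t) * cis ((freq k - freq l) \<bullet> g t))) \<le> Q"
    and Q0: "Q \<ge> 0"
  shows "integral {0..L} (\<lambda>t. (norm (\<Sum>k\<in>K. a k * (of_real (b k t) * wave k (g t))))\<^sup>2)
    \<le> (2 * D + real (card K) * Q) * (\<Sum>k\<in>K. (norm (a k))\<^sup>2)"
proof -
  have finK: "finite K" unfolding K_def by (rule finite_circle_freqs)
  define J where "J k l = integral {0..L} (\<lambda>t. of_real (b k t * b l t) * cis ((freq k - freq l) \<bullet> g t))" for k l
  define \<Phi> where "\<Phi> t = (\<Sum>k\<in>K. a k * (of_real (b k t) * wave k (g t)))" for t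
  define T where "T k l = (if norm (freq k - freq l) < r then D else Q)" for k l
  have cw: "continuous_on {0..L} (\<lambda>t. wave k (g t))" for k
    unfolding wave_def by (intro continuous_intros conts)
  have c\<Phi>: "continuous_on {0..L} \<Phi>"
    unfolding \<Phi>_def by (intro continuous_intros cw contb)
  have cJ: "continuous_on {0..L} (\<lambda>t. of_real (b k t * b l t) * cis ((freq k - freq l) \<bullet> g t))" if "k \<in> K" "l \<in> K" for k l
    using that by (intro continuous_intros contb conts)
  have sq: "(\<lambda>t. (b k t)\<^sup>2) integrable_on {0..L}" if "k \<in> K" for k
    using that by (intro integrable_continuous_interval continuous_intros contb)
  have D0: "D \<ge> 0" if "k \<in> K" for k
    using integral_nonneg[OF sq[OF that]] D[OF that] by (meson order_trans zero_le_power2)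
  have JT: "norm (J k l) \<le> T k l" if kl: "k \<in> K" "l \<in> K" for k l
  proof (cases "norm (freq k - freq l) < r")
    case True
    have "norm (J k l) \<le> integral {0..L} (\<lambda>t. ((b k t)\<^sup>2 + (b l t)\<^sup>2) * (1 / 2))"
      unfolding J_def
    proof (rule integral_norm_bound_integral)
      show "(\<lambda>t. of_real (b k t * b l t) * cis ((freq k - freq l) \<bullet> g t)) integrable_on {0..L}"
        by (rule integrable_continuous_interval[OF cJ[OF kl]])
      show "(\<lambda>t. ((b k t)\<^sup>2 + (b l t)\<^sup>2) * (1 / 2)) integrable_on {0..L}"
        by (intro integrable_on_mult_left integrable_add sq kl)
      fix t
      have "0 \<le> (\<bar>b k t\<bar> - \<bar>b l t\<bar>)\<^sup>2" by simp
      then have "\<bar>b k t\<bar> * \<bar>b l t\<bar> \<le> ((b k t)\<^sup>2 + (b l t)\<^sup>2) * (1 / 2)" by (simp add: power2_diff)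
      then show "norm (of_real (b k t * b l t) * cis ((freq k - freq l) \<bullet> g t)) \<le> ((b k t)\<^sup>2 + (b l t)\<^sup>2) * (1 / 2)"
        by (simp add: norm_mult)
    qed
    also have "\<dots> = (integral {0..L} (\<lambda>t. (b k t)\<^sup>2) + integral {0..L} (\<lambda>t. (b l t)\<^sup>2)) * (1 / 2)"
      using integral_add[OF sq[OF kl(1)] sq[OF kl(2)]] by simp
    also have "\<dots> \<le> (D + D) * (1 / 2)"
      using D[OF kl(1)] D[OF kl(2)] by (intro mult_right_mono add_mono) auto
    also have "\<dots> = D" by simp
    finally show ?thesis using True by (simp add: T_def)
  next
    case False
    then show ?thesis using far[OF kl] by (simp add: T_def J_def)
  qed
  have row: "(\<Sum>l\<in>K. T k l) \<le> 2 * D + real (card K) * Q" if k: "k \<in> K" for k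
  proof -
    define N where "N = {l \<in> K. norm (freq k - freq l) < r}"
    have "card N \<le> 2"
      using card_near_frequencies[OF lam, of k] k by (simp add: N_def K_def)
    have "(\<Sum>l\<in>K. T k l) \<le> (\<Sum>l\<in>K. (if l \<in> N then D else 0) + Q)"
      using Q0 D0 by (intro sum_mono) (auto simp: T_def N_def)
    also have "\<dots> = real (card N) * D + real (card K) * Q"
      using finK by (simp add: sum.distrib N_def sum.If_cases Int_def)
    also have "\<dots> \<le> 2 * D + real (card K) * Q"
      using \<open>card N \<le> 2\<close> D0[OF k] by (intro add_right_mono mult_right_mono) auto
    finally show ?thesis .
  qed
  have expand: "complex_of_real ((norm (\<Phi> t))\<^sup>2)
      = (\<Sum>k\<in>K. \<Sum>l\<in>K. (a k * cnj (a l)) * (of_real (b k t * b l t) * cis ((freq k - freq l) \<bullet> g t)))" for t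
  proof -
    have "complex_of_real ((norm (\<Phi> t))\<^sup>2) = \<Phi> t * cnj (\<Phi> t)"
      using complex_norm_square[of "\<Phi> t"] by simp
    also have "\<dots> = (\<Sum>k\<in>K. \<Sum>l\<in>K. (a k * (of_real (b k t) * wave k (g t))) * (cnj (a l) * (of_real (b l t) * cnj (wave l (g t)))))"
      unfolding \<Phi>_def by (simp add: sum_product)
    also have "\<dots> = (\<Sum>k\<in>K. \<Sum>l\<in>K. (a k * cnj (a l)) * (of_real (b k t * b l t) * cis ((freq k - freq l) \<bullet> g t)))"
    proof (intro sum.cong refl)
      fix k l
      have "cis ((freq k - freq l) \<bullet> g t) = wave k (g t) * cnj (wave l (g t))"
        by (simp add: wave_def cis_cnj cis_mult inner_diff_left)
      then show "(a k * (of_real (b k t) * wave k (g t))) * (cnj (a l) * (of_real (b l t) * cnj (wave l (g t))))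
          = (a k * cnj (a l)) * (of_real (b k t * b l t) * cis ((freq k - freq l) \<bullet> g t))"
        by (simp add: mult_ac)
    qed
    finally show ?thesis .
  qed
  have c2: "(\<lambda>t. (norm (\<Phi> t))\<^sup>2) integrable_on {0..L}"
    by (intro integrable_continuous_interval continuous_intros c\<Phi>)
  have "complex_of_real (integral {0..L} (\<lambda>t. (norm (\<Phi> t))\<^sup>2)) = integral {0..L} (\<lambda>t. complex_of_real ((norm (\<Phi> t))\<^sup>2))"
    using integral_linear[OF c2 bounded_linear_of_real[where 'a = complex]] by (simp add: o_def)
  also have "\<dots> = (\<Sum>k\<in>K. \<Sum>l\<in>K. (a k * cnj (a l)) * J k l)"
  proof -
    have i: "(\<lambda>t. (a k * cnj (a l)) * (of_real (b k t * b l t) * cis ((freq k - freq l) \<bullet> g t))) integrable_on {0..L}"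
      if "k \<in> K" "l \<in> K" for k l
      by (intro integrable_on_mult_right integrable_continuous_interval cJ that)
    have "integral {0..L} (\<lambda>t. complex_of_real ((norm (\<Phi> t))\<^sup>2))
       = (\<Sum>k\<in>K. integral {0..L} (\<lambda>t. \<Sum>l\<in>K. (a k * cnj (a l)) * (of_real (b k t * b l t) * cis ((freq k - freq l) \<bullet> g t))))"
      unfolding expand by (intro integral_sum finK integrable_sum i)
    also have "\<dots> = (\<Sum>k\<in>K. \<Sum>l\<in>K. integral {0..L} (\<lambda>t. (a k * cnj (a l)) * (of_real (b k t * b l t) * cis ((freq k - freq l) \<bullet> g t))))"
      by (intro sum.cong refl integral_sum finK i)
    finally show ?thesis by (simp add: J_def del: of_real_mult)
  qed
  finally have "\<bar>integral {0..L} (\<lambda>t. (norm (\<Phi> t))\<^sup>2)\<bar> = norm (\<Sum>k\<in>K. \<Sum>l\<in>K. (a k * cnj (a l)) * J k l)"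
    by (metis norm_of_real)
  also have "\<dots> \<le> (\<Sum>k\<in>K. \<Sum>l\<in>K. norm (a k) * norm (a l) * T k l)"
  proof (intro sum_norm_le)
    fix k l assume "k \<in> K" "l \<in> K"
    then show "norm ((a k * cnj (a l)) * J k l) \<le> norm (a k) * norm (a l) * T k l"
      unfolding norm_mult complex_mod_cnj by (intro mult_left_mono JT) auto
  qed
  also have "\<dots> \<le> (2 * D + real (card K) * Q) * (\<Sum>k\<in>K. (norm (a k))\<^sup>2)"
    using D0 Q0 by (intro schur_test finK row) (auto simp: T_def norm_minus_commute)
  finally show ?thesis unfolding \<Phi>_def by linarith
qed

text \<open>
  The parameter \<open>\<mu> = lam powr (1/48)\<close> makes all the exponents in use natural numbers: there are
  \<open>O(\<mu>\<^sup>2)\<close> frequencies, the separation is \<open>r = \<mu> ^ 16\<close>, and an oscillatory integral at distance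
  \<open>r\<close> has size \<open>1 / \<mu> ^ 8\<close>. Hence the far pairs gain a factor \<open>1 / \<mu> ^ 6\<close> in total.
\<close>

lemma mean_square_bound:
  fixes lam :: real and b b' :: "int \<times> int \<Rightarrow> real \<Rightarrow> real" and a :: "int \<times> int \<Rightarrow> complex"
  defines "K \<equiv> circle_freqs lam"
  assumes \<mu>: "\<mu> \<ge> 1" "lam = \<mu> ^ 48" and C1: "real (card K) \<le> C1 * \<mu>\<^sup>2"
    and contb: "\<And>k. k \<in> K \<Longrightarrow> continuous_on {0..L} (b k)"
    and db: "\<And>k t. k \<in> K \<Longrightarrow> t \<in> {0<..<L} \<Longrightarrow> (b k has_real_derivative b' k t) (at t)"
    and bb: "\<And>k t. k \<in> K \<Longrightarrow> t \<in> {0..L} \<Longrightarrow> \<bar>b k t\<bar> \<le> B"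
    and bb': "\<And>k t. k \<in> K \<Longrightarrow> t \<in> {0<..<L} \<Longrightarrow> \<bar>b' k t\<bar> \<le> B'" and B: "B \<ge> 0" "B' \<ge> 0"
    and D: "\<And>k. k \<in> K \<Longrightarrow> integral {0..L} (\<lambda>t. (b k t)\<^sup>2) \<le> D"
  shows "integral {0..L} (\<lambda>t. (norm (\<Sum>k\<in>K. a k * (of_real (b k t) * wave k (g t))))\<^sup>2)
    \<le> (2 * D + 2 * oscillation_const * C1 * (B * B + 2 * L * (B * B')) / \<mu> ^ 6) * (\<Sum>k\<in>K. (norm (a k))\<^sup>2)"
proof -
  define Q where "Q = 2 * oscillation_const * (B * B + L * (2 * (B * B'))) / \<mu> ^ 8"
  have Q0: "Q \<ge> 0"
    unfolding Q_def using B L_pos \<mu> oscillation_const_ge_1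
    by (intro divide_nonneg_nonneg mult_nonneg_nonneg add_nonneg_nonneg) auto
  have \<mu>16: "1 \<le> \<mu> ^ 16" using \<mu> by simp
  have "integral {0..L} (\<lambda>t. (norm (\<Sum>k\<in>K. a k * (of_real (b k t) * wave k (g t))))\<^sup>2)
      \<le> (2 * D + real (card K) * Q) * (\<Sum>k\<in>K. (norm (a k))\<^sup>2)"
    unfolding K_def
  proof (rule quasi_orthogonality[where r = "\<mu> ^ 16"])
    show "lam > 0" using \<mu> by simp
    show "lam = (\<mu> ^ 16) ^ 3" using \<mu> by (simp flip: power_mult)
    fix k l assume kl: "k \<in> circle_freqs lam" "l \<in> circle_freqs lam" and far: "\<mu> ^ 16 \<le> norm (freq k - freq l)"
    have kl: "k \<in> K" "l \<in> K" using kl by (auto simp: K_def)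
    have "norm (integral {0..L} (\<lambda>t. of_real (b k t * b l t) * cis ((freq k - freq l) \<bullet> g t)))
        \<le> 2 * oscillation_const * (B * B + L * (2 * (B * B'))) / sqrt (norm (freq k - freq l))"
    proof (rule oscillatory_integral_decay)
      show "1 \<le> norm (freq k - freq l)" using far \<mu>16 by linarith
      show "continuous_on {0..L} (\<lambda>t. b k t * b l t)" using kl by (intro continuous_intros contb)
      show "((\<lambda>t. b k t * b l t) has_real_derivative (b' k t * b l t + b' l t * b k t)) (at t)" if "t \<in> {0<..<L}" for t
        by (rule DERIV_mult[OF db[OF kl(1) that] db[OF kl(2) that]])
      show "\<bar>b k t * b l t\<bar> \<le> B * B" if "t \<in> {0..L}" for t
        unfolding abs_mult using bb[OF kl(1) that] bb[OF kl(2) that] B by (intro mult_mono) auto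
      show "\<bar>b' k t * b l t + b' l t * b k t\<bar> \<le> 2 * (B * B')" if "t \<in> {0<..<L}" for t
      proof -
        have t: "t \<in> {0..L}" using that by auto
        have "\<bar>b' k t * b l t\<bar> \<le> B' * B" "\<bar>b' l t * b k t\<bar> \<le> B' * B"
          unfolding abs_mult using bb[OF kl(1) t] bb[OF kl(2) t] bb'[OF kl(1) that] bb'[OF kl(2) that] B
          by (auto intro!: mult_mono)
        then show ?thesis by (simp add: mult.commute)
      qed
      show "0 \<le> 2 * (B * B')" using B by simp
    qed
    also have "\<dots> \<le> Q"
    proof -
      have "\<mu> ^ 8 \<le> sqrt (norm (freq k - freq l))"
        using far \<mu> by (intro real_le_rsqrt) (simp flip: power_mult)
      then show ?thesis
        unfolding Q_def using B L_pos \<mu> oscillation_const_ge_1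
        by (intro divide_left_mono mult_nonneg_nonneg add_nonneg_nonneg mult_pos_pos) (auto intro: less_le_trans[of 0 "\<mu> ^ 8"])
    qed
    finally show "norm (integral {0..L} (\<lambda>t. of_real (b k t * b l t) * cis ((freq k - freq l) \<bullet> g t))) \<le> Q" .
  qed (use contb D Q0 in \<open>auto simp: K_def\<close>)
  also have "\<dots> \<le> (2 * D + 2 * oscillation_const * C1 * (B * B + 2 * L * (B * B')) / \<mu> ^ 6) * (\<Sum>k\<in>K. (norm (a k))\<^sup>2)"
  proof (intro mult_right_mono add_left_mono)
    have "real (card K) * Q \<le> (C1 * \<mu>\<^sup>2) * Q" using C1 Q0 by (intro mult_right_mono) auto
    also have "\<dots> = 2 * oscillation_const * C1 * (B * B + 2 * L * (B * B')) * (\<mu>\<^sup>2 / \<mu> ^ 8)"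
      by (simp add: Q_def mult_ac)
    also have "\<mu>\<^sup>2 / \<mu> ^ 8 = 1 / \<mu> ^ 6" using \<mu> by (simp add: field_simps flip: power_add)
    finally show "real (card K) * Q \<le> 2 * oscillation_const * C1 * (B * B + 2 * L * (B * B')) / \<mu> ^ 6" by simp
  qed (auto intro: sum_nonneg)
  finally show ?thesis .
qed

end

section \<open>Smoothing the sign of a function\<close>

text \<open>
  Extending the sign by zero beyond \<open>L\<close> allows averages over windows that leave the interval, at the
  price of one additional jump at \<open>L\<close>.
\<close>

definition cut_sign :: "real \<Rightarrow> (real \<Rightarrow> real) \<Rightarrow> real \<Rightarrow> real" where
  "cut_sign L \<phi> t = (if t \<in> {0..L} then sgn (\<phi> t) else 0)"

lemma abs_cut_sign_le: "\<bar>cut_sign L \<phi> t\<bar> \<le> 1"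
  by (auto simp: cut_sign_def sgn_real_def)

lemma cut_sign_integrable:
  assumes "continuous_on {0..L} \<phi>"
  shows "cut_sign L \<phi> integrable_on {a..b}"
proof -
  have "(\<lambda>t. indicator {0..L} t *\<^sub>R \<phi> t) \<in> borel_measurable borel"
    using assms by (rule borel_measurable_continuous_on_indicator[rotated]) auto
  then have "(\<lambda>t. sgn (indicator {0..L} t *\<^sub>R \<phi> t)) \<in> borel_measurable borel"
    by (rule measurable_compose[OF _ borel_measurable_sgn])
  also have "(\<lambda>t. sgn (indicator {0..L} t *\<^sub>R \<phi> t)) = cut_sign L \<phi>"
    by (auto simp: cut_sign_def indicator_def)
  finally have meas: "cut_sign L \<phi> \<in> borel_measurable borel" .
  have "set_integrable lborel {a..b} (cut_sign L \<phi>)"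
  proof (rule set_integrable_bound)
    show "set_integrable lborel {a..b} (\<lambda>_. 1 :: real)"
      unfolding set_integrable_def by (intro borel_integrable_compact continuous_intros) auto
    show "set_borel_measurable lborel {a..b} (cut_sign L \<phi>)"
      unfolding set_borel_measurable_def using meas by simp
  qed (use abs_cut_sign_le in auto)
  then show ?thesis by (rule set_borel_integral_eq_integral)
qed

lemma isCont_cut_sign:
  assumes "continuous_on {0..L} \<phi>" "t > 0" "t \<noteq> L" "t < L \<Longrightarrow> \<phi> t \<noteq> 0"
  shows "isCont (cut_sign L \<phi>) t"
proof (cases "t < L")
  case True
  then have t: "t \<in> {0<..<L}" using assms by auto
  have "isCont \<phi> t"
    using assms(1) t by (intro continuous_on_interior[of "{0..L}"]) auto
  then have "((\<lambda>x. sgn (\<phi> x)) \<longlongrightarrow> sgn (\<phi> t)) (at t)"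
    using assms(4)[OF True] by (intro tendsto_sgn) (auto simp: isCont_def)
  moreover have ev: "\<forall>\<^sub>F x in at t. sgn (\<phi> x) = cut_sign L \<phi> x"
    using eventually_at_in_open'[OF open_greaterThanLessThan t]
    by (rule eventually_mono) (auto simp: cut_sign_def)
  moreover have "sgn (\<phi> t) = cut_sign L \<phi> t" using t by (auto simp: cut_sign_def)
  ultimately show ?thesis
    unfolding isCont_def using tendsto_cong[OF ev, of "sgn (\<phi> t)"] by simp
next
  case False
  then have t: "t \<in> {L<..}" using assms by auto
  have "\<forall>\<^sub>F x in at t. cut_sign L \<phi> x = 0"
    using eventually_at_in_open'[OF open_greaterThan t]
    by (rule eventually_mono) (auto simp: cut_sign_def)
  moreover have "cut_sign L \<phi> t = 0" using t by (auto simp: cut_sign_def)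
  ultimately show ?thesis unfolding isCont_def by (simp add: tendsto_eventually)
qed

lemma sgn_constant_without_zeros:
  fixes \<phi> :: "real \<Rightarrow> real"
  assumes cont: "continuous_on {a..b} \<phi>" and nz: "\<And>t. t \<in> {a..b} \<Longrightarrow> \<phi> t \<noteq> 0" and x: "x \<in> {a..b}"
  shows "sgn (\<phi> x) = sgn (\<phi> a)"
proof (rule ccontr)
  assume ne: "sgn (\<phi> x) \<noteq> sgn (\<phi> a)"
  have c: "continuous_on {a..x} \<phi>" using cont x by (auto intro: continuous_on_subset)
  have "a \<in> {a..b}" using x by auto
  then consider "\<phi> a < 0" "\<phi> x > 0" | "\<phi> a > 0" "\<phi> x < 0"
    using ne nz[of a] nz[OF x] by (auto simp: sgn_real_def split: if_splits)
  then obtain y where "y \<in> {a..x}" "\<phi> y = 0"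
  proof cases
    case 1
    then show ?thesis using IVT'[of \<phi> a 0 x] c x that by auto
  next
    case 2
    then show ?thesis using IVT2'[of \<phi> x 0 a] c x that by auto
  qed
  then show False using nz[of y] x by auto
qed

text \<open>
  The function \<open>u t\<close> is the mean of the sign over \<open>{t..t + h}\<close>. It differs from the sign, and its
  derivative is nonzero, only if this window contains a jump; \<open>w\<close> is the indicator function of the
  set of these \<open>t\<close>, a union of \<open>m\<close> intervals of length \<open>h\<close>. The additional jump at \<open>L\<close> is the
  reason for the successor in \<open>m\<close>.
\<close>

lemma sign_smoothing:
  fixes \<phi> :: "real \<Rightarrow> real" and L h :: real
  assumes L: "L > 0" and h: "h > 0" and cont: "continuous_on {0..L} \<phi>"
    and fin: "finite {t \<in> {0..L}. \<phi> t = 0}"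
  defines "m \<equiv> Suc (card {t \<in> {0..L}. \<phi> t = 0})"
  obtains u u' w :: "real \<Rightarrow> real" and S where
    "continuous_on {0..L} u" "\<And>t. t \<in> {0..L} \<Longrightarrow> \<bar>u t\<bar> \<le> 1" "finite S"
    "\<And>t. t \<in> {0<..<L} - S \<Longrightarrow> (u has_real_derivative u' t) (at t)"
    "\<And>t. t \<in> {0<..<L} - S \<Longrightarrow> \<bar>u' t\<bar> \<le> (2 / h) * w t"
    "\<And>t. t \<in> {0..L} \<Longrightarrow> \<bar>sgn (\<phi> t) - u t\<bar> \<le> 2 * w t"
    "\<And>t. w t \<in> {0, 1}" "w integrable_on {0..L}" "integral {0..L} w \<le> real m * h"
proof -
  define s where "s = cut_sign L \<phi>"
  define J where "J = insert L {t \<in> {0..L}. \<phi> t = 0}"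
  have finJ: "finite J" using fin by (simp add: J_def)
  have cardJ: "card J \<le> m" unfolding J_def m_def using fin by (simp add: card_insert_if)
  have si: "s integrable_on {a..b}" for a b unfolding s_def by (rule cut_sign_integrable[OF cont])
  have sb: "\<bar>s t\<bar> \<le> 1" for t unfolding s_def by (rule abs_cut_sign_le)
  define u where "u t = (integral {0..t + h} s - integral {0..t} s) / h" for t
  define u' where "u' t = (s (t + h) - s t) / h" for t
  define E where "E = (\<Union>j\<in>J. {j - h..j})"
  define w where "w = indicat_real E"
  define S where "S = J \<union> (\<lambda>j. j - h) ` J"
  have u_eq: "u t = integral {t..t + h} s / h" if "t \<ge> 0" for t
    using Henstock_Kurzweil_Integration.integral_combine[of 0 t "t + h" s] that h si[of 0 "t + h"] by (simp add: u_def algebra_simps)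
  have ub: "\<bar>u t\<bar> \<le> 1" if "t \<in> {0..L}" for t
  proof -
    have "norm (integral {t..t + h} s) \<le> integral {t..t + h} (\<lambda>_. 1 :: real)"
      using si sb by (intro integral_norm_bound_integral) auto
    then have "\<bar>integral {t..t + h} s\<bar> \<le> h" using h by simp
    then show ?thesis using that h by (simp add: u_eq abs_divide)
  qed
  have E_iff: "t \<in> E \<longleftrightarrow> (\<exists>j\<in>J. j \<in> {t..t + h})" for t by (auto simp: E_def algebra_simps)
  have const: "s x = sgn (\<phi> t) \<and> t + h < L" if t: "t \<in> {0..L}" "t \<notin> E" and x: "x \<in> {t..t + h}" for t x
  proof -
    have tL: "t + h < L"
    proof (rule ccontr)
      assume "\<not> t + h < L"
      then have "L \<in> {t..t + h}" using t by auto
      then show False using t(2) unfolding E_iff J_def by blast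
    qed
    have "\<phi> y \<noteq> 0" if "y \<in> {t..t + h}" for y
    proof
      assume "\<phi> y = 0"
      then have "y \<in> J" using that tL t by (auto simp: J_def)
      then show False using that t(2) unfolding E_iff by blast
    qed
    moreover have "continuous_on {t..t + h} \<phi>"
      by (rule continuous_on_subset[OF cont]) (use t tL in auto)
    ultimately have "sgn (\<phi> x) = sgn (\<phi> t)" using sgn_constant_without_zeros x by blast
    moreover have "x \<in> {0..L}" using x t tL by auto
    ultimately show ?thesis using tL by (simp add: s_def cut_sign_def)
  qed
  have u_off: "u t = sgn (\<phi> t)" if t: "t \<in> {0..L}" "t \<notin> E" for t
  proof -
    have "integral {t..t + h} s = integral {t..t + h} (\<lambda>_. sgn (\<phi> t))"
      using const[OF t] by (intro integral_cong) auto
    then show ?thesis using t h by (simp add: u_eq)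
  qed
  show ?thesis
  proof
    have c: "continuous_on {0..L + h} (\<lambda>x. integral {0..x} s)"
      by (rule indefinite_integral_continuous_1[OF si])
    have "continuous_on {0..L} (\<lambda>t. integral {0..t + h} s)"
      by (rule continuous_on_compose2[OF c]) (use h in \<open>auto intro!: continuous_intros\<close>)
    moreover have "continuous_on {0..L} (\<lambda>t. integral {0..t} s)"
      by (rule continuous_on_subset[OF c]) (use h in auto)
    ultimately show "continuous_on {0..L} u"
      unfolding u_def using h by (intro continuous_intros) auto
    show "finite S" unfolding S_def using finJ by auto
    show "\<bar>u t\<bar> \<le> 1" if "t \<in> {0..L}" for t by (rule ub[OF that])
    show "(u has_real_derivative u' t) (at t)" if t: "t \<in> {0<..<L} - S" for t
    proof -
      have d: "((\<lambda>x. integral {0..x} s) has_real_derivative s x) (at x)"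
        if x: "x > 0" "x \<notin> J" for x
      proof -
        have "isCont s x"
          unfolding s_def using x by (intro isCont_cut_sign[OF cont]) (auto simp: J_def)
        then have "((\<lambda>u. integral {0..u} s) has_vector_derivative s x) (at x within ({0..x + 1} - {}))"
          using x by (intro integral_has_vector_derivative_continuous_at[OF si]) (auto intro: continuous_at_imp_continuous_at_within)
        then show ?thesis
          using at_within_Icc_at[of 0 x "x + 1"] x by (simp add: has_real_derivative_iff_has_vector_derivative)
      qed
      have "t \<notin> J" "t + h \<notin> J" using t by (auto simp: S_def image_iff)
      then have 1: "((\<lambda>x. integral {0..x} s) has_real_derivative s t) (at t)"
        and 2: "((\<lambda>x. integral {0..x} s) has_real_derivative s (t + h)) (at (t + h))"
        using d t h by auto
      have 3: "((\<lambda>x. integral {0..x + h} s) has_real_derivative s (t + h)) (at t)"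
        using 2 by (simp add: DERIV_shift)
      show ?thesis
        unfolding u_def u'_def using DERIV_cdivide[OF DERIV_diff[OF 3 1], of h] by simp
    qed
    show "\<bar>u' t\<bar> \<le> (2 / h) * w t" if t: "t \<in> {0<..<L} - S" for t
    proof (cases "t \<in> E")
      case True
      have "\<bar>s (t + h) - s t\<bar> \<le> 2" using sb[of t] sb[of "t + h"] by linarith
      then show ?thesis using True h by (simp add: w_def u'_def abs_divide divide_right_mono)
    next
      case False
      have "s (t + h) = s t" using const[of t t] const[of t "t + h"] False t h by auto
      then show ?thesis using False by (simp add: u'_def w_def)
    qed
    show "\<bar>sgn (\<phi> t) - u t\<bar> \<le> 2 * w t" if t: "t \<in> {0..L}" for t
    proof (cases "t \<in> E")
      case True
      have "\<bar>sgn (\<phi> t)\<bar> \<le> 1" by (auto simp: sgn_real_def)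
      moreover have "w t = 1" using True by (simp add: w_def)
      ultimately show ?thesis using ub[OF t] by linarith
    next
      case False
      then show ?thesis using u_off[OF t False] by (simp add: w_def)
    qed
    show "w t \<in> {0, 1}" for t by (auto simp: w_def indicator_def)
    have "compact (E \<inter> {0..L})"
      unfolding E_def using finJ by (intro compact_Int_closed compact_UN) auto
    then have lm: "E \<inter> {0..L} \<in> lmeasurable" by (rule lmeasurable_compact)
    then show iw: "w integrable_on {0..L}" unfolding w_def integrable_on_indicator .
    have lmj: "{j - h..j} \<inter> {0..L} \<in> lmeasurable" for j
      by (intro lmeasurable_compact compact_Int_closed) auto
    then have ij: "indicat_real {j - h..j} integrable_on {0..L}" for j
      unfolding integrable_on_indicator .
    have "integral {0..L} w \<le> integral {0..L} (\<lambda>t. \<Sum>j\<in>J. indicat_real {j - h..j} t)"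
    proof (rule integral_le[OF iw])
      show "(\<lambda>t. \<Sum>j\<in>J. indicat_real {j - h..j} t) integrable_on {0..L}"
        by (intro integrable_sum finJ ij)
      show "w t \<le> (\<Sum>j\<in>J. indicat_real {j - h..j} t)" for t
      proof (cases "t \<in> E")
        case True
        then obtain j where j: "j \<in> J" "t \<in> {j - h..j}" by (auto simp: E_def)
        have "indicat_real {j - h..j} t \<le> (\<Sum>j\<in>J. indicat_real {j - h..j} t)"
          by (rule member_le_sum[OF j(1)]) (auto simp: finJ)
        then show ?thesis using j True by (simp add: w_def)
      next
        case False
        then show ?thesis by (simp add: w_def sum_nonneg)
      qed
    qed
    also have "\<dots> = (\<Sum>j\<in>J. integral {0..L} (indicat_real {j - h..j}))"
      by (rule integral_sum[OF finJ ij])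
    also have "\<dots> \<le> (\<Sum>j\<in>J. h)"
    proof (rule sum_mono)
      fix j
      have "integral {0..L} (indicat_real {j - h..j}) = measure lebesgue ({j - h..j} \<inter> {0..L})"
        by (rule integral_indicator[OF lmj])
      also have "\<dots> \<le> measure lebesgue {j - h..j}"
        using lmj[of j] by (intro measure_mono_fmeasurable) (auto simp: fmeasurableD)
      also have "\<dots> = h" using h by simp
      finally show "integral {0..L} (indicat_real {j - h..j}) \<le> h" .
    qed
    also have "\<dots> \<le> real m * h" using cardJ h by simp
    finally show "integral {0..L} w \<le> real m * h" .
  qed
qed

section \<open>Mean values of restricted eigenfunctions\<close>

lemma le_sqrt_by_weighted_am_gm:
  fixes X W Y :: real
  assumes "W > 0" "Y \<ge> 0" and le: "\<And>c. c > 0 \<Longrightarrow> X \<le> (c * W + Y / c) / 2"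
  shows "X \<le> sqrt (W * Y)"
proof (cases "Y = 0")
  case True
  have "X \<le> 0"
  proof (rule field_le_epsilon)
    fix e :: real assume "e > 0"
    then have "X \<le> ((e / W) * W + Y / (e / W)) / 2" using assms by (intro le) auto
    also have "\<dots> = e / 2" using True assms by simp
    finally show "X \<le> 0 + e" using \<open>e > 0\<close> by simp
  qed
  then show ?thesis using True by simp
next
  case False
  define c where "c = sqrt Y / sqrt W"
  have p: "sqrt Y > 0" "sqrt W > 0" using assms False by auto
  have "W = sqrt W * sqrt W" "Y = sqrt Y * sqrt Y" using assms by auto
  then have e: "c * W = sqrt Y * sqrt W" "Y / c = sqrt Y * sqrt W"
    using p unfolding c_def by (auto simp: divide_simps)
  have "X \<le> (c * W + Y / c) / 2" using p by (intro le) (auto simp: c_def)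
  then show ?thesis unfolding e by (simp add: real_sqrt_mult mult.commute)
qed

text \<open>
  Cauchy-Schwarz for \<open>w\<close> and \<open>norm f\<close>, derived from the arithmetic-geometric mean inequality so
  that integrability is only asked for \<open>p\<close>, \<open>w\<close> and the square of \<open>norm f\<close>.
\<close>

lemma weighted_cauchy_schwarz:
  fixes f :: "real \<Rightarrow> complex" and p :: "real \<Rightarrow> 'a::banach"
  assumes ip: "p integrable_on {0..L}" and cf: "continuous_on {0..L} f"
    and w: "\<And>t. w t \<in> {0, 1}" "w integrable_on {0..L}" "integral {0..L} w \<le> W" "W > 0"
    and Y: "integral {0..L} (\<lambda>t. (norm (f t))\<^sup>2) \<le> Y"
    and le: "\<And>t. t \<in> {0..L} \<Longrightarrow> norm (p t) \<le> w t * norm (f t)"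
  shows "norm (integral {0..L} p) \<le> sqrt (W * Y)"
proof (rule le_sqrt_by_weighted_am_gm)
  have i2: "(\<lambda>t. (norm (f t))\<^sup>2) integrable_on {0..L}"
    by (intro integrable_continuous_interval continuous_intros cf)
  show "Y \<ge> 0" using integral_nonneg[OF i2] Y by (meson order_trans zero_le_power2)
  show "W > 0" by (rule w)
  fix c :: real assume c: "c > 0"
  have i: "(\<lambda>t. (c / 2) * w t + (1 / (2 * c)) * (norm (f t))\<^sup>2) integrable_on {0..L}"
    by (intro integrable_add integrable_on_mult_right w i2)
  have "norm (integral {0..L} p) \<le> integral {0..L} (\<lambda>t. (c / 2) * w t + (1 / (2 * c)) * (norm (f t))\<^sup>2)"
  proof (rule integral_norm_bound_integral[OF ip i])
    fix t assume t: "t \<in> {0..L}"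
    have "norm (f t) \<le> c / 2 + (1 / (2 * c)) * (norm (f t))\<^sup>2"
    proof -
      have "0 \<le> (c - norm (f t))\<^sup>2 / (2 * c)" using c by simp
      also have "\<dots> = c / 2 + (1 / (2 * c)) * (norm (f t))\<^sup>2 - norm (f t)"
        using c by (simp add: power2_diff divide_simps) (simp add: power2_eq_square algebra_simps)
      finally show ?thesis by simp
    qed
    moreover have "0 \<le> (1 / (2 * c)) * (norm (f t))\<^sup>2" using c by simp
    ultimately have "w t * norm (f t) \<le> (c / 2) * w t + (1 / (2 * c)) * (norm (f t))\<^sup>2"
      using w(1)[of t] by auto
    then show "norm (p t) \<le> (c / 2) * w t + (1 / (2 * c)) * (norm (f t))\<^sup>2"
      using le[OF t] by linarith
  qed
  also have "\<dots> = (c / 2) * integral {0..L} w + (1 / (2 * c)) * integral {0..L} (\<lambda>t. (norm (f t))\<^sup>2)"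
    using integral_add[OF integrable_on_mult_right[OF w(2), of "c / 2"] integrable_on_mult_right[OF i2, of "1 / (2 * c)"]] by simp
  also have "\<dots> \<le> (c / 2) * W + (1 / (2 * c)) * Y"
    using w Y c by (intro add_mono mult_left_mono) auto
  also have "\<dots> = (c * W + Y / c) / 2" using c by (simp add: field_simps)
  finally show "norm (integral {0..L} p) \<le> (c * W + Y / c) / 2" .
qed

definition (in curved_path) mean_square_const :: "real \<Rightarrow> real" where
  "mean_square_const C1 = 2 * L + 2 * resonance_const + 2 * oscillation_const * C1 * (1 + 2 * L * M)"

definition (in curved_path) restriction_const :: "real \<Rightarrow> real" where
  "restriction_const C1 = 4 * sqrt (mean_square_const C1) + sqrt (L * mean_square_const C1)
     + sqrt C1 * (4 * oscillation_const + 1 + L * M)"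

text \<open>
  The restriction \<open>\<phi>\<close> of an eigenfunction to a curved path, in terms of its coefficients. The
  assumption on the number of frequencies is the divisor bound with exponent \<open>1 / 24\<close>, in terms of
  \<open>\<mu> = lam powr (1/48)\<close>.
\<close>

locale restricted_wave = curved_path +
  fixes C1 \<mu> lam :: real and a :: "int \<times> int \<Rightarrow> complex" and \<phi> :: "real \<Rightarrow> real"
  assumes \<mu>_ge_1: "\<mu> \<ge> 1" and lam_eq: "lam = \<mu> ^ 48" and C1_ge_1: "C1 \<ge> 1"
    and card_freqs: "real (card (circle_freqs lam)) \<le> C1 * \<mu>\<^sup>2"
    and cont_\<phi>: "continuous_on {0..L} \<phi>"
    and expansion: "\<And>t. t \<in> {0..L} \<Longrightarrow> of_real (\<phi> t) = (\<Sum>k\<in>circle_freqs lam. a k * wave k (g t))"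
begin

abbreviation K where "K \<equiv> circle_freqs lam"

abbreviation P where "P \<equiv> mean_square_const C1"

definition \<sigma> where "\<sigma> = sqrt (\<Sum>k\<in>K. (norm (a k))\<^sup>2)"

definition packet :: "(int \<times> int \<Rightarrow> real \<Rightarrow> real) \<Rightarrow> real \<Rightarrow> complex" where
  "packet b t = (\<Sum>k\<in>K. a k * (of_real (b k t) * wave k (g t)))"

definition dir :: "int \<times> int \<Rightarrow> real \<times> real" where "dir k = (1 / lam) *\<^sub>R freq k"

lemma lam_ge_1: "lam \<ge> 1"
  using \<mu>_ge_1 lam_eq by simp

lemma \<sigma>_nonneg: "\<sigma> \<ge> 0" and \<sigma>_square: "\<sigma>\<^sup>2 = (\<Sum>k\<in>K. (norm (a k))\<^sup>2)"
  by (auto simp: \<sigma>_def sum_nonneg)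

lemma norm_dir: "k \<in> K \<Longrightarrow> norm (dir k) = 1"
  using lam_ge_1 by (simp add: dir_def circle_freqs_def)

lemma freq_dir: "freq k \<bullet> x = lam * (dir k \<bullet> x)"
  using lam_ge_1 by (simp add: dir_def)

lemma P_bounds: "P \<ge> 0" "2 * L + 2 * oscillation_const * C1 \<le> P"
  "2 * resonance_const + 2 * oscillation_const * C1 * (1 + 2 * L * M) \<le> P"
proof -
  have p: "0 \<le> 2 * oscillation_const * C1" "0 \<le> L * M"
    using oscillation_const_ge_1 C1_ge_1 L_pos M_pos by auto
  have "2 * oscillation_const * C1 * 1 \<le> 2 * oscillation_const * C1 * (1 + 2 * L * M)"
    using p by (intro mult_left_mono) auto
  then show "P \<ge> 0" "2 * L + 2 * oscillation_const * C1 \<le> P"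
    "2 * resonance_const + 2 * oscillation_const * C1 * (1 + 2 * L * M) \<le> P"
    using p L_pos resonance_const_pos by (auto simp: mean_square_const_def)
qed

lemma sum_coeffs: "(\<Sum>k\<in>K. norm (a k)) \<le> sqrt C1 * \<mu> * \<sigma>"
proof -
  have "(\<Sum>k\<in>K. norm (a k))\<^sup>2 \<le> (\<Sum>k\<in>K. (norm (a k))\<^sup>2) * card K"
    by (rule sum_squared_le_sum_of_squares)
  also have "\<dots> \<le> (\<Sum>k\<in>K. (norm (a k))\<^sup>2) * (C1 * \<mu>\<^sup>2)"
    using card_freqs by (intro mult_left_mono) (auto intro: sum_nonneg)
  also have "\<dots> = (sqrt C1 * \<mu> * \<sigma>)\<^sup>2"
    using C1_ge_1 by (simp add: power_mult_distrib \<sigma>_square mult_ac)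
  finally show ?thesis
    by (rule power2_le_imp_le) (use C1_ge_1 \<mu>_ge_1 \<sigma>_nonneg in auto)
qed

lemma norm_weighted_sum:
  assumes "\<And>k. k \<in> K \<Longrightarrow> norm (c k) \<le> B" "B \<ge> 0"
  shows "norm (\<Sum>k\<in>K. a k * c k) \<le> sqrt C1 * \<mu> * \<sigma> * B"
proof -
  have "norm (\<Sum>k\<in>K. a k * c k) \<le> (\<Sum>k\<in>K. norm (a k) * B)"
    using assms by (intro sum_norm_le) (auto simp: norm_mult mult_left_mono)
  also have "\<dots> = (\<Sum>k\<in>K. norm (a k)) * B" by (simp add: sum_distrib_right)
  also have "\<dots> \<le> sqrt C1 * \<mu> * \<sigma> * B"
    using assms sum_coeffs by (intro mult_right_mono)
  finally show ?thesis .
qed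

text \<open>
  The \<open>L\<^sup>2\<close> restriction bound, with weights equal to one.
\<close>

lemma mean_square: "integral {0..L} (\<lambda>t. (norm (complex_of_real (\<phi> t)))\<^sup>2) \<le> P * \<sigma>\<^sup>2"
proof -
  have "integral {0..L} (\<lambda>t. (norm (packet (\<lambda>_ _. 1) t))\<^sup>2)
      \<le> (2 * L + 2 * oscillation_const * C1 * (1 * 1 + 2 * L * (1 * 0)) / \<mu> ^ 6) * \<sigma>\<^sup>2"
    unfolding packet_def \<sigma>_square
    by (rule mean_square_bound[where b' = "\<lambda>_ _. 0"]) (use \<mu>_ge_1 lam_eq card_freqs L_pos in auto)
  also have "\<dots> \<le> P * \<sigma>\<^sup>2"
  proof (rule mult_right_mono)
    have "2 * oscillation_const * C1 / \<mu> ^ 6 \<le> 2 * oscillation_const * C1 / 1"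
      using \<mu>_ge_1 oscillation_const_ge_1 C1_ge_1 by (intro divide_left_mono) auto
    then show "2 * L + 2 * oscillation_const * C1 * (1 * 1 + 2 * L * (1 * 0)) / \<mu> ^ 6 \<le> P"
      using P_bounds(2) by simp
  qed simp
  finally have "integral {0..L} (\<lambda>t. (norm (packet (\<lambda>_ _. 1) t))\<^sup>2) \<le> P * \<sigma>\<^sup>2" .
  moreover have "integral {0..L} (\<lambda>t. (norm (complex_of_real (\<phi> t)))\<^sup>2)
      = integral {0..L} (\<lambda>t. (norm (packet (\<lambda>_ _. 1) t))\<^sup>2)"
    by (rule integral_cong) (simp only: expansion packet_def of_real_1 mult_1_left)
  ultimately show ?thesis by linarith
qed

text \<open>
  The weights that select the part of a wave near its stationary points on the path, and the kernels
  that remain when the complementary part is integrated.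
\<close>

definition res :: "real \<Rightarrow> int \<times> int \<Rightarrow> real \<Rightarrow> real" where
  "res \<theta> k t = \<theta>\<^sup>2 / ((dir k \<bullet> g1 t)\<^sup>2 + \<theta>\<^sup>2)"

definition ker :: "real \<Rightarrow> int \<times> int \<Rightarrow> real \<Rightarrow> real" where
  "ker \<theta> k t = (dir k \<bullet> g1 t) / ((dir k \<bullet> g1 t)\<^sup>2 + \<theta>\<^sup>2)"

definition ker' :: "real \<Rightarrow> int \<times> int \<Rightarrow> real \<Rightarrow> real" where
  "ker' \<theta> k t = (dir k \<bullet> g2 t) * ((\<theta>\<^sup>2 - (dir k \<bullet> g1 t)\<^sup>2) / ((dir k \<bullet> g1 t)\<^sup>2 + \<theta>\<^sup>2)\<^sup>2)"

lemma cont_kernels: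
  assumes "\<theta> > 0"
  shows "continuous_on {0..L} (res \<theta> k)" "continuous_on {0..L} (ker \<theta> k)" "continuous_on {0..L} (ker' \<theta> k)"
    "continuous_on {0..L} (\<lambda>t. wave k (g t))"
  unfolding res_def ker_def ker'_def wave_def using assms
  by (auto intro!: continuous_intros conts)

lemma res_plus_ker:
  assumes "\<theta> > 0"
  shows "res \<theta> k t + (dir k \<bullet> g1 t) * ker \<theta> k t = 1"
proof -
  define v where "v = dir k \<bullet> g1 t"
  have "v\<^sup>2 + \<theta>\<^sup>2 \<noteq> 0" using resonance_kernel_bounds(4)[OF assms, of v] by linarith
  then have "(v\<^sup>2 + \<theta>\<^sup>2) / (v\<^sup>2 + \<theta>\<^sup>2) = 1" by (rule divide_self)
  then show ?thesis
    unfolding res_def ker_def v_def add_divide_distrib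
    by (simp only: power2_eq_square times_divide_eq_right add.commute)
qed

lemma abs_ker: "\<theta> > 0 \<Longrightarrow> \<bar>ker \<theta> k t\<bar> \<le> 1 / (2 * \<theta>)"
  unfolding ker_def by (rule resonance_kernel_bounds)

lemma res_range:
  assumes "\<theta> > 0"
  shows "0 \<le> res \<theta> k t" "res \<theta> k t \<le> 1"
  using resonance_kernel_bounds(4)[OF assms, of "dir k \<bullet> g1 t"] by (auto simp: res_def)

lemma ker_derivative:
  assumes "\<theta> > 0" "t \<in> {0<..<L}"
  shows "(ker \<theta> k has_real_derivative ker' \<theta> k t) (at t)"
  using slope_kernel_derivative[of t \<theta> "dir k"] assms at_within_Icc_at[of 0 t L]
  unfolding ker_def ker'_def by auto

lemma abs_ker':
  assumes "\<theta> > 0" "t \<in> {0..L}" "k \<in> K"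
  shows "\<bar>ker' \<theta> k t\<bar> \<le> M / \<theta>\<^sup>2"
proof -
  have "\<bar>(\<theta>\<^sup>2 - (dir k \<bullet> g1 t)\<^sup>2) / ((dir k \<bullet> g1 t)\<^sup>2 + \<theta>\<^sup>2)\<^sup>2\<bar> \<le> 1 / \<theta>\<^sup>2"
    using resonance_kernel_bounds(2,3)[OF assms(1), of "dir k \<bullet> g1 t"] by linarith
  then have "\<bar>ker' \<theta> k t\<bar> \<le> M * (1 / \<theta>\<^sup>2)"
    unfolding ker'_def abs_mult using slope_bounds(2)[OF assms(2) norm_dir[OF assms(3)]] M_pos
    by (intro mult_mono) auto
  then show ?thesis by simp
qed

lemma res_derivative:
  assumes "\<theta> > 0" "t \<in> {0<..<L}"
  shows "(res \<theta> k has_real_derivative - 2 * (dir k \<bullet> g2 t) * res \<theta> k t * ker \<theta> k t) (at t)"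
proof -
  define v where "v = dir k \<bullet> g1 t"
  define b where "b = dir k \<bullet> g2 t"
  have p: "v\<^sup>2 + \<theta>\<^sup>2 \<noteq> 0" using resonance_kernel_bounds(4)[OF assms(1), of v] by linarith
  have at: "at t within {0..L} = at t" using assms at_within_Icc_at[of 0 t L] by auto
  have 1: "((\<lambda>t. dir k \<bullet> g1 t) has_real_derivative b) (at t)"
    using inner_derivs(2)[of t "dir k"] assms unfolding at b_def by auto
  have 2: "((\<lambda>t. (dir k \<bullet> g1 t)\<^sup>2 + \<theta>\<^sup>2) has_real_derivative 2 * v * b) (at t)"
    by (rule derivative_eq_intros 1 refl)+ (simp add: v_def)
  have 3: "((\<lambda>t. \<theta>\<^sup>2) has_real_derivative 0) (at t)" by simp
  have R: "(res \<theta> k has_real_derivative (0 * (v\<^sup>2 + \<theta>\<^sup>2) - \<theta>\<^sup>2 * (2 * v * b)) / ((v\<^sup>2 + \<theta>\<^sup>2) * (v\<^sup>2 + \<theta>\<^sup>2))) (at t)"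
    using DERIV_divide[OF 3 2] p unfolding v_def res_def by blast
  have eq: "(0 * (v\<^sup>2 + \<theta>\<^sup>2) - \<theta>\<^sup>2 * (2 * v * b)) / ((v\<^sup>2 + \<theta>\<^sup>2) * (v\<^sup>2 + \<theta>\<^sup>2))
      = - 2 * b * (\<theta>\<^sup>2 / (v\<^sup>2 + \<theta>\<^sup>2)) * (v / (v\<^sup>2 + \<theta>\<^sup>2))"
    by simp
  show ?thesis
    using R unfolding eq by (simp only: res_def ker_def v_def b_def)
qed

text \<open>
  The condition on \<open>\<theta>\<close> is what lets the gain from the far pairs of frequencies dominate three
  factors \<open>1 / \<theta>\<close>.
\<close>

lemma width_cube:
  assumes "1 \<le> \<theta> * \<mu>\<^sup>2"
  shows "1 / \<mu> ^ 6 \<le> \<theta> ^ 3"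
proof -
  have "1 \<le> (\<theta> * \<mu>\<^sup>2) ^ 3" using assms by (rule one_le_power)
  then show ?thesis using \<mu>_ge_1 by (simp add: power_mult_distrib field_simps flip: power_mult)
qed

text \<open>
  On the diagonal the weights contribute the resonance integral, of size \<open>\<theta>\<close>. Off the diagonal,
  differentiating them costs \<open>1 / \<theta>\<close>, and \<open>\<theta> \<ge> 1 / \<mu>\<^sup>2\<close> guarantees that the gain \<open>1 / \<mu> ^ 6\<close> is at
  most \<open>\<theta> ^ 3\<close>.
\<close>

lemma resonant_mean_square:
  assumes \<theta>: "0 < \<theta>" "\<theta> \<le> 1" "1 \<le> \<theta> * \<mu>\<^sup>2"
  shows "integral {0..L} (\<lambda>t. (norm (packet (res \<theta>) t))\<^sup>2) \<le> P * \<theta> * \<sigma>\<^sup>2"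
proof -
  note \<mu>6 = width_cube[OF \<theta>(3)]
  have "integral {0..L} (\<lambda>t. (norm (packet (res \<theta>) t))\<^sup>2)
      \<le> (2 * (\<theta> * resonance_const) + 2 * oscillation_const * C1 * (1 * 1 + 2 * L * (1 * (M / \<theta>))) / \<mu> ^ 6) * \<sigma>\<^sup>2"
    unfolding packet_def \<sigma>_square
  proof (rule mean_square_bound[where b = "res \<theta>" and b' = "\<lambda>k t. - 2 * (dir k \<bullet> g2 t) * res \<theta> k t * ker \<theta> k t"])
    fix k assume k: "k \<in> K"
    show "continuous_on {0..L} (res \<theta> k)" by (rule cont_kernels[OF \<theta>(1)])
    show "\<bar>res \<theta> k t\<bar> \<le> 1" for t using res_range[OF \<theta>(1), of k t] by auto
    show "(res \<theta> k has_real_derivative - 2 * (dir k \<bullet> g2 t) * res \<theta> k t * ker \<theta> k t) (at t)" if "t \<in> {0<..<L}" for t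
      by (rule res_derivative[OF \<theta>(1) that])
    show "\<bar>- 2 * (dir k \<bullet> g2 t) * res \<theta> k t * ker \<theta> k t\<bar> \<le> M / \<theta>" if "t \<in> {0<..<L}" for t
    proof -
      have "\<bar>- 2 * (dir k \<bullet> g2 t) * res \<theta> k t * ker \<theta> k t\<bar> = 2 * (\<bar>dir k \<bullet> g2 t\<bar> * \<bar>res \<theta> k t\<bar> * \<bar>ker \<theta> k t\<bar>)"
        by (simp add: abs_mult)
      also have "\<dots> \<le> 2 * (M * 1 * (1 / (2 * \<theta>)))"
        using slope_bounds(2)[OF _ norm_dir[OF k], of t] that res_range[OF \<theta>(1), of k t] abs_ker[OF \<theta>(1), of k t] M_pos
        by (intro mult_left_mono mult_mono) auto
      finally show ?thesis by simp
    qed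
    have "integral {0..L} (\<lambda>t. (res \<theta> k t)\<^sup>2) \<le> integral {0..L} (\<lambda>t. \<theta>\<^sup>2 * (1 / ((dir k \<bullet> g1 t)\<^sup>2 + \<theta>\<^sup>2)))"
    proof (rule integral_le)
      show "(\<lambda>t. (res \<theta> k t)\<^sup>2) integrable_on {0..L}"
        by (intro integrable_continuous_interval continuous_intros cont_kernels \<theta>)
      show "(\<lambda>t. \<theta>\<^sup>2 * (1 / ((dir k \<bullet> g1 t)\<^sup>2 + \<theta>\<^sup>2))) integrable_on {0..L}"
        by (intro integrable_continuous_interval continuous_on_mult continuous_on_const continuous_resonance_kernel \<theta>)
      fix t
      have "(res \<theta> k t)\<^sup>2 \<le> res \<theta> k t"
        using res_range[OF \<theta>(1), of k t] by (simp add: power2_eq_square mult_left_le)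
      then show "(res \<theta> k t)\<^sup>2 \<le> \<theta>\<^sup>2 * (1 / ((dir k \<bullet> g1 t)\<^sup>2 + \<theta>\<^sup>2))" by (simp add: res_def)
    qed
    also have "\<dots> = \<theta>\<^sup>2 * integral {0..L} (\<lambda>t. 1 / ((dir k \<bullet> g1 t)\<^sup>2 + \<theta>\<^sup>2))" by (rule integral_mult_right)
    also have "\<dots> \<le> \<theta>\<^sup>2 * (resonance_const / \<theta>)"
      by (intro mult_left_mono resonance_integral norm_dir k \<theta>) auto
    also have "\<dots> = \<theta> * resonance_const" using \<theta> by (simp add: power2_eq_square)
    finally show "integral {0..L} (\<lambda>t. (res \<theta> k t)\<^sup>2) \<le> \<theta> * resonance_const" .
  qed (use \<mu>_ge_1 lam_eq card_freqs M_pos \<theta> in auto)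
  also have "\<dots> \<le> P * \<theta> * \<sigma>\<^sup>2"
  proof (rule mult_right_mono)
    have "(1 * 1 + 2 * L * (1 * (M / \<theta>))) / \<mu> ^ 6 \<le> (1 + 2 * L * (M / \<theta>)) * \<theta> ^ 3"
      using mult_left_mono[OF \<mu>6, of "1 + 2 * L * (M / \<theta>)"] L_pos M_pos \<theta> by simp
    also have "\<dots> = \<theta> * (\<theta>\<^sup>2 + 2 * L * M * \<theta>)"
      using \<theta> by (simp add: power2_eq_square power3_eq_cube distrib_left distrib_right)
    also have "\<dots> \<le> \<theta> * (1 + 2 * L * M * 1)"
      using \<theta> L_pos M_pos by (intro mult_left_mono add_mono) (auto intro: power_le_one)
    finally have "(2 * oscillation_const * C1) * ((1 * 1 + 2 * L * (1 * (M / \<theta>))) / \<mu> ^ 6) \<le> (2 * oscillation_const * C1) * (\<theta> * (1 + 2 * L * M * 1))"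
      using oscillation_const_ge_1 C1_ge_1 by (intro mult_left_mono) auto
    then have "2 * (\<theta> * resonance_const) + 2 * oscillation_const * C1 * (1 * 1 + 2 * L * (1 * (M / \<theta>))) / \<mu> ^ 6
        \<le> (2 * resonance_const + 2 * oscillation_const * C1 * (1 + 2 * L * M)) * \<theta>"
      by (simp add: algebra_simps)
    also have "\<dots> \<le> P * \<theta>" using P_bounds(3) \<theta> by (intro mult_right_mono) auto
    finally show "2 * (\<theta> * resonance_const) + 2 * oscillation_const * C1 * (1 * 1 + 2 * L * (1 * (M / \<theta>))) / \<mu> ^ 6 \<le> P * \<theta>" .
  qed simp
  finally show ?thesis .
qed

text \<open>
  The same argument; the kernels have size \<open>1 / \<theta>\<close> and derivatives of size \<open>1 / \<theta>\<^sup>2\<close>, so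
  the off-diagonal loss is \<open>1 / \<theta> ^ 3\<close>, exactly the gain.
\<close>

lemma kernel_mean_square:
  assumes \<theta>: "0 < \<theta>" "\<theta> \<le> 1" "1 \<le> \<theta> * \<mu>\<^sup>2"
  shows "integral {0..L} (\<lambda>t. (norm (packet (ker \<theta>) t))\<^sup>2) \<le> P / \<theta> * \<sigma>\<^sup>2"
proof -
  note \<mu>6 = width_cube[OF \<theta>(3)]
  have "integral {0..L} (\<lambda>t. (norm (packet (ker \<theta>) t))\<^sup>2)
      \<le> (2 * (resonance_const / \<theta>) + 2 * oscillation_const * C1 * ((1 / \<theta>) * (1 / \<theta>) + 2 * L * ((1 / \<theta>) * (M / \<theta>\<^sup>2))) / \<mu> ^ 6) * \<sigma>\<^sup>2"
    unfolding packet_def \<sigma>_square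
  proof (rule mean_square_bound[where b = "ker \<theta>" and b' = "ker' \<theta>"])
    fix k assume k: "k \<in> K"
    show "continuous_on {0..L} (ker \<theta> k)" by (rule cont_kernels[OF \<theta>(1)])
    show "\<bar>ker \<theta> k t\<bar> \<le> 1 / \<theta>" for t
    proof -
      have "1 / (2 * \<theta>) \<le> 1 / \<theta>" using \<theta> by (simp add: field_simps)
      then show ?thesis using abs_ker[OF \<theta>(1), of k t] by linarith
    qed
    show "(ker \<theta> k has_real_derivative ker' \<theta> k t) (at t)" if "t \<in> {0<..<L}" for t
      by (rule ker_derivative[OF \<theta>(1) that])
    show "\<bar>ker' \<theta> k t\<bar> \<le> M / \<theta>\<^sup>2" if "t \<in> {0<..<L}" for t
      using abs_ker'[OF \<theta>(1) _ k] that by auto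
    have "integral {0..L} (\<lambda>t. (ker \<theta> k t)\<^sup>2) \<le> integral {0..L} (\<lambda>t. 1 / ((dir k \<bullet> g1 t)\<^sup>2 + \<theta>\<^sup>2))"
    proof (rule integral_le)
      show "(\<lambda>t. (ker \<theta> k t)\<^sup>2) integrable_on {0..L}"
        by (intro integrable_continuous_interval continuous_intros cont_kernels \<theta>)
      show "(\<lambda>t. 1 / ((dir k \<bullet> g1 t)\<^sup>2 + \<theta>\<^sup>2)) integrable_on {0..L}"
        by (intro integrable_continuous_interval continuous_resonance_kernel \<theta>)
      fix t
      define v where "v = dir k \<bullet> g1 t"
      have p: "v\<^sup>2 + \<theta>\<^sup>2 > 0" by (rule resonance_kernel_bounds[OF \<theta>(1)])
      have "(v / (v\<^sup>2 + \<theta>\<^sup>2))\<^sup>2 = v\<^sup>2 / (v\<^sup>2 + \<theta>\<^sup>2)\<^sup>2" by (simp add: power_divide)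
      also have "\<dots> \<le> (v\<^sup>2 + \<theta>\<^sup>2) / (v\<^sup>2 + \<theta>\<^sup>2)\<^sup>2" by (intro divide_right_mono) auto
      also have "\<dots> = 1 / (v\<^sup>2 + \<theta>\<^sup>2)" using p by (simp add: power2_eq_square)
      finally show "(ker \<theta> k t)\<^sup>2 \<le> 1 / ((dir k \<bullet> g1 t)\<^sup>2 + \<theta>\<^sup>2)" by (simp add: ker_def v_def)
    qed
    also have "\<dots> \<le> resonance_const / \<theta>"
      by (intro resonance_integral norm_dir k \<theta>)
    finally show "integral {0..L} (\<lambda>t. (ker \<theta> k t)\<^sup>2) \<le> resonance_const / \<theta>" .
  qed (use \<mu>_ge_1 lam_eq card_freqs M_pos \<theta> in auto)
  also have "\<dots> \<le> P / \<theta> * \<sigma>\<^sup>2"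
  proof (rule mult_right_mono)
    define N where "N = (1 / \<theta>) * (1 / \<theta>) + 2 * L * ((1 / \<theta>) * (M / \<theta>\<^sup>2))"
    have "N / \<mu> ^ 6 \<le> N * \<theta> ^ 3"
      using mult_left_mono[OF \<mu>6, of N] L_pos M_pos \<theta> by (simp add: N_def)
    also have "N * \<theta> ^ 3 = \<theta> + 2 * L * M"
      using \<theta> by (simp add: N_def power2_eq_square power3_eq_cube distrib_right)
    also have "\<dots> \<le> 1 + 2 * L * M" using \<theta> by simp
    also have "\<dots> \<le> (1 + 2 * L * M) * (1 / \<theta>)"
      using \<theta> L_pos M_pos by (intro mult_left_mono[of 1 "1 / \<theta>" "1 + 2 * L * M", simplified mult_1_right]) auto
    finally have "(2 * oscillation_const * C1) * (N / \<mu> ^ 6) \<le> (2 * oscillation_const * C1) * ((1 + 2 * L * M) * (1 / \<theta>))"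
      using oscillation_const_ge_1 C1_ge_1 by (intro mult_left_mono) auto
    then have "2 * (resonance_const / \<theta>) + 2 * oscillation_const * C1 * N / \<mu> ^ 6
        \<le> 2 * (resonance_const / \<theta>) + (2 * oscillation_const * C1) * ((1 + 2 * L * M) * (1 / \<theta>))"
      by (simp only: times_divide_eq_right add_left_mono)
    also have "\<dots> = (2 * resonance_const + 2 * oscillation_const * C1 * (1 + 2 * L * M)) / \<theta>"
      unfolding add_divide_distrib[of "2 * resonance_const"] by (simp only: times_divide_eq_right mult_1_right)
    also have "\<dots> \<le> P / \<theta>" using P_bounds(3) \<theta> by (intro divide_right_mono) auto
    finally show "2 * (resonance_const / \<theta>) + 2 * oscillation_const * C1 * ((1 / \<theta>) * (1 / \<theta>) + 2 * L * ((1 / \<theta>) * (M / \<theta>\<^sup>2))) / \<mu> ^ 6 \<le> P / \<theta>"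
      unfolding N_def .
  qed simp
  finally show ?thesis .
qed

end

section \<open>Few sign changes force a small mean value\<close>

context restricted_wave
begin

lemma mean_absolute: "integral {0..L} (\<lambda>t. \<bar>\<phi> t\<bar>) \<le> sqrt (L * P) * \<sigma>"
proof -
  have "norm (integral {0..L} (\<lambda>t. \<bar>\<phi> t\<bar>)) \<le> sqrt (L * (P * \<sigma>\<^sup>2))"
    by (rule weighted_cauchy_schwarz[where w = "\<lambda>_. 1" and f = "\<lambda>t. of_real (\<phi> t)"])
       (use mean_square L_pos in \<open>auto intro!: integrable_continuous_interval continuous_intros cont_\<phi>\<close>)
  also have "\<dots> = sqrt (L * P) * \<sigma>"
    using \<sigma>_nonneg by (simp add: real_sqrt_mult mult.assoc[symmetric])
  finally show ?thesis by simp
qed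

end

text \<open>
  A function \<open>u\<close> with the properties of a smoothed sign of \<open>\<phi>\<close>: bounded by one, with a derivative of
  size \<open>lam\<close> that is supported on a set of measure \<open>q ^ 4\<close>.
\<close>

locale smoothed_wave = restricted_wave +
  fixes u u' w :: "real \<Rightarrow> real" and S :: "real set" and q :: real
  assumes q: "0 < q" "q < 1" and q4_lam: "1 \<le> lam * q ^ 4"
    and cont_u: "continuous_on {0..L} u" and abs_u: "\<And>t. t \<in> {0..L} \<Longrightarrow> \<bar>u t\<bar> \<le> 1"
    and finite_S: "finite S"
    and deriv_u: "\<And>t. t \<in> {0<..<L} - S \<Longrightarrow> (u has_real_derivative u' t) (at t)"
    and abs_deriv_u: "\<And>t. t \<in> {0<..<L} - S \<Longrightarrow> \<bar>u' t\<bar> \<le> 2 * lam * w t"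
    and w: "\<And>t. w t \<in> {0, 1}" "w integrable_on {0..L}" "integral {0..L} w \<le> q ^ 4"
begin

definition \<theta> where "\<theta> = q\<^sup>2"

definition nonres :: "int \<times> int \<Rightarrow> real \<Rightarrow> real" where
  "nonres k t = (dir k \<bullet> g1 t) * ker \<theta> k t"

lemma \<theta>_range: "0 < \<theta>" "\<theta> \<le> 1"
  using q by (auto simp: \<theta>_def power_le_one)

lemma \<theta>_square: "\<theta>\<^sup>2 = q ^ 4"
  by (simp add: \<theta>_def flip: power_mult)

lemma width_condition: "1 \<le> \<mu> * q \<Longrightarrow> 1 \<le> \<theta> * \<mu>\<^sup>2"
  using one_le_power[of "\<mu> * q" 2] by (simp add: \<theta>_def power_mult_distrib mult.commute)

lemma lam_pos: "lam > 0"
  using lam_ge_1 by simp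

lemma w_nonneg: "w t \<ge> 0"
  using w(1)[of t] by auto

lemma cont_packet:
  "continuous_on {0..L} (packet (res \<theta>))" "continuous_on {0..L} (packet (ker \<theta>))"
  "continuous_on {0..L} (packet (ker' \<theta>))" "continuous_on {0..L} (packet nonres)"
  unfolding packet_def nonres_def by (intro continuous_intros cont_kernels[OF \<theta>_range(1)] conts)+

lemma pairing_complex:
  "complex_of_real (integral {0..L} (\<lambda>t. u t * \<phi> t)) = integral {0..L} (\<lambda>t. of_real (u t) * of_real (\<phi> t))"
proof -
  have "(\<lambda>t. u t * \<phi> t) integrable_on {0..L}"
    by (intro integrable_continuous_interval continuous_intros cont_u cont_\<phi>)
  from integral_linear[OF this bounded_linear_of_real[where 'a = complex]] show ?thesis by (simp add: o_def)
qed

text \<open>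
  The total variation of \<open>u\<close> is at most \<open>2 * lam * q ^ 4\<close>, and \<open>\<theta> = q\<^sup>2\<close> balances the two terms of
  the oscillatory integral bound.
\<close>

lemma single_wave_pairing:
  assumes k: "k \<in> K"
  shows "norm (integral {0..L} (\<lambda>t. of_real (u t) * wave k (g t))) \<le> 4 * oscillation_const * q\<^sup>2"
proof -
  have nk: "norm (freq k) = lam" using k by (simp add: circle_freqs_def)
  have "norm (integral {0..L} (\<lambda>t. of_real (u t) * wave k (g t)))
      \<le> oscillation_const * (1 * \<theta> + (1 + 2 * lam * q ^ 4) / (norm (freq k) * \<theta>))"
    unfolding wave_def
  proof (rule oscillatory_integral[where S = S and w = "\<lambda>t. 2 * lam * w t"])
    show "freq k \<noteq> 0" using nk lam_pos by auto
    show "(\<lambda>t. 2 * lam * w t) integrable_on {0..L}" by (intro integrable_on_mult_right w)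
    show "integral {0..L} (\<lambda>t. 2 * lam * w t) \<le> 2 * lam * q ^ 4"
      using mult_left_mono[OF w(3), of "2 * lam"] lam_pos by simp
    show "0 \<le> 2 * lam * w t" for t using lam_pos w_nonneg[of t] by simp
  qed (use \<theta>_range cont_u abs_u finite_S deriv_u abs_deriv_u in auto)
  also have "(1 + 2 * lam * q ^ 4) / (norm (freq k) * \<theta>) \<le> 3 * \<theta>"
  proof -
    have "(1 + 2 * lam * q ^ 4) / (lam * \<theta>) \<le> (3 * \<theta> * (lam * \<theta>)) / (lam * \<theta>)"
      using q4_lam lam_pos \<theta>_range unfolding \<theta>_square[symmetric]
      by (intro divide_right_mono) (auto simp: power2_eq_square mult_ac)
    also have "\<dots> = 3 * \<theta>" using lam_pos \<theta>_range by simp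
    finally show ?thesis by (simp add: nk)
  qed
  finally have "norm (integral {0..L} (\<lambda>t. of_real (u t) * wave k (g t))) \<le> oscillation_const * (1 * \<theta> + 3 * \<theta>)"
    using oscillation_const_ge_1 by simp
  then show ?thesis by (simp add: \<theta>_def)
qed

text \<open>
  The loss \<open>\<mu>\<close> from the number of waves is compensated by one factor \<open>q\<close>.
\<close>

lemma pairing_small_width:
  assumes "\<mu> * q \<le> 1"
  shows "\<bar>integral {0..L} (\<lambda>t. u t * \<phi> t)\<bar> \<le> sqrt C1 * (4 * oscillation_const) * (\<sigma> * q)"
proof -
  have i: "(\<lambda>t. a k * (of_real (u t) * wave k (g t))) integrable_on {0..L}" for k
    by (intro integrable_continuous_interval continuous_intros cont_u cont_kernels[OF \<theta>_range(1)])
  have "complex_of_real (integral {0..L} (\<lambda>t. u t * \<phi> t))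
      = integral {0..L} (\<lambda>t. \<Sum>k\<in>K. a k * (of_real (u t) * wave k (g t)))"
    unfolding pairing_complex by (rule integral_cong) (simp add: expansion sum_distrib_left mult_ac)
  also have "\<dots> = (\<Sum>k\<in>K. a k * integral {0..L} (\<lambda>t. of_real (u t) * wave k (g t)))"
    unfolding integral_mult_right[symmetric] by (rule integral_sum[OF finite_circle_freqs i])
  finally have "\<bar>integral {0..L} (\<lambda>t. u t * \<phi> t)\<bar> = norm (\<Sum>k\<in>K. a k * integral {0..L} (\<lambda>t. of_real (u t) * wave k (g t)))"
    by (metis norm_of_real)
  also have "\<dots> \<le> sqrt C1 * \<mu> * \<sigma> * (4 * oscillation_const * q\<^sup>2)"
    using oscillation_const_ge_1 by (intro norm_weighted_sum single_wave_pairing) auto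
  also have "\<dots> = sqrt C1 * (4 * oscillation_const) * (\<sigma> * q) * (\<mu> * q)"
    by (simp add: power2_eq_square)
  also have "\<dots> \<le> sqrt C1 * (4 * oscillation_const) * (\<sigma> * q) * 1"
    using assms C1_ge_1 oscillation_const_ge_1 \<sigma>_nonneg q by (intro mult_left_mono) auto
  finally show ?thesis by simp
qed

lemma resonant_pairing:
  assumes "1 \<le> \<mu> * q"
  shows "norm (integral {0..L} (\<lambda>t. of_real (u t) * packet (res \<theta>) t)) \<le> sqrt (L * P) * \<sigma> * q"
proof -
  have "norm (integral {0..L} (\<lambda>t. of_real (u t) * packet (res \<theta>) t)) \<le> sqrt (L * (P * \<theta> * \<sigma>\<^sup>2))"
  proof (rule weighted_cauchy_schwarz[where w = "\<lambda>_. 1"])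
    show "(\<lambda>t. of_real (u t) * packet (res \<theta>) t) integrable_on {0..L}"
      by (intro integrable_continuous_interval continuous_intros cont_u cont_packet)
    show "integral {0..L} (\<lambda>t. (norm (packet (res \<theta>) t))\<^sup>2) \<le> P * \<theta> * \<sigma>\<^sup>2"
      by (rule resonant_mean_square[OF \<theta>_range width_condition[OF assms]])
    show "norm (of_real (u t) * packet (res \<theta>) t) \<le> 1 * norm (packet (res \<theta>) t)" if "t \<in> {0..L}" for t
      unfolding norm_mult using abs_u[OF that] by (intro mult_right_mono) auto
  qed (use L_pos cont_packet in auto)
  also have "\<dots> = sqrt (L * P) * \<sigma> * q"
    using \<sigma>_nonneg q by (simp add: real_sqrt_mult \<theta>_def)
  finally show ?thesis .
qed

text \<open>
  Integration by parts against \<open>H\<close>, the packet with the kernels as weights: its derivative is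
  \<open>\<i> * lam\<close> times the nonresonant packet, plus the packet \<open>H1\<close> in which the kernels are
  differentiated. The main term is the one with \<open>u'\<close>; the others are so small that the trivial
  bound for sums of waves suffices.
\<close>

lemma nonresonant_pairing:
  assumes \<mu>q: "1 \<le> \<mu> * q"
  shows "norm (integral {0..L} (\<lambda>t. of_real (u t) * packet nonres t))
    \<le> sqrt C1 * (1 + L * M) * \<sigma> * q + 2 * sqrt P * \<sigma> * q"
proof -
  define H where "H = packet (ker \<theta>)"
  define H1 where "H1 = packet (ker' \<theta>)"
  define N where "N = packet nonres"
  note cH = cont_packet(2)[folded H_def] and cH1 = cont_packet(3)[folded H1_def]
    and cN = cont_packet(4)[folded N_def]
  note packet_defs = H_def H1_def N_def packet_def nonres_def
  have cuN: "continuous_on {0..L} (\<lambda>t. of_real (u t) * N t)"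
    and cuH1: "continuous_on {0..L} (\<lambda>t. of_real (u t) * H1 t)"
    by (intro continuous_intros cont_u cN cH1)+
  \<comment> \<open>\<open>D\<close> is \<open>u'\<close>, set to zero where \<open>u\<close> may fail to be differentiable\<close>
  define D where "D t = (if t \<in> {0<..<L} - S then u' t else 0)" for t
  have ftc: "((\<lambda>t. of_real (D t) * H t + of_real (u t) * H1 t + (\<i> * of_real lam) * (of_real (u t) * N t))
      has_integral (of_real (u L) * H L - of_real (u 0) * H 0)) {0..L}"
  proof (rule fundamental_theorem_of_calculus_interior_strong[OF finite_S])
    show "continuous_on {0..L} (\<lambda>t. of_real (u t) * H t)" by (intro continuous_intros cont_u cH)
    fix t assume t: "t \<in> {0<..<L} - S"
    then have t': "t \<in> {0..L}" and ti: "t \<in> {0<..<L}" and at: "at t within {0..L} = at t"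
      using at_within_Icc_at[of 0 t L] by auto
    have wd: "((\<lambda>t. wave k (g t)) has_vector_derivative (\<i> * of_real (lam * (dir k \<bullet> g1 t)) * wave k (g t))) (at t)" for k
      using wave_derivative[OF t', of "freq k"] unfolding at wave_def freq_dir[of k "g1 t"] .
    have kd: "((\<lambda>t. complex_of_real (ker \<theta> k t)) has_vector_derivative of_real (ker' \<theta> k t)) (at t)" for k
      by (rule has_vector_derivative_of_real[OF ker_derivative[OF \<theta>_range(1) ti]])
    have "(H has_vector_derivative (\<Sum>k\<in>K. a k * (of_real (ker \<theta> k t) * (\<i> * of_real (lam * (dir k \<bullet> g1 t)) * wave k (g t)) + of_real (ker' \<theta> k t) * wave k (g t)))) (at t)"
      unfolding packet_defs
      by (intro has_vector_derivative_sum has_vector_derivative_mult_right has_vector_derivative_mult wd kd)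
    also have "(\<Sum>k\<in>K. a k * (of_real (ker \<theta> k t) * (\<i> * of_real (lam * (dir k \<bullet> g1 t)) * wave k (g t)) + of_real (ker' \<theta> k t) * wave k (g t)))
        = H1 t + (\<i> * of_real lam) * N t"
      unfolding packet_defs sum_distrib_left sum.distrib[symmetric]
      by (intro sum.cong refl) (simp add: algebra_simps)
    finally have Hd: "(H has_vector_derivative (H1 t + (\<i> * of_real lam) * N t)) (at t)" .
    have ud: "((\<lambda>t. complex_of_real (u t)) has_vector_derivative of_real (D t)) (at t)"
      using has_vector_derivative_of_real[OF deriv_u[OF t]] t by (simp add: D_def)
    show "((\<lambda>t. of_real (u t) * H t) has_vector_derivative
        (of_real (D t) * H t + of_real (u t) * H1 t + (\<i> * of_real lam) * (of_real (u t) * N t))) (at t)"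
      using has_vector_derivative_mult[OF ud Hd] by (simp add: algebra_simps)
  qed (use L_pos in auto)
  have iN: "(\<lambda>t. (\<i> * of_real lam) * (of_real (u t) * N t)) integrable_on {0..L}"
    by (intro integrable_on_mult_right integrable_continuous_interval cuN)
  have iH1: "(\<lambda>t. of_real (u t) * H1 t) integrable_on {0..L}" by (rule integrable_continuous_interval[OF cuH1])
  have iDH: "(\<lambda>t. of_real (D t) * H t) integrable_on {0..L}"
    using integrable_diff[OF integrable_diff[OF has_integral_integrable[OF ftc] iN] iH1] by simp
  have "of_real (u L) * H L - of_real (u 0) * H 0
      = integral {0..L} (\<lambda>t. of_real (D t) * H t) + integral {0..L} (\<lambda>t. of_real (u t) * H1 t)
        + (\<i> * of_real lam) * integral {0..L} (\<lambda>t. of_real (u t) * N t)"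
    using integral_unique[OF ftc] integral_add[OF integrable_add[OF iDH iH1] iN] integral_add[OF iDH iH1] by simp
  then have parts: "(\<i> * of_real lam) * integral {0..L} (\<lambda>t. of_real (u t) * N t)
      = (of_real (u L) * H L - of_real (u 0) * H 0) - (integral {0..L} (\<lambda>t. of_real (D t) * H t) + integral {0..L} (\<lambda>t. of_real (u t) * H1 t))"
    by (simp add: algebra_simps)
  define T where "T = sqrt C1 * \<mu> * \<sigma>"
  have T0: "T \<ge> 0" using C1_ge_1 \<mu>_ge_1 \<sigma>_nonneg by (simp add: T_def)
  have Hb: "norm (H t) \<le> T * (1 / (2 * \<theta>))" for t
    unfolding packet_defs T_def using abs_ker[OF \<theta>_range(1)] \<theta>_range by (intro norm_weighted_sum) (auto simp: norm_mult)
  have H1b: "norm (H1 t) \<le> T * (M / \<theta>\<^sup>2)" if "t \<in> {0..L}" for t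
    unfolding packet_defs T_def using abs_ker'[OF \<theta>_range(1) that] \<theta>_range M_pos by (intro norm_weighted_sum) (auto simp: norm_mult)
  have bdry: "norm (of_real (u L) * H L - of_real (u 0) * H 0) \<le> T * (1 / \<theta>\<^sup>2)"
  proof -
    have b: "norm (of_real (u t) * H t) \<le> T * (1 / (2 * \<theta>))" if "t \<in> {0..L}" for t
      using mult_mono[OF abs_u[OF that] Hb[of t]] by (simp add: norm_mult)
    have "norm (of_real (u L) * H L - of_real (u 0) * H 0) \<le> T * (1 / (2 * \<theta>)) + T * (1 / (2 * \<theta>))"
      by (rule order_trans[OF norm_triangle_ineq4 add_mono[OF b b]]) (use L_pos in auto)
    also have "\<dots> = T * (1 / \<theta>)" by simp
    also have "\<dots> \<le> T * (1 / \<theta>\<^sup>2)"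
      using \<theta>_range T0 by (intro mult_left_mono divide_left_mono) (auto simp: power2_eq_square mult_left_le)
    finally show ?thesis .
  qed
  \<comment> \<open>the gain over the trivial bound: \<open>u'\<close> lives on a set of measure \<open>q ^ 4\<close>\<close>
  have DHb: "norm (integral {0..L} (\<lambda>t. of_real (D t) * H t)) \<le> lam * (2 * sqrt P * \<sigma> * q)"
  proof -
    have "norm (integral {0..L} (\<lambda>t. of_real (D t) * H t)) \<le> sqrt (q ^ 4 * (4 * lam\<^sup>2 * (P / \<theta> * \<sigma>\<^sup>2)))"
    proof (rule weighted_cauchy_schwarz[OF iDH, where w = w and f = "\<lambda>t. of_real (2 * lam) * H t"])
      show "continuous_on {0..L} (\<lambda>t. of_real (2 * lam) * H t)" by (intro continuous_intros cH)
      have "integral {0..L} (\<lambda>t. (norm (of_real (2 * lam) * H t))\<^sup>2) = integral {0..L} (\<lambda>t. 4 * lam\<^sup>2 * (norm (H t))\<^sup>2)"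
        by (simp add: norm_mult power_mult_distrib)
      also have "\<dots> = 4 * lam\<^sup>2 * integral {0..L} (\<lambda>t. (norm (H t))\<^sup>2)" by (rule integral_mult_right)
      also have "\<dots> \<le> 4 * lam\<^sup>2 * (P / \<theta> * \<sigma>\<^sup>2)"
        unfolding H_def by (intro mult_left_mono kernel_mean_square \<theta>_range width_condition[OF \<mu>q]) auto
      finally show "integral {0..L} (\<lambda>t. (norm (of_real (2 * lam) * H t))\<^sup>2) \<le> 4 * lam\<^sup>2 * (P / \<theta> * \<sigma>\<^sup>2)" .
      fix t
      have "\<bar>D t\<bar> \<le> 2 * lam * w t" using abs_deriv_u w_nonneg lam_pos by (auto simp: D_def)
      then have "\<bar>D t\<bar> * norm (H t) \<le> (2 * lam * w t) * norm (H t)" by (rule mult_right_mono) simp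
      then show "norm (of_real (D t) * H t) \<le> w t * norm (of_real (2 * lam) * H t)"
        using lam_pos by (simp add: norm_mult mult_ac)
    qed (use w q in simp_all)
    also have "q ^ 4 * (4 * lam\<^sup>2 * (P / \<theta> * \<sigma>\<^sup>2)) = (2 * lam * q * \<sigma>)\<^sup>2 * P"
    proof -
      have "q ^ 4 = \<theta> * q\<^sup>2" unfolding \<theta>_def by (simp flip: power_add)
      then show ?thesis using \<theta>_range by (simp add: power_mult_distrib)
    qed
    also have "sqrt \<dots> = lam * (2 * sqrt P * \<sigma> * q)"
      unfolding real_sqrt_mult using lam_pos q \<sigma>_nonneg by simp
    finally show ?thesis .
  qed
  have H1int: "norm (integral {0..L} (\<lambda>t. of_real (u t) * H1 t)) \<le> T * (M / \<theta>\<^sup>2) * (L - 0)"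
  proof (rule integral_bound)
    show "norm (of_real (u t) * H1 t) \<le> T * (M / \<theta>\<^sup>2)" if "t \<in> {0..L}" for t
      using mult_mono[OF abs_u[OF that] H1b[OF that]] by (simp add: norm_mult)
  qed (use L_pos cuH1 in auto)
  have "lam * norm (integral {0..L} (\<lambda>t. of_real (u t) * N t)) = norm ((\<i> * of_real lam) * integral {0..L} (\<lambda>t. of_real (u t) * N t))"
    using lam_pos by (simp add: norm_mult)
  also have "\<dots> \<le> T * (1 / \<theta>\<^sup>2) + (lam * (2 * sqrt P * \<sigma> * q) + T * (M / \<theta>\<^sup>2) * (L - 0))"
    unfolding parts
    by (rule order_trans[OF norm_triangle_ineq4 add_mono[OF bdry order_trans[OF norm_triangle_ineq add_mono[OF DHb H1int]]]])
  also have "\<dots> = T * (1 + L * M) / \<theta>\<^sup>2 + lam * (2 * sqrt P * \<sigma> * q)"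
    by (simp add: add_divide_distrib distrib_left mult_ac)
  \<comment> \<open>these terms lose at most \<open>\<mu> / \<theta>\<^sup>2 = \<mu> / q ^ 4\<close>, against \<open>lam = \<mu> ^ 48\<close>\<close>
  also have "T * (1 + L * M) / \<theta>\<^sup>2 \<le> lam * (sqrt C1 * (1 + L * M) * \<sigma> * q)"
  proof -
    have "1 \<le> (\<mu> * q) ^ 5 * \<mu> ^ 42"
      using mult_mono[OF one_le_power[OF \<mu>q, of 5] one_le_power[OF \<mu>_ge_1, of 42]] \<mu>q by simp
    then have "\<mu> * 1 \<le> \<mu> * ((\<mu> * q) ^ 5 * \<mu> ^ 42)" using \<mu>_ge_1 by (intro mult_left_mono) auto
    also have "\<dots> = lam * q ^ 5"
      unfolding lam_eq power_mult_distrib by (simp add: mult_ac flip: power_add power_Suc)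
    finally have "\<mu> \<le> lam * q * \<theta>\<^sup>2"
      unfolding \<theta>_square by (simp add: mult.assoc flip: power_Suc)
    then have "\<mu> / \<theta>\<^sup>2 \<le> lam * q"
      using \<theta>_range by (simp add: pos_divide_le_eq)
    then have "(sqrt C1 * \<sigma> * (1 + L * M)) * (\<mu> / \<theta>\<^sup>2) \<le> (sqrt C1 * \<sigma> * (1 + L * M)) * (lam * q)"
      using C1_ge_1 \<sigma>_nonneg L_pos M_pos by (intro mult_left_mono) auto
    then show ?thesis by (simp add: T_def mult_ac)
  qed
  finally have "lam * norm (integral {0..L} (\<lambda>t. of_real (u t) * N t))
      \<le> lam * (sqrt C1 * (1 + L * M) * \<sigma> * q + 2 * sqrt P * \<sigma> * q)"
    by (simp add: distrib_left)
  then show ?thesis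
    using lam_pos by (simp add: N_def)
qed

lemma pairing_bound:
  "\<bar>integral {0..L} (\<lambda>t. u t * \<phi> t)\<bar>
    \<le> (2 * sqrt P + sqrt (L * P) + sqrt C1 * (4 * oscillation_const + 1 + L * M)) * (\<sigma> * q)"
proof (cases "\<mu> * q \<le> 1")
  case True
  have "sqrt C1 * (4 * oscillation_const) \<le> sqrt C1 * (4 * oscillation_const + 1 + L * M)"
    using C1_ge_1 L_pos M_pos by (intro mult_left_mono) auto
  moreover have "0 \<le> 2 * sqrt P + sqrt (L * P)" using P_bounds(1) L_pos by simp
  ultimately have "sqrt C1 * (4 * oscillation_const) \<le> 2 * sqrt P + sqrt (L * P) + sqrt C1 * (4 * oscillation_const + 1 + L * M)"
    by linarith
  from mult_right_mono[OF this, of "\<sigma> * q"] pairing_small_width[OF True] show ?thesis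
    using \<sigma>_nonneg q by simp
next
  case False
  then have \<mu>q: "1 \<le> \<mu> * q" by simp
  have split: "of_real (\<phi> t) = packet (res \<theta>) t + packet nonres t" if "t \<in> {0..L}" for t
  proof -
    have "packet (res \<theta>) t + packet nonres t
        = (\<Sum>k\<in>K. a k * (of_real (res \<theta> k t + (dir k \<bullet> g1 t) * ker \<theta> k t) * wave k (g t)))"
      unfolding packet_def nonres_def sum.distrib[symmetric] by (intro sum.cong refl) (simp add: algebra_simps)
    then show ?thesis using expansion[OF that] by (simp only: res_plus_ker[OF \<theta>_range(1)] of_real_1 mult_1_left)
  qed
  have "complex_of_real (integral {0..L} (\<lambda>t. u t * \<phi> t))
      = integral {0..L} (\<lambda>t. of_real (u t) * packet (res \<theta>) t + of_real (u t) * packet nonres t)"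
    unfolding pairing_complex by (rule integral_cong) (simp add: split distrib_left)
  also have "\<dots> = integral {0..L} (\<lambda>t. of_real (u t) * packet (res \<theta>) t) + integral {0..L} (\<lambda>t. of_real (u t) * packet nonres t)"
    by (intro integral_add integrable_continuous_interval continuous_intros cont_u cont_packet)
  finally have "\<bar>integral {0..L} (\<lambda>t. u t * \<phi> t)\<bar>
      = norm (integral {0..L} (\<lambda>t. of_real (u t) * packet (res \<theta>) t) + integral {0..L} (\<lambda>t. of_real (u t) * packet nonres t))"
    by (metis norm_of_real)
  also have "\<dots> \<le> sqrt (L * P) * \<sigma> * q + (sqrt C1 * (1 + L * M) * \<sigma> * q + 2 * sqrt P * \<sigma> * q)"
    by (rule order_trans[OF norm_triangle_ineq add_mono[OF resonant_pairing nonresonant_pairing]]) (rule \<mu>q)+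
  also have "\<dots> = (2 * sqrt P + sqrt (L * P) + sqrt C1 * (1 + L * M)) * (\<sigma> * q)"
    by (simp add: distrib_right mult.assoc)
  also have "\<dots> \<le> (2 * sqrt P + sqrt (L * P) + sqrt C1 * (4 * oscillation_const + 1 + L * M)) * (\<sigma> * q)"
    using C1_ge_1 oscillation_const_ge_1 \<sigma>_nonneg q by (intro mult_right_mono add_left_mono mult_left_mono) auto
  finally show ?thesis .
qed

end

context restricted_wave
begin

text \<open>
  The smoothed sign at scale \<open>1 / lam\<close> differs from the sign of \<open>\<phi>\<close> on a set of measure \<open>q ^ 4\<close>
  only.
\<close>

lemma restriction_bound_few_sign_changes:
  fixes q :: real
  assumes fin: "finite {t \<in> {0..L}. \<phi> t = 0}"
    and q: "0 < q" "q < 1" "q ^ 4 = real (Suc (card {t \<in> {0..L}. \<phi> t = 0})) / lam"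
  shows "integral {0..L} (\<lambda>t. \<bar>\<phi> t\<bar>) \<le> restriction_const C1 * \<sigma> * q"
proof -
  define m where "m = Suc (card {t \<in> {0..L}. \<phi> t = 0})"
  have m1: "real m \<ge> 1" by (simp add: m_def)
  have \<eta>: "q ^ 4 = real m / lam" using q(3) by (simp add: m_def)
  have q4_pos: "0 < q ^ 4" using q(1) by simp
  have qq: "q\<^sup>2 \<le> q" using q by (simp add: power2_eq_square)
  have invlam: "1 / lam > 0" using lam_ge_1 by simp
  obtain u u' w S where u: "continuous_on {0..L} u" "\<And>t. t \<in> {0..L} \<Longrightarrow> \<bar>u t\<bar> \<le> 1" "finite S"
    "\<And>t. t \<in> {0<..<L} - S \<Longrightarrow> (u has_real_derivative u' t) (at t)"
    "\<And>t. t \<in> {0<..<L} - S \<Longrightarrow> \<bar>u' t\<bar> \<le> (2 / (1 / lam)) * w t"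
    "\<And>t. t \<in> {0..L} \<Longrightarrow> \<bar>sgn (\<phi> t) - u t\<bar> \<le> 2 * w t"
    and w: "\<And>t. w t \<in> {0, 1}" "w integrable_on {0..L}" "integral {0..L} w \<le> real m * (1 / lam)"
    unfolding m_def by (rule sign_smoothing[OF L_pos invlam cont_\<phi> fin]) blast
  have w\<eta>: "integral {0..L} w \<le> q ^ 4" using w(3) \<eta> by simp
  interpret smoothed_wave L \<kappa> M g g1 g2 g3 C1 \<mu> lam a \<phi> u u' w S q
    using q(1,2) m1 \<eta> lam_ge_1 u(1-5) w(1,2) w\<eta> by unfold_locales simp_all
  have cu\<phi>: "continuous_on {0..L} (\<lambda>t. u t * \<phi> t)" by (intro continuous_intros u cont_\<phi>)
  have ca\<phi>: "continuous_on {0..L} (\<lambda>t. \<bar>\<phi> t\<bar>)" by (intro continuous_intros cont_\<phi>)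
  define I where "I = integral {0..L} (\<lambda>t. \<bar>\<phi> t\<bar>)"
  define I' where "I' = integral {0..L} (\<lambda>t. u t * \<phi> t)"
  have near: "I - I' \<le> 2 * sqrt P * \<sigma> * q"
  proof -
    have "norm (integral {0..L} (\<lambda>t. \<bar>\<phi> t\<bar> - u t * \<phi> t)) \<le> sqrt (q ^ 4 * (4 * (P * \<sigma>\<^sup>2)))"
    proof (rule weighted_cauchy_schwarz[where w = w and f = "\<lambda>t. 2 * complex_of_real (\<phi> t)"])
      show "(\<lambda>t. \<bar>\<phi> t\<bar> - u t * \<phi> t) integrable_on {0..L}"
        by (intro integrable_diff integrable_continuous_interval cu\<phi> ca\<phi>)
      show "continuous_on {0..L} (\<lambda>t. 2 * complex_of_real (\<phi> t))"
        by (intro continuous_intros cont_\<phi>)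
      have "integral {0..L} (\<lambda>t. (norm (2 * complex_of_real (\<phi> t)))\<^sup>2) = integral {0..L} (\<lambda>t. 4 * (norm (complex_of_real (\<phi> t)))\<^sup>2)"
        by (simp add: norm_mult power_mult_distrib)
      also have "\<dots> = 4 * integral {0..L} (\<lambda>t. (norm (complex_of_real (\<phi> t)))\<^sup>2)" by (rule integral_mult_right)
      finally show "integral {0..L} (\<lambda>t. (norm (2 * complex_of_real (\<phi> t)))\<^sup>2) \<le> 4 * (P * \<sigma>\<^sup>2)"
        using mean_square by simp
      show "norm (\<bar>\<phi> t\<bar> - u t * \<phi> t) \<le> w t * norm (2 * complex_of_real (\<phi> t))" if "t \<in> {0..L}" for t
      proof -
        have "\<bar>\<phi> t\<bar> - u t * \<phi> t = (sgn (\<phi> t) - u t) * \<phi> t"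
          by (simp add: abs_sgn algebra_simps)
        then have "norm (\<bar>\<phi> t\<bar> - u t * \<phi> t) \<le> (2 * w t) * \<bar>\<phi> t\<bar>"
          using u(6)[OF that] by (simp add: abs_mult mult_right_mono)
        then show ?thesis by (simp add: norm_mult mult_ac)
      qed
    qed (use w(1,2) w\<eta> q4_pos in simp_all)
    also have "sqrt (q ^ 4 * (4 * (P * \<sigma>\<^sup>2))) = q\<^sup>2 * (2 * (sqrt P * \<sigma>))"
    proof -
      have "sqrt (q ^ 4) = q\<^sup>2" by (rule real_sqrt_unique) auto
      then show ?thesis
        unfolding real_sqrt_mult using \<sigma>_nonneg by simp
    qed
    also have "\<dots> \<le> q * (2 * (sqrt P * \<sigma>))"
      using qq \<sigma>_nonneg P_bounds(1) by (intro mult_right_mono) auto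
    finally have "norm (integral {0..L} (\<lambda>t. \<bar>\<phi> t\<bar> - u t * \<phi> t)) \<le> 2 * sqrt P * \<sigma> * q" by (simp add: mult_ac)
    moreover have "integral {0..L} (\<lambda>t. \<bar>\<phi> t\<bar> - u t * \<phi> t) = I - I'"
      unfolding I_def I'_def by (intro integral_diff integrable_continuous_interval cu\<phi> ca\<phi>)
    ultimately show ?thesis by simp
  qed
  have "I \<le> \<bar>I'\<bar> + 2 * sqrt P * \<sigma> * q" using near by linarith
  also have "\<dots> \<le> (2 * sqrt P + sqrt (L * P) + sqrt C1 * (4 * oscillation_const + 1 + L * M)) * (\<sigma> * q) + 2 * sqrt P * \<sigma> * q"
    using pairing_bound by (simp add: I'_def)
  also have "\<dots> = restriction_const C1 * \<sigma> * q"
    by (simp add: restriction_const_def distrib_right mult.assoc)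
  finally show ?thesis by (simp add: I_def)
qed

text \<open>
  For \<open>q < 1\<close> the preceding lemma gives even the fourth power; otherwise \<open>q ^ 4 \<ge> 1\<close> and the mean
  square bound suffices.
\<close>

theorem sign_changes_lower_bound:
  assumes fin: "finite {t \<in> {0..L}. \<phi> t = 0}"
  shows "(integral {0..L} (\<lambda>t. \<bar>\<phi> t\<bar>)) ^ 5
    \<le> (restriction_const C1 * \<sigma>) ^ 5 * (real (Suc (card {t \<in> {0..L}. \<phi> t = 0})) / lam)"
proof -
  define \<eta> where "\<eta> = real (Suc (card {t \<in> {0..L}. \<phi> t = 0})) / lam"
  have \<eta>0: "\<eta> > 0" using lam_ge_1 by (simp add: \<eta>_def)
  define q where "q = sqrt (sqrt \<eta>)"
  have q0: "q > 0" using \<eta>0 by (simp add: q_def)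
  have q4: "q ^ 4 = \<eta>"
  proof -
    have "q ^ 4 = (q\<^sup>2)\<^sup>2" by simp
    then show ?thesis using \<eta>0 by (simp add: q_def)
  qed
  define I where "I = integral {0..L} (\<lambda>t. \<bar>\<phi> t\<bar>)"
  have I0: "I \<ge> 0"
    unfolding I_def by (intro integral_nonneg integrable_continuous_interval continuous_intros cont_\<phi>) auto
  define C where "C = restriction_const C1"
  have C: "sqrt (L * P) \<le> C" "C \<ge> 0"
  proof -
    have p: "0 \<le> 4 * sqrt P" "0 \<le> sqrt (L * P)" "0 \<le> sqrt C1 * (4 * oscillation_const + 1 + L * M)"
      using P_bounds(1) C1_ge_1 oscillation_const_ge_1 L_pos M_pos by auto
    then show "sqrt (L * P) \<le> C" "C \<ge> 0" by (auto simp: C_def restriction_const_def)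
  qed
  have "I ^ 5 \<le> (C * \<sigma>) ^ 5 * \<eta>"
  proof (cases "q < 1")
    case True
    have "I \<le> C * \<sigma> * q"
      unfolding I_def C_def using fin q0 True q4 by (intro restriction_bound_few_sign_changes) (auto simp: \<eta>_def)
    then have "I ^ 5 \<le> (C * \<sigma> * q) ^ 5" using I0 by (rule power_mono)
    also have "\<dots> = (C * \<sigma>) ^ 5 * (q ^ 4 * q)" by (simp add: power_mult_distrib flip: power_Suc2)
    also have "\<dots> \<le> (C * \<sigma>) ^ 5 * (q ^ 4 * 1)"
      using True q0 C \<sigma>_nonneg by (intro mult_left_mono) auto
    finally show ?thesis using q4 by simp
  next
    case False
    then have "\<eta> \<ge> 1" unfolding q4[symmetric] by (intro one_le_power) auto
    have "I \<le> sqrt (L * P) * \<sigma>" unfolding I_def by (rule mean_absolute)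
    also have "\<dots> \<le> C * \<sigma>" using C \<sigma>_nonneg by (intro mult_right_mono)
    finally have "I ^ 5 \<le> (C * \<sigma>) ^ 5 * 1" using I0 by (simp add: power_mono)
    also have "\<dots> \<le> (C * \<sigma>) ^ 5 * \<eta>" using \<open>\<eta> \<ge> 1\<close> C \<sigma>_nonneg by (intro mult_left_mono) auto
    finally show ?thesis .
  qed
  then show ?thesis by (simp add: I_def C_def \<eta>_def)
qed

end

section \<open>Existence of a zero and multiplicity of the parameterization\<close>

context curved_path
begin

lemma wave_integral_decay:
  assumes "norm \<zeta> \<ge> 1"
  shows "norm (integral {0..L} (\<lambda>t. cis (\<zeta> \<bullet> g t))) \<le> 2 * oscillation_const / sqrt (norm \<zeta>)"
  using oscillatory_integral_decay[of \<zeta> "\<lambda>_. 1" "\<lambda>_. 0" 1 0] assms by simp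

text \<open>
  Equality would force \<open>\<zeta> \<bullet> g\<close> to be constant modulo \<open>2 * pi\<close>, so that \<open>g1\<close> and \<open>g2\<close> would both be
  orthogonal to \<open>\<zeta>\<close>; but they span the plane.
\<close>

lemma wave_integral_less_length:
  assumes "\<zeta> \<noteq> 0"
  shows "norm (integral {0..L} (\<lambda>t. cis (\<zeta> \<bullet> g t))) < L"
proof (rule ccontr)
  assume nless: "\<not> norm (integral {0..L} (\<lambda>t. cis (\<zeta> \<bullet> g t))) < L"
  define E where "E t = cis (\<zeta> \<bullet> g t)" for t
  have cE: "continuous_on {0..L} E" unfolding E_def by (intro continuous_intros conts)
  define Z where "Z = integral {0..L} E"
  have iE: "E integrable_on {0..L}" by (rule integrable_continuous_interval[OF cE])
  have "norm Z \<le> 1 * (L - 0)"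
    unfolding Z_def using L_pos cE by (intro integral_bound) (auto simp: E_def)
  then have nZ: "norm Z = L" using nless by (simp add: Z_def E_def[abs_def])
  \<comment> \<open>the rotation that turns the integral into its largest possible value \<open>L\<close>\<close>
  define d where "d = cnj Z / of_real L"
  have nd: "norm d = 1" using nZ L_pos by (simp add: d_def norm_divide)
  have le1: "Re (d * E t) \<le> 1" for t
    using complex_Re_le_cmod[of "d * E t"] nd by (simp add: norm_mult E_def)
  have "((\<lambda>t. d * E t) has_integral d * Z) {0..L}"
    unfolding Z_def using iE by (intro has_integral_mult_right integrable_integral)
  moreover have "d * Z = of_real L"
  proof -
    have "d * Z = (Z * cnj Z) / of_real L" by (simp add: d_def mult.commute)
    also have "Z * cnj Z = of_real L * of_real L"
      using complex_norm_square[of Z] nZ by (simp add: power2_eq_square)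
    finally show ?thesis using L_pos by simp
  qed
  ultimately have dE: "((\<lambda>t. d * E t) has_integral of_real L) {0..L}" by simp
  have "((\<lambda>t. Re (d * E t)) has_integral L) {0..L}"
    using has_integral_linear[OF dE bounded_linear_Re] by (simp add: o_def)
  from has_integral_diff[OF has_integral_const_real[of "1::real" 0 L] this]
  have I0: "((\<lambda>t. 1 - Re (d * E t)) has_integral 0) (cbox 0 L)" using L_pos by simp
  have zero: "1 - Re (d * E t) = 0" if "t \<in> {0..L}" for t
    by (rule has_integral_0_cbox_imp_0[OF _ _ I0])
       (use le1 L_pos that cE in \<open>auto intro!: continuous_intros\<close>)
  have const: "d * E t = 1" if "t \<in> {0..L}" for t
  proof -
    have "Re (d * E t) = 1" using zero[OF that] by simp
    moreover have "(Re (d * E t))\<^sup>2 + (Im (d * E t))\<^sup>2 = 1"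
      using cmod_power2[of "d * E t"] nd by (simp add: norm_mult E_def)
    ultimately show ?thesis by (auto simp: complex_eq_iff)
  qed
  have E0: "E t = inverse d" if "t \<in> {0..L}" for t
    using const[OF that] by (metis inverse_unique)
  have v0: "\<zeta> \<bullet> g1 t = 0" if t: "t \<in> {0..L}" for t
  proof -
    have "((\<lambda>t. inverse d) has_vector_derivative (\<i> * of_real (\<zeta> \<bullet> g1 t) * E t)) (at t within {0..L})"
      by (rule has_vector_derivative_transform[OF t _ wave_derivative[OF t, of \<zeta>, folded E_def]])
         (simp add: E0 E_def[symmetric])
    then have "\<i> * of_real (\<zeta> \<bullet> g1 t) * E t = 0"
      using vector_derivative_unique_within_closed_interval[of 0 L t] t L_pos
      by (metis cbox_interval has_vector_derivative_const)
    then show ?thesis by (simp add: E_def)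
  qed
  define e where "e = (1 / norm \<zeta>) *\<^sub>R \<zeta>"
  have e: "norm e = 1" using assms by (simp add: e_def)
  have 0: "0 \<in> {0..L}" using L_pos by auto
  have "((\<lambda>t. 0) has_vector_derivative (e \<bullet> g2 0)) (at 0 within {0..L})"
  proof (rule has_vector_derivative_transform[OF 0])
    show "((\<lambda>t. e \<bullet> g1 t) has_vector_derivative (e \<bullet> g2 0)) (at 0 within {0..L})"
      using inner_derivs(2)[OF 0] by (simp add: has_real_derivative_iff_has_vector_derivative)
    show "0 = e \<bullet> g1 t" if "t \<in> {0..L}" for t using v0[OF that] by (simp add: e_def)
  qed
  then have g20: "e \<bullet> g2 0 = 0"
    using vector_derivative_unique_within_closed_interval[of 0 L 0] L_pos 0
    by (metis cbox_interval has_vector_derivative_const)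
  have g10: "e \<bullet> g1 0 = 0" using v0[OF 0] by (simp add: e_def)
  show False
    using acceleration_lower[OF 0 e] \<kappa>_pos unfolding g10 g20 by simp
qed

text \<open>
  A uniform form of the preceding lemma: large frequencies decay, and finitely many remain.
\<close>

lemma wave_integral_gap:
  "\<exists>c>0. \<forall>k. k \<noteq> 0 \<longrightarrow> norm (integral {0..L} (\<lambda>t. cis (freq k \<bullet> g t))) \<le> L - c"
proof -
  define J where "J k = norm (integral {0..L} (\<lambda>t. cis (freq k \<bullet> g t)))" for k
  define B where "B = max 1 ((4 * oscillation_const / L)\<^sup>2)"
  define A where "A = insert (L / 2) ((\<lambda>k. L - J k) ` {k. norm (freq k) \<le> B \<and> k \<noteq> 0})"
  have finA: "finite A" unfolding A_def
    by (intro finite.insertI finite_imageI finite_subset[OF _ finite_bounded_freqs[of B]]) auto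
  have less: "J k < L" if "k \<noteq> 0" for k
    unfolding J_def using norm_freq_ge_1[OF that] by (intro wave_integral_less_length) auto
  have pos: "x > 0" if "x \<in> A" for x
    using that less L_pos unfolding A_def by force
  have "J k \<le> L - Min A" if "k \<noteq> 0" for k
  proof (cases "norm (freq k) \<le> B")
    case True
    then have "L - J k \<in> A" using that by (auto simp: A_def)
    then have "Min A \<le> L - J k" using finA by simp
    then show ?thesis by simp
  next
    case False
    then have n: "norm (freq k) \<ge> 1" "(4 * oscillation_const / L)\<^sup>2 \<le> norm (freq k)" by (auto simp: B_def)
    have s: "4 * oscillation_const / L \<le> sqrt (norm (freq k))" by (rule real_le_rsqrt[OF n(2)])
    have s0: "sqrt (norm (freq k)) > 0" by (rule real_sqrt_gt_zero) (use n(1) in linarith)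
    have "J k \<le> 2 * oscillation_const / sqrt (norm (freq k))"
      unfolding J_def by (rule wave_integral_decay[OF n(1)])
    also have "\<dots> \<le> L / 2" using s s0 L_pos by (simp add: field_simps)
    finally have "J k \<le> L - L / 2" by simp
    moreover have "Min A \<le> L / 2" using Min_le[OF finA, of "L / 2"] by (simp add: A_def)
    ultimately show ?thesis by simp
  qed
  moreover have "Min A > 0" using finA pos by (simp add: A_def)
  ultimately show ?thesis unfolding J_def by blast
qed

text \<open>
  Short arcs move forward in the direction of their initial tangent vector, so their endpoints differ
  in the plane; and they are too short to differ by a nonzero lattice vector.
\<close>

lemma short_arcs_injective:
  "\<exists>\<delta>>0. \<forall>s\<in>{0..L}. \<forall>t\<in>{0..L}. s < t \<longrightarrow> t - s < \<delta> \<longrightarrow> torus_of (g s) \<noteq> torus_of (g t)"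
proof -
  have "uniformly_continuous_on {0..L} g1"
    by (intro compact_uniformly_continuous conts) simp
  then obtain \<delta>1 where \<delta>1: "\<delta>1 > 0" "\<And>s t. s \<in> {0..L} \<Longrightarrow> t \<in> {0..L} \<Longrightarrow> dist t s < \<delta>1 \<Longrightarrow> dist (g1 t) (g1 s) < 1"
    unfolding uniformly_continuous_on_def by (metis zero_less_one)
  have "torus_of (g s) \<noteq> torus_of (g t)"
    if st: "s \<in> {0..L}" "t \<in> {0..L}" "s < t" "t - s < min \<delta>1 1" for s t
  proof
    assume eq: "torus_of (g s) = torus_of (g t)"
    have sub: "{s..t} \<subseteq> {0..L}" using st by auto
    have d: "(g has_derivative (\<lambda>h. h *\<^sub>R g1 r)) (at r within {s..t})" if "r \<in> {s..t}" for r
      using has_vector_derivative_within_subset[OF deriv0 sub] that sub by (auto simp: has_vector_derivative_def)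
    have "\<exists>r\<in>{s<..<t}. (g t \<bullet> g1 s) - (g s \<bullet> g1 s) = ((t - s) *\<^sub>R g1 r) \<bullet> g1 s"
      by (rule mvt_simple[OF st(3), of "\<lambda>r. g r \<bullet> g1 s" "\<lambda>r h. (h *\<^sub>R g1 r) \<bullet> g1 s"])
         (rule has_derivative_inner_left[OF d], simp)
    then obtain r where r: "r \<in> {s<..<t}" "(g t - g s) \<bullet> g1 s = (t - s) * (g1 r \<bullet> g1 s)"
      by (auto simp: inner_diff_left)
    have rL: "r \<in> {0..L}" using r sub by auto
    have "norm (g1 r - g1 s) < 1" using \<delta>1(2)[OF st(1) rL] r st by (auto simp: dist_norm)
    then have "(norm (g1 r - g1 s))\<^sup>2 < 1" by (simp add: abs_square_less_1)
    moreover have "(norm (g1 r - g1 s))\<^sup>2 = 2 - 2 * (g1 r \<bullet> g1 s)"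
      using unit_speed[OF rL] unit_speed[OF st(1)]
      by (simp add: power2_norm_eq_inner inner_diff_left inner_diff_right inner_commute norm_eq_1)
    ultimately have "g1 r \<bullet> g1 s > 0" by simp
    then have ne: "g t \<noteq> g s" using r(2) st(3) by auto
    have "\<exists>r\<in>{s<..<t}. norm (g t - g s) \<le> norm ((t - s) *\<^sub>R g1 r)"
    proof (rule mvt_general[OF st(3), of g "\<lambda>r h. h *\<^sub>R g1 r"])
      show "continuous_on {s..t} g" by (rule continuous_on_subset[OF conts(1) sub])
      show "(g has_derivative (\<lambda>h. h *\<^sub>R g1 r)) (at r)" if "s < r" "r < t" for r
        using d[of r] at_within_Icc_at[of s r t] that by simp
    qed
    then obtain r' where "r' \<in> {s<..<t}" "norm (g t - g s) \<le> (t - s) * norm (g1 r')" using st by auto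
    then have small: "norm (g t - g s) < 1" using unit_speed[of r'] sub st by auto
    obtain m n :: int where mn: "g t = g s + (2 * pi * of_int m, 2 * pi * of_int n)"
      using eq by (auto simp: torus_of_eq_iff lattice_equiv_def)
    then have "g t - g s = (2 * pi) *\<^sub>R freq (m, n)" by (simp add: freq_def)
    moreover have "(m, n) \<noteq> 0" using ne mn by (auto simp: prod_eq_iff)
    ultimately have "norm (g t - g s) \<ge> 2 * pi" using norm_freq_ge_1[of "(m, n)"] by simp
    then show False using small pi_gt3 by linarith
  qed
  then show ?thesis using \<delta>1(1) by (intro exI[of _ "min \<delta>1 1"]) auto
qed

text \<open>
  Parameters of the same point of the torus lie in different intervals of length \<open>\<delta>\<close>, where \<open>\<delta>\<close> is
  an injectivity length.
\<close>

lemma fibres_bounded: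
  "\<exists>N::nat. N > 0 \<and> (\<forall>p. finite {t \<in> {0..L}. torus_of (g t) = p} \<and> card {t \<in> {0..L}. torus_of (g t) = p} \<le> N)"
proof -
  obtain \<delta> where \<delta>: "\<delta> > 0"
    "\<And>s t. s \<in> {0..L} \<Longrightarrow> t \<in> {0..L} \<Longrightarrow> s < t \<Longrightarrow> t - s < \<delta> \<Longrightarrow> torus_of (g s) \<noteq> torus_of (g t)"
    using short_arcs_injective by blast
  define N where "N = Suc (nat \<lfloor>L / \<delta>\<rfloor>)"
  have "finite A \<and> card A \<le> N" if A: "A = {t \<in> {0..L}. torus_of (g t) = p}" for p A
  proof -
    define f where "f t = nat \<lfloor>t / \<delta>\<rfloor>" for t
    have mem: "f t \<in> {..nat \<lfloor>L / \<delta>\<rfloor>}" if "t \<in> A" for t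
      using that \<delta> by (auto simp: f_def A intro!: nat_mono floor_mono divide_right_mono)
    have eq: "\<not> s < t" if "s \<in> A" "t \<in> A" "f s = f t" for s t
    proof
      assume "s < t"
      have "0 \<le> s / \<delta>" "0 \<le> t / \<delta>" using that \<delta> by (auto simp: A)
      then have "\<lfloor>s / \<delta>\<rfloor> = \<lfloor>t / \<delta>\<rfloor>" using that(3) by (simp add: f_def eq_nat_nat_iff)
      then have "t / \<delta> - s / \<delta> < 1" by linarith
      then have "t - s < \<delta>" using \<delta> by (simp add: field_simps)
      then show False using \<delta>(2)[of s t] that \<open>s < t\<close> by (auto simp: A)
    qed
    have inj: "inj_on f A"
      by (rule inj_onI) (metis eq linorder_neqE_linordered_idom)
    have "finite A" by (rule inj_on_finite[OF inj, of "{..nat \<lfloor>L / \<delta>\<rfloor>}"]) (use mem in auto)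
    moreover have "card A \<le> card {..nat \<lfloor>L / \<delta>\<rfloor>}"
      by (rule card_inj_on_le[OF inj]) (use mem in auto)
    ultimately show ?thesis by (simp add: N_def)
  qed
  then show ?thesis by (intro exI[of _ N]) (auto simp: N_def)
qed

end

context restricted_wave
begin

text \<open>
  Without a zero, the integral \<open>I\<close> of \<open>\<bar>\<phi>\<bar>\<close> is the absolute value of that of \<open>\<phi>\<close>, in which every
  wave decays. On the other hand, \<open>I\<close> bounds the integral of \<open>\<phi>\<close> against the conjugate of the wave
  with the largest coefficient \<open>\<alpha>\<close> in absolute value. There the wave itself contributes \<open>\<alpha> * L\<close>, a possible close
  neighbour at most \<open>\<alpha> * (L - c)\<close>, and all others decay. Hence \<open>\<alpha> * c\<close> is bounded by
  decaying terms, a contradiction for large \<open>\<mu>\<close>.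
\<close>

lemma zero_exists:
  assumes gap: "\<And>k. k \<noteq> 0 \<Longrightarrow> norm (integral {0..L} (\<lambda>t. cis (freq k \<bullet> g t))) \<le> L - c"
    and \<sigma>: "\<sigma> > 0" and large: "4 * oscillation_const * C1 < c * \<mu>"
  shows "\<exists>t\<in>{0..L}. \<phi> t = 0"
proof (rule ccontr)
  assume "\<not> (\<exists>t\<in>{0..L}. \<phi> t = 0)"
  then have nz: "\<And>t. t \<in> {0..L} \<Longrightarrow> \<phi> t \<noteq> 0" by blast
  have finK: "finite K" by (rule finite_circle_freqs)
  have lam0: "lam > 0" using lam_ge_1 by simp
  have Kne: "K \<noteq> {}" using \<sigma> by (auto simp: \<sigma>_def)
  define \<alpha> where "\<alpha> = Max ((\<lambda>k. norm (a k)) ` K)"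
  have \<alpha>_ge: "norm (a k) \<le> \<alpha>" if "k \<in> K" for k using that finK by (simp add: \<alpha>_def)
  have "\<alpha> \<in> (\<lambda>k. norm (a k)) ` K" unfolding \<alpha>_def using finK Kne by (intro Max_in) auto
  then obtain k0 where k0: "k0 \<in> K" "norm (a k0) = \<alpha>" by auto
  have \<alpha>0: "\<alpha> > 0"
  proof (rule ccontr)
    assume "\<not> \<alpha> > 0"
    then have "norm (a k) = 0" if "k \<in> K" for k using \<alpha>_ge[OF that] norm_ge_zero[of "a k"] by linarith
    then show False using \<sigma> by (simp add: \<sigma>_def)
  qed
  define J where "J k = integral {0..L} (\<lambda>t. cis ((freq k - freq k0) \<bullet> g t))" for k
  define I where "I = integral {0..L} (\<lambda>t. \<bar>\<phi> t\<bar>)"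
  have c\<phi>: "continuous_on {0..L} (\<lambda>t. complex_of_real (\<phi> t))" by (intro continuous_intros cont_\<phi>)
  have cwave: "continuous_on {0..L} (\<lambda>t. cis (\<zeta> \<bullet> g t))" for \<zeta> by (intro continuous_intros conts)
  have upper: "I \<le> real (card K) * (\<alpha> * (2 * oscillation_const / \<mu> ^ 8))"
  proof -
    have "I = norm (integral {0..L} \<phi>)"
    proof -
      define s where "s = sgn (\<phi> 0)"
      have s: "\<bar>s\<bar> = 1" using nz[of 0] L_pos by (simp add: s_def abs_sgn_eq)
      have "I = integral {0..L} (\<lambda>t. s * \<phi> t)"
        unfolding I_def
      proof (rule integral_cong)
        fix t assume t: "t \<in> {0..L}"
        have "sgn (\<phi> t) = s" unfolding s_def by (rule sgn_constant_without_zeros[OF cont_\<phi> nz t])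
        then show "\<bar>\<phi> t\<bar> = s * \<phi> t" by (simp add: abs_sgn mult.commute)
      qed
      also have "\<dots> = s * integral {0..L} \<phi>" by (rule integral_mult_right)
      finally have "\<bar>I\<bar> = norm (integral {0..L} \<phi>)" using s by (simp add: abs_mult)
      moreover have "I \<ge> 0"
        unfolding I_def by (intro integral_nonneg integrable_continuous_interval continuous_intros cont_\<phi>) auto
      ultimately show ?thesis by simp
    qed
    also have "\<dots> = norm (complex_of_real (integral {0..L} \<phi>))" by simp
    also have "complex_of_real (integral {0..L} \<phi>) = integral {0..L} (\<lambda>t. complex_of_real (\<phi> t))"
      using integral_linear[OF integrable_continuous_interval[OF cont_\<phi>] bounded_linear_of_real[where 'a = complex]]
      by (simp add: o_def)
    also have "\<dots> = integral {0..L} (\<lambda>t. \<Sum>k\<in>K. a k * cis (freq k \<bullet> g t))"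
      by (rule integral_cong) (simp add: expansion wave_def)
    also have "\<dots> = (\<Sum>k\<in>K. a k * integral {0..L} (\<lambda>t. cis (freq k \<bullet> g t)))"
      unfolding integral_mult_right[symmetric]
      by (intro integral_sum finK integrable_on_mult_right integrable_continuous_interval cwave)
    also have "norm \<dots> \<le> (\<Sum>k\<in>K. \<alpha> * (2 * oscillation_const / \<mu> ^ 8))"
    proof (rule sum_norm_le)
      fix k assume k: "k \<in> K"
      then have nk: "norm (freq k) = lam" by (simp add: circle_freqs_def)
      have "\<mu> ^ 16 \<le> \<mu> ^ 48" using \<mu>_ge_1 by (intro power_increasing) auto
      then have "\<mu> ^ 8 \<le> sqrt lam" unfolding lam_eq by (intro real_le_rsqrt) (simp flip: power_mult)
      then have "2 * oscillation_const / sqrt lam \<le> 2 * oscillation_const / \<mu> ^ 8"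
        using \<mu>_ge_1 lam0 oscillation_const_ge_1 by (intro divide_left_mono) auto
      then have "norm (integral {0..L} (\<lambda>t. cis (freq k \<bullet> g t))) \<le> 2 * oscillation_const / \<mu> ^ 8"
        using wave_integral_decay[of "freq k"] lam_ge_1 unfolding nk by linarith
      then show "norm (a k * integral {0..L} (\<lambda>t. cis (freq k \<bullet> g t))) \<le> \<alpha> * (2 * oscillation_const / \<mu> ^ 8)"
        unfolding norm_mult using \<alpha>_ge[OF k] \<alpha>0 by (intro mult_mono) auto
    qed
    finally show ?thesis by simp
  qed
  have lower: "\<alpha> * c \<le> I + real (card K) * (\<alpha> * (2 * oscillation_const / \<mu> ^ 8))"
  proof -
    define near where "near = {l \<in> K. norm (freq k0 - freq l) < \<mu> ^ 16} - {k0}"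
    have fin_near: "finite near" using finK by (simp add: near_def)
    have lam3: "lam = (\<mu> ^ 16) ^ 3" unfolding lam_eq by (simp flip: power_mult)
    have card_near: "card near \<le> 1"
    proof -
      have "k0 \<in> {l \<in> K. norm (freq k0 - freq l) < \<mu> ^ 16}" using k0 \<mu>_ge_1 by simp
      then show ?thesis
        using card_near_frequencies[OF lam0 lam3 k0(1)] finK by (simp add: near_def card_Diff_singleton)
    qed
    have c_le: "0 \<le> L - c"
      using gap[of "(1, 0)"] norm_ge_zero order_trans by (metis prod.inject zero_neq_one zero_prod_def)
    have Jb: "norm (J k) \<le> (if k \<in> near then L - c else 0) + 2 * oscillation_const / \<mu> ^ 8" if "k \<in> K - {k0}" for k
    proof (cases "k \<in> near")
      case True
      have "norm (J k) \<le> L - c" using gap[of "k - k0"] that by (simp add: J_def freq_diff)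
      then show ?thesis using True oscillation_const_ge_1 \<mu>_ge_1 by (simp add: add_increasing2)
    next
      case False
      then have far: "norm (freq k - freq k0) \<ge> \<mu> ^ 16" using that by (auto simp: near_def norm_minus_commute)
      then have "\<mu> ^ 8 \<le> sqrt (norm (freq k - freq k0))" by (intro real_le_rsqrt) (simp flip: power_mult)
      moreover have "1 \<le> \<mu> ^ 16" using \<mu>_ge_1 by simp
      moreover have "\<mu> ^ 8 > 0" using \<mu>_ge_1 by simp
      ultimately have "2 * oscillation_const / sqrt (norm (freq k - freq k0)) \<le> 2 * oscillation_const / \<mu> ^ 8"
        "norm (freq k - freq k0) \<ge> 1"
        using far oscillation_const_ge_1 by (auto intro!: divide_left_mono mult_pos_pos)
      then show ?thesis using wave_integral_decay[of "freq k - freq k0"] False unfolding J_def by simp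
    qed
    have sumJ: "(\<Sum>k\<in>K - {k0}. norm (J k)) \<le> (L - c) + real (card K) * (2 * oscillation_const / \<mu> ^ 8)"
    proof -
      have "(\<Sum>k\<in>K - {k0}. norm (J k)) \<le> (\<Sum>k\<in>K - {k0}. (if k \<in> near then L - c else 0) + 2 * oscillation_const / \<mu> ^ 8)"
        by (rule sum_mono) (rule Jb)
      also have "\<dots> = real (card near) * (L - c) + real (card (K - {k0})) * (2 * oscillation_const / \<mu> ^ 8)"
      proof -
        have "(K - {k0}) \<inter> near = near" by (auto simp: near_def)
        then show ?thesis using finK by (simp add: sum.distrib sum.If_cases)
      qed
      also have "\<dots> \<le> 1 * (L - c) + real (card K) * (2 * oscillation_const / \<mu> ^ 8)"
        using card_near c_le finK oscillation_const_ge_1 \<mu>_ge_1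
        by (intro add_mono mult_right_mono) (auto intro: card_mono)
      finally show ?thesis by simp
    qed
    have Jk0: "J k0 = of_real L" using L_pos by (simp add: J_def scaleR_conv_of_real)
    have eq: "integral {0..L} (\<lambda>t. of_real (\<phi> t) * cis (- (freq k0 \<bullet> g t))) = (\<Sum>k\<in>K. a k * J k)"
    proof -
      have "integral {0..L} (\<lambda>t. of_real (\<phi> t) * cis (- (freq k0 \<bullet> g t))) = integral {0..L} (\<lambda>t. \<Sum>k\<in>K. a k * cis ((freq k - freq k0) \<bullet> g t))"
      proof (rule integral_cong)
        fix t assume "t \<in> {0..L}"
        from expansion[OF this] show "of_real (\<phi> t) * cis (- (freq k0 \<bullet> g t)) = (\<Sum>k\<in>K. a k * cis ((freq k - freq k0) \<bullet> g t))"
          by (simp add: sum_distrib_right wave_def mult.assoc cis_mult inner_diff_left)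
      qed
      also have "\<dots> = (\<Sum>k\<in>K. a k * J k)"
        unfolding J_def integral_mult_right[symmetric]
        by (intro integral_sum finK integrable_on_mult_right integrable_continuous_interval cwave)
      finally show ?thesis .
    qed
    have cint: "continuous_on {0..L} (\<lambda>t. of_real (\<phi> t) * cis (- (freq k0 \<bullet> g t)))"
      by (intro continuous_intros c\<phi> conts)
    have "norm (\<Sum>k\<in>K. a k * J k) \<le> I"
      unfolding eq[symmetric] I_def
      by (rule integral_norm_bound_integral)
         (auto intro!: integrable_continuous_interval cint continuous_on_rabs cont_\<phi> simp: norm_mult)
    moreover have "(\<Sum>k\<in>K. a k * J k) = a k0 * of_real L + (\<Sum>k\<in>K - {k0}. a k * J k)"
      using finK k0(1) Jk0 by (simp add: sum.remove)
    moreover have "norm (\<Sum>k\<in>K - {k0}. a k * J k) \<le> \<alpha> * ((L - c) + real (card K) * (2 * oscillation_const / \<mu> ^ 8))"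
    proof -
      have "norm (\<Sum>k\<in>K - {k0}. a k * J k) \<le> (\<Sum>k\<in>K - {k0}. \<alpha> * norm (J k))"
        using \<alpha>_ge by (intro sum_norm_le) (auto simp: norm_mult mult_right_mono)
      also have "\<dots> = \<alpha> * (\<Sum>k\<in>K - {k0}. norm (J k))" by (simp add: sum_distrib_left)
      also have "\<dots> \<le> \<alpha> * ((L - c) + real (card K) * (2 * oscillation_const / \<mu> ^ 8))"
        using sumJ \<alpha>0 by (intro mult_left_mono) auto
      finally show ?thesis .
    qed
    moreover have "norm (a k0 * of_real L) = \<alpha> * L" using k0 L_pos by (simp add: norm_mult)
    moreover have "norm (a k0 * of_real L) \<le> norm (a k0 * of_real L + (\<Sum>k\<in>K - {k0}. a k * J k)) + norm (\<Sum>k\<in>K - {k0}. a k * J k)"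
      using norm_triangle_ineq4[of "a k0 * of_real L + (\<Sum>k\<in>K - {k0}. a k * J k)" "\<Sum>k\<in>K - {k0}. a k * J k"]
      by simp
    ultimately have "\<alpha> * L \<le> I + \<alpha> * ((L - c) + real (card K) * (2 * oscillation_const / \<mu> ^ 8))"
      by simp
    then show ?thesis by (simp add: algebra_simps)
  qed
  have "\<alpha> * c \<le> \<alpha> * (real (card K) * (4 * oscillation_const / \<mu> ^ 8))"
  proof -
    have "\<alpha> * (real (card K) * (4 * oscillation_const / \<mu> ^ 8)) = 2 * (real (card K) * (\<alpha> * (2 * oscillation_const / \<mu> ^ 8)))"
      by simp
    then show ?thesis using upper lower by linarith
  qed
  then have "c \<le> real (card K) * (4 * oscillation_const / \<mu> ^ 8)"
    using mult_le_cancel_left_pos[OF \<alpha>0] by blast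
  also have "\<dots> \<le> (C1 * \<mu>\<^sup>2) * (4 * oscillation_const / \<mu> ^ 8)"
    using card_freqs oscillation_const_ge_1 \<mu>_ge_1 by (intro mult_right_mono) auto
  also have "\<dots> = 4 * oscillation_const * C1 / \<mu> ^ 6"
    using \<mu>_ge_1 by (simp add: field_simps flip: power_add)
  finally have "c * \<mu> ^ 6 \<le> 4 * oscillation_const * C1"
    using \<mu>_ge_1 by (simp add: pos_le_divide_eq)
  moreover have "c * \<mu> \<le> c * \<mu> ^ 6"
  proof (rule mult_left_mono)
    show "\<mu> \<le> \<mu> ^ 6" using \<mu>_ge_1 by (intro self_le_power) auto
    have "0 < c * \<mu>" using large oscillation_const_ge_1 C1_ge_1 by (intro less_trans[OF _ large]) simp
    then show "0 \<le> c" using \<mu>_ge_1 by (simp add: zero_less_mult_iff)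
  qed
  ultimately show False using large by linarith
qed

end

section \<open>The lower bound for the number of zeros\<close>

text \<open>
  The curvature has a positive minimum by compactness.
\<close>

lemma smooth_arclength_curved_path:
  assumes L: "L > 0" and par: "smooth_arclength_param L \<gamma> g"
    and curv: "\<forall>t\<in>{0..L}. arclength_curvature L g t \<noteq> 0"
  shows "\<exists>\<kappa> M g1 g2 g3. curved_path L \<kappa> M g g1 g2 g3"
proof -
  define G where "G n = nth_deriv {0..L} n g" for n
  have G0: "G 0 = g" by (simp add: G_def nth_deriv_def)
  have smooth: "G n differentiable_on {0..L}" for n
    using par by (simp add: smooth_arclength_param_def smooth_path_def G_def)
  have GS: "G (Suc n) t = vector_derivative (G n) (at t within {0..L})" for n t
    by (simp add: G_def nth_deriv_def)
  have dG: "(G n has_vector_derivative G (Suc n) t) (at t within {0..L})" if "t \<in> {0..L}" for n t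
    using smooth[of n] that unfolding GS vector_derivative_works[symmetric] differentiable_on_def by blast
  have cG: "continuous_on {0..L} (G n)" for n
    using smooth by (rule differentiable_imp_continuous_on)
  have cnG: "continuous_on {0..L} (\<lambda>t. norm (G n t))" for n
    by (intro continuous_intros cG)
  have ne: "{0..L} \<noteq> {}" using L by auto
  obtain t2 where t2: "t2 \<in> {0..L}" "\<And>t. t \<in> {0..L} \<Longrightarrow> norm (G 2 t2) \<le> norm (G 2 t)"
    using continuous_attains_inf[OF compact_Icc ne cnG[of 2]] by blast
  obtain s2 where s2: "\<And>t. t \<in> {0..L} \<Longrightarrow> norm (G 2 t) \<le> norm (G 2 s2)"
    using continuous_attains_sup[OF compact_Icc ne cnG[of 2]] by blast
  obtain s3 where s3: "\<And>t. t \<in> {0..L} \<Longrightarrow> norm (G 3 t) \<le> norm (G 3 s3)"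
    using continuous_attains_sup[OF compact_Icc ne cnG[of 3]] by blast
  have "curved_path L (norm (G 2 t2)) (max (norm (G 2 s2)) (norm (G 3 s3))) g (G 1) (G 2) (G 3)"
  proof
    show "L > 0" by (rule L)
    show "norm (G 2 t2) > 0" using curv t2(1) by (simp add: arclength_curvature_def G_def)
    show "continuous_on {0..L} (G 3)" by (rule cG)
    fix t assume t: "t \<in> {0..L}"
    show "(g has_vector_derivative G 1 t) (at t within {0..L})"
      "(G 1 has_vector_derivative G 2 t) (at t within {0..L})"
      "(G 2 has_vector_derivative G 3 t) (at t within {0..L})"
      using dG[OF t, of 0] dG[OF t, of 1] dG[OF t, of 2] by (simp_all add: G0 numeral_2_eq_2 numeral_3_eq_3)
    show "norm (G 1 t) = 1" using par t by (simp add: smooth_arclength_param_def G_def)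
    show "norm (G 2 t2) \<le> norm (G 2 t)" by (rule t2(2)[OF t])
    show "norm (G 2 t) \<le> max (norm (G 2 s2)) (norm (G 3 s3))"
      "norm (G 3 t) \<le> max (norm (G 2 s2)) (norm (G 3 s3))"
      using s2[OF t] s3[OF t] by auto
  qed
  then show ?thesis by blast
qed

theorem theorem1p2:
  fixes L :: real and C :: "torus set" and \<gamma> :: "real \<Rightarrow> torus"
    and g :: "real \<Rightarrow> real \<times> real"
  assumes "L > 0"
    and "C = \<gamma> ` {0..L}"
    and "smooth_arclength_param L \<gamma> g"
    and "\<forall>t\<in>{0..L}. arclength_curvature L g t \<noteq> 0"
  shows "\<exists>c lam0 :: real. c > 0 \<and> lam0 > 0 \<and>
    (\<forall>lam\<ge>lam0. \<forall>F :: torus \<Rightarrow> real. torus_eigenfunction lam F \<and> F \<noteq> (\<lambda>_. 0) \<longrightarrow>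
       zero_count F C \<ge>
         ennreal (c * lam * ((1 / torus_L2_norm F) * curve_integral L \<gamma> (\<lambda>x. \<bar>F x\<bar>)) ^ 5))"
proof -
  obtain \<kappa> M g1 g2 g3 where "curved_path L \<kappa> M g g1 g2 g3"
    using smooth_arclength_curved_path[OF assms(1,3,4)] by blast
  then interpret curved_path L \<kappa> M g g1 g2 g3 .
  have \<gamma>: "\<gamma> t = torus_of (g t)" if "t \<in> {0..L}" for t
    using assms(3) that by (simp add: smooth_arclength_param_def)
  obtain C0 where C0: "C0 > 0" "\<And>lam. lam \<ge> 1 \<Longrightarrow> real (card (circle_freqs lam)) \<le> C0 * lam powr (1 / 24)"
    using circle_freqs_subpolynomial[of "1 / 24"] by auto
  define C1 where "C1 = max 1 C0"
  obtain c where c: "c > 0" "\<And>k. k \<noteq> 0 \<Longrightarrow> norm (integral {0..L} (\<lambda>t. cis (freq k \<bullet> g t))) \<le> L - c"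
    using wave_integral_gap by blast
  obtain N where N: "N > 0" "\<And>p. finite {t \<in> {0..L}. torus_of (g t) = p}"
    "\<And>p. card {t \<in> {0..L}. torus_of (g t) = p} \<le> N"
    using fibres_bounded by blast
  \<comment> \<open>\<open>zero_exists\<close> applies as soon as \<open>\<mu> \<ge> b\<close>\<close>
  define b where "b = 4 * oscillation_const * C1 / c + 1"
  have b1: "b \<ge> 1" using oscillation_const_ge_1 c(1) by (simp add: b_def C1_def)
  define D where "D = max 1 (restriction_const C1)"
  define c0 where "c0 = (2 * pi) ^ 5 / (D ^ 5 * (2 * real N))"
  have D0: "D > 0" by (simp add: D_def)
  have c00: "c0 > 0" using N(1) D0 by (simp add: c0_def)
  have "zero_count F C \<ge> ennreal (c0 * lam * ((1 / torus_L2_norm F) * curve_integral L \<gamma> (\<lambda>x. \<bar>F x\<bar>)) ^ 5)"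
    if lam: "lam \<ge> b ^ 48" and eig: "torus_eigenfunction lam F" and F0: "F \<noteq> (\<lambda>_. 0)" for lam F
  proof (cases "finite ({x. F x = 0} \<inter> C)")
    case False
    then show ?thesis by (simp add: zero_count_def)
  next
    case True
    have lam1: "lam \<ge> 1" using lam one_le_power[OF b1, of 48] by linarith
    obtain a where a: "\<And>z. of_real (F (torus_of z)) = (\<Sum>k\<in>circle_freqs lam. a k * wave k z)"
      and norm_F: "torus_L2_norm F = 2 * pi * sqrt (\<Sum>k\<in>circle_freqs lam. (norm (a k))\<^sup>2)"
      using eigenfunction_expansion[OF eig] lam1 by auto
    define \<mu> where "\<mu> = lam powr (1 / 48)"
    define \<phi> where "\<phi> t = F (torus_of (g t))" for t
    have \<mu>48: "\<mu> ^ 48 = lam"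
      using lam1 by (simp add: \<mu>_def powr_powr flip: powr_realpow)
    have \<mu>b: "\<mu> \<ge> b"
    proof (rule power_le_imp_le_base[of _ 47])
      show "b ^ Suc 47 \<le> \<mu> ^ Suc 47" using lam \<mu>48 by simp
      show "0 \<le> \<mu>" by (simp add: \<mu>_def)
    qed
    have contF: "continuous_on UNIV (F \<circ> torus_of)"
      using eig by (intro differentiable_imp_continuous_on) (simp add: torus_eigenfunction_def C2_def)
    have cont\<phi>: "continuous_on {0..L} \<phi>"
      using continuous_on_compose2[OF contF conts(1)] by (simp add: \<phi>_def[abs_def])
    interpret restricted_wave L \<kappa> M g g1 g2 g3 C1 \<mu> lam a \<phi>
    proof unfold_locales
      show "1 \<le> \<mu>" using \<mu>b b1 by linarith
      show "lam = \<mu> ^ 48" using \<mu>48 by simp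
      show "1 \<le> C1" by (simp add: C1_def)
      have "\<mu>\<^sup>2 = lam powr (1 / 24)"
        using lam1 by (simp add: \<mu>_def powr_powr flip: powr_realpow)
      then have "real (card (circle_freqs lam)) \<le> C0 * \<mu>\<^sup>2" using C0(2)[OF lam1] by simp
      also have "\<dots> \<le> C1 * \<mu>\<^sup>2" by (intro mult_right_mono) (auto simp: C1_def)
      finally show "real (card (circle_freqs lam)) \<le> C1 * \<mu>\<^sup>2" .
      show "continuous_on {0..L} \<phi>" by (rule cont\<phi>)
      show "of_real (\<phi> t) = (\<Sum>k\<in>circle_freqs lam. a k * wave k (g t))" for t
        unfolding \<phi>_def by (rule a)
    qed
    have norm_\<sigma>: "torus_L2_norm F = 2 * pi * \<sigma>" using norm_F by (simp add: \<sigma>_def)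
    have \<sigma>0: "\<sigma> > 0"
    proof (rule ccontr)
      assume "\<not> \<sigma> > 0"
      then have "(\<Sum>k\<in>K. (norm (a k))\<^sup>2) = 0" using \<sigma>_nonneg \<sigma>_square by simp
      then have "\<forall>k\<in>K. a k = 0" by (subst (asm) sum_nonneg_eq_0_iff) (auto simp: finite_circle_freqs)
      then have "F (torus_of z) = 0" for z using a[of z] by simp
      then have "F = (\<lambda>_. 0)" using surj_torus_of by (metis surjD ext)
      then show False using F0 by contradiction
    qed
    define Z where "Z = {x. F x = 0} \<inter> C"
    define T where "T = {t \<in> {0..L}. \<phi> t = 0}"
    have T_sub: "T \<subseteq> (\<Union>p\<in>Z. {t \<in> {0..L}. torus_of (g t) = p})"
    proof
      fix t assume "t \<in> T"
      then have t: "t \<in> {0..L}" "F (torus_of (g t)) = 0" by (auto simp: T_def \<phi>_def)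
      have "torus_of (g t) \<in> C"
        using imageI[OF t(1), of \<gamma>] \<gamma>[OF t(1)] unfolding assms(2) by simp
      then have "torus_of (g t) \<in> Z" using t(2) by (simp add: Z_def)
      then show "t \<in> (\<Union>p\<in>Z. {t \<in> {0..L}. torus_of (g t) = p})" using t(1) by blast
    qed
    have finU: "finite (\<Union>p\<in>Z. {t \<in> {0..L}. torus_of (g t) = p})"
      using True N(2) by (auto simp: Z_def)
    have finT: "finite T" using T_sub finU by (rule finite_subset)
    have "card T \<le> card (\<Union>p\<in>Z. {t \<in> {0..L}. torus_of (g t) = p})" using finU T_sub by (rule card_mono)
    also have "\<dots> \<le> (\<Sum>p\<in>Z. card {t \<in> {0..L}. torus_of (g t) = p})"
      using True by (intro card_UN_le) (simp add: Z_def)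
    also have "\<dots> \<le> (\<Sum>p\<in>Z. N)" by (intro sum_mono N)
    finally have card_T: "card T \<le> card Z * N" by simp
    have "4 * oscillation_const * C1 < c * \<mu>"
    proof -
      have "4 * oscillation_const * C1 < c * b" using c(1) by (simp add: b_def field_simps)
      also have "\<dots> \<le> c * \<mu>" using \<mu>b c(1) by simp
      finally show ?thesis .
    qed
    then obtain t0 where "t0 \<in> T" using zero_exists[OF c(2) \<sigma>0] by (auto simp: T_def)
    then have "card T \<ge> 1" using finT by (metis One_nat_def Suc_leI card_gt_0_iff empty_iff)
    then have "Suc (card T) \<le> 2 * (card Z * N)" using card_T by linarith
    then have m: "real (Suc (card T)) \<le> 2 * (real (card Z) * real N)"
      by (metis of_nat_le_iff of_nat_mult of_nat_numeral)
    define I where "I = integral {0..L} (\<lambda>t. \<bar>\<phi> t\<bar>)"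
    have I0: "I \<ge> 0"
      unfolding I_def by (intro integral_nonneg integrable_continuous_interval continuous_intros cont\<phi>) auto
    have curve: "curve_integral L \<gamma> (\<lambda>x. \<bar>F x\<bar>) = I"
    proof -
      have "curve_integral L \<gamma> (\<lambda>x. \<bar>F x\<bar>) = set_lebesgue_integral lborel {0..L} (\<lambda>t. \<bar>\<phi> t\<bar>)"
        unfolding curve_integral_def by (rule set_lebesgue_integral_cong) (auto simp: \<phi>_def \<gamma>)
      also have "\<dots> = I"
      proof -
        have "set_integrable lborel {0..L} (\<lambda>t. \<bar>\<phi> t\<bar>)"
          unfolding set_integrable_def by (intro borel_integrable_compact continuous_intros cont\<phi>) simp
        then show ?thesis unfolding I_def by (rule set_borel_integral_eq_integral(2))
      qed
      finally show ?thesis .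
    qed
    have "I ^ 5 \<le> (restriction_const C1 * \<sigma>) ^ 5 * (real (Suc (card T)) / lam)"
      using sign_changes_lower_bound finT unfolding I_def T_def by blast
    also have "\<dots> \<le> (D * \<sigma>) ^ 5 * (2 * (real (card Z) * real N) / lam)"
    proof (rule mult_mono)
      have "0 \<le> restriction_const C1"
        using P_bounds(1) C1_ge_1 oscillation_const_ge_1 L_pos M_pos by (simp add: restriction_const_def)
      then show "(restriction_const C1 * \<sigma>) ^ 5 \<le> (D * \<sigma>) ^ 5"
        using \<sigma>_nonneg by (intro power_mono mult_right_mono) (auto simp: D_def)
    qed (use m lam1 D0 \<sigma>_nonneg in \<open>auto intro!: divide_right_mono\<close>)
    finally have I5: "I ^ 5 * lam \<le> (D * \<sigma>) ^ 5 * (2 * (real (card Z) * real N))"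
      using lam1 by (simp add: field_simps)
    have "c0 * lam * ((1 / torus_L2_norm F) * I) ^ 5 = c0 / ((2 * pi * \<sigma>) ^ 5) * (I ^ 5 * lam)"
      by (simp add: norm_\<sigma> power_mult_distrib power_divide)
    also have "\<dots> \<le> c0 / ((2 * pi * \<sigma>) ^ 5) * ((D * \<sigma>) ^ 5 * (2 * (real (card Z) * real N)))"
      using I5 c00 \<sigma>0 by (intro mult_left_mono) auto
    also have "\<dots> = real (card Z)"
      using \<sigma>0 D0 N(1) unfolding c0_def power_mult_distrib by (simp add: field_simps)
    finally have "ennreal (c0 * lam * ((1 / torus_L2_norm F) * I) ^ 5) \<le> ennreal (real (card Z))"
      by (rule ennreal_leI)
    also have "\<dots> = zero_count F C"
      using True by (simp add: zero_count_def Z_def ennreal_of_nat_eq_real_of_nat)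
    finally show ?thesis unfolding curve .
  qed
  moreover have "b ^ 48 > 0" using b1 by simp
  ultimately show ?thesis
    using c00 by (intro exI[of _ c0] exI[of _ "b ^ 48"]) blast
qed

end
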